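(* Let $n\in\mathbb N$, $\alpha>0$, $1<p<\infty$ and $\frac1p+\frac1{p'}=1$. Then \[ \inf_{h\in\mathcal{H}^n_{p',\alpha}\setminus\{0\}} \frac{\|\langle\cdot,h\rangle_\alpha\|^\ast_{p,\alpha}}{\|h\|_{p',\alpha}}=1, \qquad\text{where}\qquad \|\langle\cdot,h\rangle_\alpha\|^\ast_{p,\alpha}=\sup_{g\in\mathcal{H}^n_{p,\alpha}\setminus\{0\}}\frac{|\langle g,h\rangle_\alpha|}{\|g\|_{p,\alpha}}. \] Moreover, for every $z\in\mathbb C^n$ and every $g\in\mathcal{H}^n_{p,\alpha}$, \[ |g(z)|\le e^{\frac{\alpha}{2}|z|^2}\|g\|_{p,\alpha}. \]
   Context: For $\alpha>0$ and $n\in\mathbb N$, $\gamma^n_\alpha$ is the probability measure $\gamma^n_\alpha(dz)=(\alpha/\pi)^n e^{-\alpha|z|^2}\lambda^n(dz)$ on $\mathbb C^n$, where $\lambda^n$ is Lebesgue measure. For $1\le p<\infty$, $\mathcal{H}^n_{p,\alpha}$ is the space of holomorphic functions $f$ on $\mathbb C^n$ with $\|f\|_{p,\alpha}:=\left(\int_{\mathbb C^n}|f|^p\,d\gamma^n_{\alpha p/2}\right)^{1/p}<\infty$. The pairing is $\langle f,g\rangle_\alpha=\int_{\mathbb C^n} f\overline{g}\,d\gamma^n_\alpha$. *)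

theory Defs
  imports "HOL-Analysis.Analysis"
begin

definition holo_Cn :: "(complex^'n \<Rightarrow> complex) \<Rightarrow> bool" where
  "holo_Cn f \<longleftrightarrow> (\<forall>z. \<exists>L. (f has_derivative L) (at z) \<and>
       (\<forall>c v. L (c *s v) = c * L v))"

definition gauss :: "real \<Rightarrow> (complex^'n) measure" where
  "gauss a = density lborel
     (\<lambda>z. ennreal ((a / pi) ^ CARD('n) * exp (- a * (norm z)\<^sup>2)))"

definition fock_norm :: "real \<Rightarrow> real \<Rightarrow> (complex^'n \<Rightarrow> complex) \<Rightarrow> real" where
  "fock_norm p a f = (\<integral>z. (norm (f z)) powr p \<partial>(gauss (a * p / 2))) powr (1 / p)"

definition fock_space :: "real \<Rightarrow> real \<Rightarrow> (complex^'n \<Rightarrow> complex) set" where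
  "fock_space p a = {f. holo_Cn f \<and>
      (\<integral>\<^sup>+ z. ennreal ((norm (f z)) powr p) \<partial>(gauss (a * p / 2))) < \<infinity>}"

definition fock_pair :: "real \<Rightarrow> (complex^'n \<Rightarrow> complex) \<Rightarrow> (complex^'n \<Rightarrow> complex) \<Rightarrow> complex" where
  "fock_pair a f g = (\<integral>z. f z * cnj (g z) \<partial>(gauss a))"

definition dual_norm :: "real \<Rightarrow> real \<Rightarrow> (complex^'n \<Rightarrow> complex) \<Rightarrow> real" where
  "dual_norm p a h = (SUP g \<in> fock_space p a - {\<lambda>_. 0}. norm (fock_pair a g h) / fock_norm p a g)"

end

theory Submission
  imports Defs "HOL-Probability.Probability" "HOL-Complex_Analysis.Complex_Analysis"
begin

text \<open>
  Gaussian measures have the mean value property for holomorphic functions. Applied to a Weyl translate of \<open>g\<close> and combined with Jensen's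
  inequality, it gives the pointwise bound. At the origin this bound says that \<open>h = 1\<close> has quotient \<open>1\<close>, so what remains is the
  lower bound \<open>\<parallel>h\<parallel> \<le> \<parallel>\<langle>\<cdot>, h\<rangle>\<parallel>\<^sup>*\<close> for all \<open>h\<close>.

  Let \<open>P\<close> be the Bargmann projection for a Gaussian measure \<open>\<gamma>\<close> and \<open>r = 2 / sqrt (p q)\<close>. The lower bound follows by testing against
  approximations of \<open>|h| powr (q-2) * h\<close>, once \<open>f \<mapsto> P f (r z)\<close> is known to be a contraction of \<open>L\<^sup>p(\<gamma>)\<close>. On
  exponentials \<open>exp (x \<cdot> z + y \<cdot> cnj z)\<close> the operator is explicit. Write the Gaussian variable as a sum of independent ones of variances
  \<open>s\<close> and \<open>1 - s\<close> and apply the operator to the first summand only. The \<open>s\<close>-derivative of the \<open>p\<close>-th moment is the mean of an expression in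
  the two complex gradients of \<open>f\<close> that is pointwise nonpositive, by a quadratic inequality valid precisely because
  \<open>r\<^sup>2 = 4 (p - 1) / p\<^sup>2\<close>. Instead of differentiating under the integral, the interval is cut into \<open>N\<close> steps, each with
  error \<open>O(N powr (-3/2))\<close>.
\<close>

text \<open>Three Gaussian measures interact: \<open>gauss (a * p / 2)\<close> and
  \<open>gauss (a * q / 2)\<close> carry the two norms, \<open>gauss a\<close> carries the pairing.
  Put \<open>\<beta> = a * q / 2\<close> and let \<open>P\<close> be the projection for
  \<open>gauss \<beta>\<close>. For \<open>g z = P f ((2 / q) z)\<close> the reproducing formula
  shows that the pairing of \<open>g\<close> with \<open>h\<close> equals the integral of
  \<open>f * cnj h\<close> over \<open>gauss \<beta>\<close>, the measure of the norm of
  \<open>h\<close>. In this way functions \<open>f\<close> that are not holomorphic become test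
  functions for \<open>h\<close>. Rescaling \<open>gauss (a * p / 2)\<close> and
  \<open>gauss \<beta>\<close> to \<open>gauss 1\<close> turns the dilation \<open>2 / q\<close>
  into \<open>r = 2 * sqrt (p - 1) / p\<close>, so contractivity says that the norm of
  \<open>g\<close> is at most the p-norm of \<open>f\<close>, with constant exactly 1 in every
  dimension. The constant survives because the comparison is infinitesimal: a step of small variance
  sees \<open>f\<close> only through its value, a drift that is the same on both sides, and its two
  gradients; Cauchy-Schwarz then reduces the claim to two real numbers. Exponentials suit this
  argument because their products are again exponentials, which makes the first and second moments
  of a step explicit.\<close>

no_notation fps_nth (infixl "$" 75)

section \<open>Gaussian measures on complex space\<close>

lemma nn_integral_lborel_scale:
  fixes f :: "'a::euclidean_space \<Rightarrow> ennreal"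
  assumes [measurable]: "f \<in> borel_measurable borel" and "c \<noteq> 0"
  shows "(\<integral>\<^sup>+x. f x \<partial>lborel) = ennreal (\<bar>c\<bar>^DIM('a)) * (\<integral>\<^sup>+x. f (t + c *\<^sub>R x) \<partial>lborel)"
proof -
  have "(\<integral>\<^sup>+x. f x \<partial>lborel) = (\<integral>\<^sup>+x. f x \<partial>(density (distr lborel borel (\<lambda>x. t + c *\<^sub>R x)) (\<lambda>_. \<bar>c\<bar>^DIM('a))))"
    using lborel_affine[OF assms(2), of t] by simp
  also have "\<dots> = (\<integral>\<^sup>+x. ennreal (\<bar>c\<bar>^DIM('a)) * f (t + c *\<^sub>R x) \<partial>lborel)"
    by (subst nn_integral_density) (auto simp: nn_integral_distr)
  also have "\<dots> = ennreal (\<bar>c\<bar>^DIM('a)) * (\<integral>\<^sup>+x. f (t + c *\<^sub>R x) \<partial>lborel)"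
    by (subst nn_integral_cmult) auto
  finally show ?thesis .
qed

lemma borel_measurable_pair_lborel:
  "borel_measurable (lborel \<Otimes>\<^sub>M lborel :: ('a::euclidean_space \<times> 'b::euclidean_space) measure) = borel_measurable borel"
  unfolding lborel_prod by simp

text \<open>A rotation is decomposed into two shears with scalings, each acting on one factor only.\<close>

lemma nn_integral_lborel_rotate_aux:
  fixes F :: "'a::euclidean_space \<times> 'a \<Rightarrow> ennreal"
  assumes [measurable]: "F \<in> borel_measurable borel" and c: "c \<noteq> 0" and cs: "c\<^sup>2 + s\<^sup>2 = 1"
  shows "(\<integral>\<^sup>+z. F (c *\<^sub>R fst z - s *\<^sub>R snd z, s *\<^sub>R fst z + c *\<^sub>R snd z) \<partial>lborel) = (\<integral>\<^sup>+z. F z \<partial>lborel)"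
proof -
  let ?D = "ennreal (\<bar>c\<bar>^DIM('a))"
  let ?Di = "ennreal (\<bar>1/c\<bar>^DIM('a))"
  have [measurable]: "F \<in> borel_measurable (borel \<Otimes>\<^sub>M borel)"
    by (simp add: borel_prod)
  have [measurable]: "F \<in> borel_measurable (lborel \<Otimes>\<^sub>M lborel)"
    by (simp add: borel_measurable_pair_lborel)
  have DD: "?D * ?Di = 1"
    using c by (simp add: ennreal_mult[symmetric] power_mult_distrib[symmetric] abs_mult[symmetric])
  have e: "s * (s * inverse c) + c = 1 / c"
    using cs c by (simp add: field_simps power2_eq_square)
  have "(\<integral>\<^sup>+z. F (c *\<^sub>R fst z - s *\<^sub>R snd z, s *\<^sub>R fst z + c *\<^sub>R snd z) \<partial>lborel)
      = (\<integral>\<^sup>+y. \<integral>\<^sup>+x. F (c *\<^sub>R x - s *\<^sub>R y, s *\<^sub>R x + c *\<^sub>R y) \<partial>lborel \<partial>lborel)"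
    by (subst lborel_prod[symmetric], subst lborel_pair.nn_integral_snd[symmetric]) (auto simp: split_def)
  \<comment> \<open>For fixed \<open>y\<close> substitute \<open>u = c x - s y\<close>. The second
    component becomes \<open>(s/c) u + (1/c) y\<close> because
    \<open>c\<^sup>2 + s\<^sup>2 = 1\<close>, and the Jacobian \<open>?Di\<close> is compensated
    below by the substitution \<open>y = - s u + c w\<close>.\<close>
  also have "\<dots> = (\<integral>\<^sup>+y. ?Di * (\<integral>\<^sup>+u. F (u, (s/c) *\<^sub>R u + (1/c) *\<^sub>R y) \<partial>lborel) \<partial>lborel)"
  proof (rule nn_integral_cong)
    fix y :: 'a
    have "(\<integral>\<^sup>+x. F (c *\<^sub>R x - s *\<^sub>R y, s *\<^sub>R x + c *\<^sub>R y) \<partial>lborel)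
      = ?Di * (\<integral>\<^sup>+u. F (c *\<^sub>R ((s/c) *\<^sub>R y + (1/c) *\<^sub>R u) - s *\<^sub>R y, s *\<^sub>R ((s/c) *\<^sub>R y + (1/c) *\<^sub>R u) + c *\<^sub>R y) \<partial>lborel)"
      by (rule nn_integral_lborel_scale) (use c in auto)
    also have "\<dots> = ?Di * (\<integral>\<^sup>+u. F (u, (s/c) *\<^sub>R u + (1/c) *\<^sub>R y) \<partial>lborel)"
    proof -
      have "s *\<^sub>R ((s/c) *\<^sub>R y + (1/c) *\<^sub>R u) + c *\<^sub>R y = (s/c) *\<^sub>R u + (s * (s * inverse c) + c) *\<^sub>R y" for u
        by (simp add: scaleR_add_right scaleR_add_left divide_inverse)
      then have "s *\<^sub>R ((s/c) *\<^sub>R y + (1/c) *\<^sub>R u) + c *\<^sub>R y = (s/c) *\<^sub>R u + (1/c) *\<^sub>R y" for u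
        unfolding e .
      moreover have "c *\<^sub>R ((s/c) *\<^sub>R y + (1/c) *\<^sub>R u) - s *\<^sub>R y = u" for u
        using c by (simp add: scaleR_add_right)
      ultimately show ?thesis by presburger
    qed
    finally show "(\<integral>\<^sup>+x. F (c *\<^sub>R x - s *\<^sub>R y, s *\<^sub>R x + c *\<^sub>R y) \<partial>lborel)
       = ?Di * (\<integral>\<^sup>+u. F (u, (s/c) *\<^sub>R u + (1/c) *\<^sub>R y) \<partial>lborel)" .
  qed
  also have "\<dots> = ?Di * (\<integral>\<^sup>+y. \<integral>\<^sup>+u. F (u, (s/c) *\<^sub>R u + (1/c) *\<^sub>R y) \<partial>lborel \<partial>lborel)"
    by (subst nn_integral_cmult) (auto intro!: lborel.borel_measurable_nn_integral)
  also have "\<dots> = ?Di * (\<integral>\<^sup>+u. \<integral>\<^sup>+y. F (u, (s/c) *\<^sub>R u + (1/c) *\<^sub>R y) \<partial>lborel \<partial>lborel)"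
    by (subst lborel_pair.Fubini'[symmetric]) (auto simp: split_def)
  also have "\<dots> = ?Di * (\<integral>\<^sup>+u. ?D * (\<integral>\<^sup>+w. F (u, w) \<partial>lborel) \<partial>lborel)"
  proof -
    have "(\<integral>\<^sup>+y. F (u, (s/c) *\<^sub>R u + (1/c) *\<^sub>R y) \<partial>lborel) = ?D * (\<integral>\<^sup>+w. F (u, w) \<partial>lborel)" for u
    proof -
      have "(\<integral>\<^sup>+y. F (u, (s/c) *\<^sub>R u + (1/c) *\<^sub>R y) \<partial>lborel) = 
         ?D * (\<integral>\<^sup>+w. F (u, (s/c) *\<^sub>R u + (1/c) *\<^sub>R (- s *\<^sub>R u + c *\<^sub>R w)) \<partial>lborel)"
        by (rule nn_integral_lborel_scale) (use c in auto)
      moreover have "(s/c) *\<^sub>R u + (1/c) *\<^sub>R (- s *\<^sub>R u + c *\<^sub>R w) = w" for w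
        using c by (simp add: scaleR_add_right scaleR_diff_right)
      ultimately show ?thesis by presburger
    qed
    then show ?thesis by simp
  qed
  also have "\<dots> = ?Di * (?D * (\<integral>\<^sup>+u. (\<integral>\<^sup>+w. F (u, w) \<partial>lborel) \<partial>lborel))"
    by (subst nn_integral_cmult) (auto intro!: lborel.borel_measurable_nn_integral)
  also have "\<dots> = (\<integral>\<^sup>+u. (\<integral>\<^sup>+w. F (u, w) \<partial>lborel) \<partial>lborel)"
    using DD by (metis (no_types, lifting) mult.assoc mult.commute mult_1)
  also have "\<dots> = (\<integral>\<^sup>+z. F z \<partial>lborel)"
    by (subst lborel_prod[symmetric], subst lborel.nn_integral_fst[symmetric]) auto
  finally show ?thesis .
qed

text \<open>The shears divide by \<open>c\<close>, so the quarter turns need a detour: each is the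
  square of a rotation with cosine \<open>1 / sqrt 2\<close>.\<close>

lemma nn_integral_lborel_rotate:
  fixes F :: "'a::euclidean_space \<times> 'a \<Rightarrow> ennreal"
  assumes [measurable]: "F \<in> borel_measurable borel" and cs: "c\<^sup>2 + s\<^sup>2 = 1"
  shows "(\<integral>\<^sup>+z. F (c *\<^sub>R fst z - s *\<^sub>R snd z, s *\<^sub>R fst z + c *\<^sub>R snd z) \<partial>lborel) = (\<integral>\<^sup>+z. F z \<partial>lborel)"
proof (cases "c = 0")
  case False
  then show ?thesis using nn_integral_lborel_rotate_aux[OF assms(1) False cs] by simp
next
  case True
  define k :: real where "k = 1 / sqrt 2"
  have k: "k \<noteq> 0" "k\<^sup>2 = 1/2" by (auto simp: k_def power_divide)
  have s: "s\<^sup>2 = 1" using cs True by simp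
  have ks: "k\<^sup>2 + (s * k)\<^sup>2 = 1" using k s by (simp add: power_mult_distrib)
  have kk: "k * k = 1/2" and ss: "s * s = 1" using k s by (auto simp: power2_eq_square)
  define T where "T z = (k *\<^sub>R fst z - (s*k) *\<^sub>R snd z, (s*k) *\<^sub>R fst z + k *\<^sub>R snd z)" for z :: "'a \<times> 'a"
  have [measurable]: "T \<in> borel \<rightarrow>\<^sub>M borel"
    unfolding T_def[abs_def] borel_prod[symmetric] by simp
  have FT: "(\<lambda>z. F (T z)) \<in> borel_measurable borel" by measurable
  have TT: "T (T z) = (c *\<^sub>R fst z - s *\<^sub>R snd z, s *\<^sub>R fst z + c *\<^sub>R snd z)" for z
  proof -
    have a: "k * k - s * k * (s * k) = 0" "k * (s * k) + s * k * k = s"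
      using kk ss by (auto simp: algebra_simps)
    have "a1 *\<^sub>R (b1 *\<^sub>R x - c1 *\<^sub>R y) - d1 *\<^sub>R (e1 *\<^sub>R x + f1 *\<^sub>R y) = (a1 * b1 - d1 * e1) *\<^sub>R x - (a1 * c1 + d1 * f1) *\<^sub>R y"
      "a1 *\<^sub>R (b1 *\<^sub>R x - c1 *\<^sub>R y) + d1 *\<^sub>R (e1 *\<^sub>R x + f1 *\<^sub>R y) = (a1 * b1 + d1 * e1) *\<^sub>R x + (d1 * f1 - a1 * c1) *\<^sub>R y"
      for x y :: 'a and a1 b1 c1 d1 e1 f1
      by (simp_all add: algebra_simps)
    note e = this
    have *: "k * (s * k) + (s * k) * k = s" "(s*k) * k + k * (s * k) = s" "k * k - (s * k) * (s * k) = 0"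
      using a by (auto simp: algebra_simps)
    have "T (T z) = (- (s *\<^sub>R snd z), s *\<^sub>R fst z)"
      unfolding T_def fst_conv snd_conv e by (simp only: *) simp
    then show ?thesis using True by simp
  qed
  have "(\<integral>\<^sup>+z. F (T (T z)) \<partial>lborel) = (\<integral>\<^sup>+z. F (T z) \<partial>lborel)"
    using nn_integral_lborel_rotate_aux[of "\<lambda>z. F (T z)", OF FT k(1) ks] by (simp add: T_def)
  also have "\<dots> = (\<integral>\<^sup>+z. F z \<partial>lborel)"
    using nn_integral_lborel_rotate_aux[of F, OF _ k(1) ks] by (simp add: T_def)
  finally show ?thesis unfolding TT .
qed


section \<open>Bilinear product (linear in both arguments, hence holomorphic) and conjugation of
  complex vectors\<close>

definition cdot :: "complex^'n \<Rightarrow> complex^'n \<Rightarrow> complex" where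
  "cdot x y = (\<Sum>j\<in>UNIV. x $ j * y $ j)"

definition vcnj :: "complex^'n \<Rightarrow> complex^'n" where
  "vcnj x = (\<chi> j. cnj (x $ j))"

lemma vcnj_nth [simp]: "vcnj x $ j = cnj (x $ j)"
  by (simp add: vcnj_def)

lemma vcnj_vcnj [simp]: "vcnj (vcnj x) = x"
  by (simp add: vec_eq_iff)

lemma vcnj_add: "vcnj (x + y) = vcnj x + vcnj y"
  by (simp add: vec_eq_iff)

lemma vcnj_scaleR: "vcnj (r *\<^sub>R x) = r *\<^sub>R vcnj x"
  by (simp add: vec_eq_iff)

lemma norm_vcnj [simp]: "norm (vcnj x) = norm x"
  by (simp add: norm_vec_def L2_set_def)

lemma cdot_commute: "cdot x y = cdot y x"
  by (simp add: cdot_def mult.commute)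

lemma cdot_add_left: "cdot (x + y) z = cdot x z + cdot y z"
  and cdot_add_right: "cdot z (x + y) = cdot z x + cdot z y"
  by (simp_all add: cdot_def algebra_simps sum.distrib)

lemma cdot_scaleR_left: "cdot (r *\<^sub>R x) z = of_real r * cdot x z"
  and cdot_scaleR_right: "cdot z (r *\<^sub>R x) = of_real r * cdot z x"
  by (simp_all add: cdot_def scaleR_sum_right flip: scaleR_conv_of_real)

lemma cdot_smult_left: "cdot (c *s x) z = c * cdot x z"
  and cdot_smult_right: "cdot z (c *s x) = c * cdot z x"
  by (simp_all add: cdot_def sum_distrib_left algebra_simps)

lemma cdot_zero [simp]: "cdot 0 z = 0" "cdot z 0 = 0"
  by (simp_all add: cdot_def)

lemma cnj_cdot: "cnj (cdot x y) = cdot (vcnj x) (vcnj y)"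
  by (simp add: cdot_def)

lemma norm_sq_eq_sum: "(norm x)\<^sup>2 = (\<Sum>j\<in>UNIV. (cmod (x $ j))\<^sup>2)" for x :: "complex^'n"
  by (simp add: norm_vec_def L2_set_def sum_nonneg)

lemma cdot_vcnj_self: "cdot x (vcnj x) = of_real ((norm x)\<^sup>2)"
  by (simp add: cdot_def norm_sq_eq_sum complex_norm_square del: of_real_power)

lemma norm_cdot_le: "cmod (cdot x y) \<le> norm x * norm y"
proof -
  have "cmod (cdot x y) \<le> (\<Sum>j\<in>UNIV. \<bar>cmod (x $ j)\<bar> * \<bar>cmod (y $ j)\<bar>)"
    unfolding cdot_def by (rule order_trans[OF norm_sum]) (simp add: norm_mult)
  also have "\<dots> \<le> norm x * norm y"
    unfolding norm_vec_def by (rule L2_set_mult_ineq)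
  finally show ?thesis .
qed

lemma continuous_on_cdot [continuous_intros]:
  assumes "continuous_on S f" "continuous_on S g"
  shows "continuous_on S (\<lambda>x. cdot (f x) (g x))"
  unfolding cdot_def by (intro continuous_intros continuous_on_component assms)

lemma continuous_on_vcnj [continuous_intros]:
  assumes "continuous_on S f"
  shows "continuous_on S (\<lambda>x. vcnj (f x))"
  unfolding vcnj_def by (intro continuous_on_vec_lambda continuous_intros continuous_on_component assms)

lemma cdot_measurable [measurable]:
  assumes "f \<in> borel_measurable M" "g \<in> borel_measurable M"
  shows "(\<lambda>x. cdot (f x) (g x)) \<in> borel_measurable M"
proof -
  have "continuous_on UNIV (\<lambda>p. cdot (fst p) (snd p) :: complex)"
    by (intro continuous_intros)
  from borel_measurable_continuous_Pair[OF assms this]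
  show ?thesis .
qed

lemma vcnj_measurable [measurable]:
  "vcnj \<in> borel_measurable borel"
  by (intro borel_measurable_continuous_onI continuous_intros)

lemma norm_add_vec_sq:
  "(norm (x + y))\<^sup>2 = (norm x)\<^sup>2 + (norm y)\<^sup>2 + 2 * Re (cdot x (vcnj y))" for x y :: "complex^'n"
proof -
  have "of_real ((norm (x + y))\<^sup>2) = cdot (x + y) (vcnj (x + y))"
    by (simp add: cdot_vcnj_self)
  also have "\<dots> = of_real ((norm x)\<^sup>2) + of_real ((norm y)\<^sup>2) + (cdot x (vcnj y) + cnj (cdot x (vcnj y)))"
    by (simp add: vcnj_add cdot_add_left cdot_add_right cdot_vcnj_self cnj_cdot cdot_commute[of y])
  also have "\<dots> = of_real ((norm x)\<^sup>2 + (norm y)\<^sup>2 + 2 * Re (cdot x (vcnj y)))"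
    by (simp add: complex_add_cnj)
  finally show ?thesis by (simp only: of_real_eq_iff)
qed

section \<open>Gaussian measures: total mass, scaling, convolution, rotation, exponential
  moments\<close>

lemma sets_gauss [measurable_cong, simp]: "sets (gauss a) = sets borel"
  by (simp add: gauss_def)

lemma space_gauss [simp]: "space (gauss a) = UNIV"
  by (simp add: gauss_def)

lemma DIM_complex_vec: "DIM(complex^'n) = 2 * CARD('n)"
  by simp

lemma nn_integral_gauss_1d:
  assumes "a > 0"
  shows "(\<integral>\<^sup>+x. ennreal (sqrt (a/pi) * exp (- a * x\<^sup>2)) \<partial>lborel) = 1"
proof -
  define \<sigma> where "\<sigma> = 1 / sqrt (2 * a)"
  have s: "\<sigma> > 0" and s2: "\<sigma>\<^sup>2 = 1 / (2 * a)" using assms by (auto simp: \<sigma>_def power_divide)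
  have "normal_density 0 \<sigma> x = sqrt (a/pi) * exp (- a * x\<^sup>2)" for x
    unfolding normal_density_def s2 using assms by (simp add: real_sqrt_divide field_simps)
  moreover have "(\<integral>\<^sup>+x. ennreal (normal_density 0 \<sigma> x) \<partial>lborel) = 1"
    using prob_space.emeasure_space_1[OF prob_space_normal_density[OF s, of 0]]
    by (simp add: emeasure_density)
  ultimately show ?thesis by simp
qed

text \<open>In real coordinates the density is a product of one-dimensional densities of mass 1.
  Each complex coordinate contributes \<open>sqrt (a / pi)\<close> twice, which accounts for the
  power \<open>CARD('n)\<close> of \<open>a / pi\<close>.\<close>

lemma prob_space_gauss:
  assumes "a > 0"
  shows "prob_space (gauss a :: (complex^'n) measure)"
proof
  let ?B = "Basis :: (complex^'n) set"
  have "(\<integral>\<^sup>+z. ennreal ((a / pi) ^ CARD('n) * exp (- a * (norm z)\<^sup>2)) \<partial>(lborel :: (complex^'n) measure))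
      = (\<integral>\<^sup>+z. (\<Prod>b\<in>?B. ennreal (sqrt (a/pi) * exp (- a * (z \<bullet> b)\<^sup>2))) \<partial>lborel)"
  proof (rule nn_integral_cong)
    fix z :: "complex^'n"
    have "(\<Prod>b\<in>?B. ennreal (sqrt (a/pi) * exp (- a * (z \<bullet> b)\<^sup>2)))
       = ennreal (\<Prod>b\<in>?B. sqrt (a/pi) * exp (- a * (z \<bullet> b)\<^sup>2))"
      by (rule prod_ennreal) (use assms in auto)
    also have "(\<Prod>b\<in>?B. sqrt (a/pi) * exp (- a * (z \<bullet> b)\<^sup>2))
       = sqrt (a/pi) ^ DIM(complex^'n) * exp (\<Sum>b\<in>?B. - a * (z \<bullet> b)\<^sup>2)"
      by (simp only: prod.distrib prod_constant exp_sum[OF finite_Basis])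
    also have "sqrt (a/pi) ^ DIM(complex^'n) = (a/pi)^CARD('n)"
      unfolding DIM_complex_vec power_mult using assms by simp
    also have "(\<Sum>b\<in>?B. - a * (z \<bullet> b)\<^sup>2) = - a * (norm z)\<^sup>2"
      by (simp add: norm_eq_sqrt_inner euclidean_inner[of z z] sum_nonneg sum_distrib_left power2_eq_square sum_negf)
    finally show "ennreal ((a / pi) ^ CARD('n) * exp (- a * (norm z)\<^sup>2)) = (\<Prod>b\<in>?B. ennreal (sqrt (a/pi) * exp (- a * (z \<bullet> b)\<^sup>2)))"
      by simp
  qed
  also have "\<dots> = (\<Prod>b\<in>?B. \<integral>\<^sup>+x. ennreal (sqrt (a/pi) * exp (- a * x\<^sup>2)) \<partial>lborel)"
    by (rule nn_integral_lborel_prod) (use assms in auto)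
  also have "\<dots> = 1"
    by (simp only: nn_integral_gauss_1d[OF assms] prod.neutral_const)
  finally show "emeasure (gauss a) (space (gauss a :: (complex^'n) measure)) = 1"
    by (simp add: gauss_def emeasure_density)
qed

lemma measure_gauss_UNIV [simp]: "a > 0 \<Longrightarrow> measure (gauss a :: (complex^'n) measure) UNIV = 1"
  using prob_space.prob_space[OF prob_space_gauss, of a] by simp

lemma nn_integral_gauss:
  fixes f :: "complex^'n \<Rightarrow> ennreal"
  assumes [measurable]: "f \<in> borel_measurable borel"
  shows "(\<integral>\<^sup>+z. f z \<partial>gauss a) = (\<integral>\<^sup>+z. ennreal ((a / pi) ^ CARD('n) * exp (- a * (norm z)\<^sup>2)) * f z \<partial>lborel)"
  unfolding gauss_def by (subst nn_integral_density) auto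

lemma distr_gauss_scale:
  assumes "a > 0" "c > 0"
  shows "distr (gauss a) borel (\<lambda>z::complex^'n. c *\<^sub>R z) = gauss (a / c\<^sup>2)"
proof (rule measure_eqI)
  fix A :: "(complex^'n) set" assume "A \<in> sets (distr (gauss a) borel (\<lambda>z::complex^'n. c *\<^sub>R z))"
  then have [measurable]: "A \<in> sets borel" by simp
  let ?n = "CARD('n)"
  have "emeasure (gauss (a / c\<^sup>2)) A = (\<integral>\<^sup>+z. indicator A z \<partial>gauss (a / c\<^sup>2))" by simp
  also have "\<dots> = (\<integral>\<^sup>+z. ennreal ((a / c\<^sup>2 / pi) ^ ?n * exp (- (a / c\<^sup>2) * (norm z)\<^sup>2)) * indicator A z \<partial>lborel)"
    by (subst nn_integral_gauss) auto
  also have "\<dots> = ennreal (\<bar>c\<bar>^DIM(complex^'n)) * (\<integral>\<^sup>+z. ennreal ((a / c\<^sup>2 / pi) ^ ?n * exp (- (a / c\<^sup>2) * (norm (0 + c *\<^sub>R z))\<^sup>2)) * indicator A (0 + c *\<^sub>R z) \<partial>lborel)"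
    by (rule nn_integral_lborel_scale) (use assms in auto)
  also have "\<dots> = (\<integral>\<^sup>+z. ennreal (\<bar>c\<bar>^DIM(complex^'n)) * (ennreal ((a / c\<^sup>2 / pi) ^ ?n * exp (- (a / c\<^sup>2) * (norm (0 + c *\<^sub>R z))\<^sup>2)) * indicator A (0 + c *\<^sub>R z)) \<partial>lborel)"
    by (subst nn_integral_cmult) auto
  also have "\<dots> = (\<integral>\<^sup>+z. ennreal ((a / pi) ^ ?n * exp (- a * (norm z)\<^sup>2)) * indicator A (c *\<^sub>R z) \<partial>lborel)"
  proof (rule nn_integral_cong)
    fix z :: "complex^'n"
    have "\<bar>c\<bar>^DIM(complex^'n) * ((a / c\<^sup>2 / pi) ^ ?n * exp (- (a / c\<^sup>2) * (norm (0 + c *\<^sub>R z))\<^sup>2)) = (a / pi) ^ ?n * exp (- a * (norm z)\<^sup>2)"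
      unfolding DIM_complex_vec power_mult using assms
      by (simp add: power_mult_distrib power_divide power_mult[symmetric] field_simps)
    then show "ennreal (\<bar>c\<bar>^DIM(complex^'n)) * (ennreal ((a / c\<^sup>2 / pi) ^ ?n * exp (- (a / c\<^sup>2) * (norm (0 + c *\<^sub>R z))\<^sup>2)) * indicator A (0 + c *\<^sub>R z))
       = ennreal ((a / pi) ^ ?n * exp (- a * (norm z)\<^sup>2)) * indicator A (c *\<^sub>R z)"
      using assms by (simp add: mult.assoc[symmetric] ennreal_mult'[symmetric] del: DIM_cart)
  qed
  also have "\<dots> = (\<integral>\<^sup>+z. indicator A (c *\<^sub>R z) \<partial>gauss a)"
    by (subst nn_integral_gauss) auto
  also have "\<dots> = (\<integral>\<^sup>+z. indicator A z \<partial>distr (gauss a) borel (\<lambda>z::complex^'n. c *\<^sub>R z))"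
    by (subst nn_integral_distr) auto
  also have "\<dots> = emeasure (distr (gauss a) borel (\<lambda>z::complex^'n. c *\<^sub>R z)) A" by simp
  finally show "emeasure (distr (gauss a) borel (\<lambda>z::complex^'n. c *\<^sub>R z)) A = emeasure (gauss (a / c\<^sup>2)) A" by simp
qed simp

text \<open>The product of two equal Gaussians is invariant under rotations mixing the factors, so
  \<open>s x + c y\<close>, being one coordinate of a rotated pair, has the law of a single
  factor.\<close>

lemma gauss_convolution:
  assumes a: "a > 0" and cs: "c\<^sup>2 + s\<^sup>2 = 1"
  shows "distr (gauss a \<Otimes>\<^sub>M gauss a) borel (\<lambda>z. s *\<^sub>R fst z + c *\<^sub>R snd z) = (gauss a :: (complex^'n) measure)"
proof (rule measure_eqI)
  interpret G: prob_space "gauss a :: (complex^'n) measure" using a by (rule prob_space_gauss)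
  interpret GG: pair_sigma_finite "gauss a :: (complex^'n) measure" "gauss a :: (complex^'n) measure" ..
  fix A :: "(complex^'n) set"
  assume "A \<in> sets (distr (gauss a \<Otimes>\<^sub>M gauss a) borel (\<lambda>z. s *\<^sub>R fst z + c *\<^sub>R snd z))"
  then have [measurable]: "A \<in> sets borel" by simp
  define w where "w = (\<lambda>z::complex^'n. ennreal ((a / pi) ^ CARD('n) * exp (- a * (norm z)\<^sup>2)))"
  have [measurable]: "w \<in> borel_measurable borel" unfolding w_def by measurable
  define F where "F = (\<lambda>z. w (fst z) * w (snd z) * indicator A (snd z))"
  have F[measurable]: "F \<in> borel_measurable borel"
    unfolding F_def borel_prod[symmetric] by measurable
  have pair: "(\<integral>\<^sup>+x. \<integral>\<^sup>+y. H x y \<partial>gauss a \<partial>gauss a) = (\<integral>\<^sup>+z. w (fst z) * w (snd z) * H (fst z) (snd z) \<partial>lborel)"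
    if [measurable]: "(\<lambda>z. H (fst z) (snd z)) \<in> borel_measurable borel" for H
  proof -
    have [measurable]: "case_prod H \<in> borel_measurable (borel \<Otimes>\<^sub>M borel)"
      using that by (simp add: borel_prod split_def)
    have [measurable]: "case_prod H \<in> borel_measurable (borel \<Otimes>\<^sub>M gauss a)"
      by measurable
    have "(\<integral>\<^sup>+x. \<integral>\<^sup>+y. H x y \<partial>gauss a \<partial>gauss a) = (\<integral>\<^sup>+x. w x * (\<integral>\<^sup>+y. w y * H x y \<partial>lborel) \<partial>lborel)"
      unfolding w_def by (subst nn_integral_gauss, measurable) (simp add: nn_integral_gauss)
    also have "\<dots> = (\<integral>\<^sup>+x. \<integral>\<^sup>+y. w x * w y * H x y \<partial>lborel \<partial>lborel)"
      by (simp add: nn_integral_cmult mult.assoc)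
    also have "\<dots> = (\<integral>\<^sup>+z. w (fst z) * w (snd z) * H (fst z) (snd z) \<partial>lborel)"
      by (subst lborel_prod[symmetric], subst lborel.nn_integral_fst[symmetric]) (auto simp: split_def)
    finally show ?thesis .
  qed
  have "emeasure (distr (gauss a \<Otimes>\<^sub>M gauss a) borel (\<lambda>z. s *\<^sub>R fst z + c *\<^sub>R snd z)) A
    = (\<integral>\<^sup>+z. indicator A z \<partial>distr (gauss a \<Otimes>\<^sub>M gauss a) borel (\<lambda>z. s *\<^sub>R fst z + c *\<^sub>R snd z))"
    by simp
  also have "\<dots> = (\<integral>\<^sup>+z. indicator A (s *\<^sub>R fst z + c *\<^sub>R snd z) \<partial>(gauss a \<Otimes>\<^sub>M gauss a))"
    by (subst nn_integral_distr) auto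
  also have "\<dots> = (\<integral>\<^sup>+x. \<integral>\<^sup>+y. indicator A (s *\<^sub>R x + c *\<^sub>R y) \<partial>gauss a \<partial>gauss a)"
    by (subst G.nn_integral_fst[symmetric]) auto
  also have "\<dots> = (\<integral>\<^sup>+z. w (fst z) * w (snd z) * indicator A (s *\<^sub>R fst z + c *\<^sub>R snd z) \<partial>lborel)"
    by (rule pair) (simp add: borel_prod[symmetric])
  \<comment> \<open>The weight depends on the pair only through \<open>|x|^2 + |y|^2\<close>, which
    the rotation preserves; the integrand is therefore \<open>F\<close> at the rotated pair.\<close>
  also have "\<dots> = (\<integral>\<^sup>+z. F (c *\<^sub>R fst z - s *\<^sub>R snd z, s *\<^sub>R fst z + c *\<^sub>R snd z) \<partial>lborel)"
  proof (rule nn_integral_cong)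
    fix z :: "(complex^'n) \<times> (complex^'n)"
    obtain x y where z: "z = (x, y)" by (cases z)
    have "(norm (c *\<^sub>R x - s *\<^sub>R y))\<^sup>2 + (norm (s *\<^sub>R x + c *\<^sub>R y))\<^sup>2 = (c\<^sup>2+s\<^sup>2) * (norm x)\<^sup>2 + (c\<^sup>2+s\<^sup>2) * (norm y)\<^sup>2"
      unfolding power2_norm_eq_inner by (simp add: inner_simps inner_commute power2_eq_square algebra_simps)
    then have n: "(norm (c *\<^sub>R x - s *\<^sub>R y))\<^sup>2 + (norm (s *\<^sub>R x + c *\<^sub>R y))\<^sup>2 = (norm x)\<^sup>2 + (norm y)\<^sup>2"
      using cs by simp
    have ww: "w u * w v = ennreal (((a / pi) ^ CARD('n))\<^sup>2 * exp (- a * ((norm u)\<^sup>2 + (norm v)\<^sup>2)))" for u v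
      unfolding w_def using a by (simp add: ennreal_mult'[symmetric] power2_eq_square distrib_left exp_add[symmetric] exp_diff field_simps)
    have "w x * w y = w (c *\<^sub>R x - s *\<^sub>R y) * w (s *\<^sub>R x + c *\<^sub>R y)"
      unfolding ww n ..
    then show "w (fst z) * w (snd z) * indicator A (s *\<^sub>R fst z + c *\<^sub>R snd z) = F (c *\<^sub>R fst z - s *\<^sub>R snd z, s *\<^sub>R fst z + c *\<^sub>R snd z)"
      by (simp add: F_def z)
  qed
  also have "\<dots> = (\<integral>\<^sup>+z. F z \<partial>lborel)"
    by (rule nn_integral_lborel_rotate[OF F cs])
  also have "\<dots> = (\<integral>\<^sup>+x. \<integral>\<^sup>+y. indicator A y \<partial>gauss a \<partial>(gauss a :: (complex^'n) measure))"
    unfolding F_def by (rule pair[of "\<lambda>_ y. indicator A y", symmetric]) (simp add: borel_prod[symmetric])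
  also have "\<dots> = emeasure (gauss a) A"
    using G.emeasure_space_1 by simp
  finally show "emeasure (distr (gauss a \<Otimes>\<^sub>M gauss a) borel (\<lambda>z. s *\<^sub>R fst z + c *\<^sub>R snd z)) A = emeasure (gauss a) A" .
qed simp

text \<open>In these coordinates multiplication by \<open>cis \<theta>\<close> is a rotation of a
  pair of real vectors, so the invariance of Lebesgue measure on real pairs carries over to complex
  vectors.\<close>

definition cvec :: "(real^'n) \<times> (real^'n) \<Rightarrow> complex^'n" where
  "cvec z = (\<chi> j. Complex (fst z $ j) (snd z $ j))"

lemma cvec_measurable [measurable]: "cvec \<in> borel_measurable borel"
  unfolding cvec_def[abs_def]
  by (intro borel_measurable_continuous_onI continuous_on_vec_lambda)
     (auto simp: Complex_eq intro!: continuous_intros)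

lemma Basis_vec_prod:
  "(\<Prod>b\<in>(Basis :: ('a::euclidean_space^'n) set). f b) = (\<Prod>i\<in>UNIV. \<Prod>u\<in>Basis. f (axis i u))"
proof -
  have B: "(Basis :: ('a^'n) set) = (\<lambda>(i, u). axis i u) ` (UNIV \<times> Basis)"
    by (auto simp: Basis_vec_def)
  have inj: "inj_on (\<lambda>(i, u). axis i u :: 'a^'n) (UNIV \<times> Basis)"
    by (auto simp: inj_on_def axis_eq_axis)
  show ?thesis
    unfolding B prod.reindex[OF inj] by (simp add: prod.cartesian_product comp_def split_def)
qed

text \<open>It is enough to compare boxes: the preimage of a box is the product of the boxes of real
  and of imaginary parts, and the side lengths multiply to the same volume.\<close>

lemma lborel_complex_vec: "(lborel :: (complex^'n) measure) = distr lborel borel cvec"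
proof (rule lborel_eqI)
  fix l u :: "complex^'n"
  assume le: "\<And>b. b \<in> Basis \<Longrightarrow> l \<bullet> b \<le> u \<bullet> b"
  have le': "Re (l $ i) \<le> Re (u $ i)" "Im (l $ i) \<le> Im (u $ i)" for i
    using le[of "axis i 1"] le[of "axis i \<i>"]
    by (auto simp: inner_axis Basis_vec_def Basis_complex_def)
  let ?l = "(\<chi> i. Re (l $ i), \<chi> i. Im (l $ i)) :: (real^'n) \<times> (real^'n)"
  let ?u = "(\<chi> i. Re (u $ i), \<chi> i. Im (u $ i)) :: (real^'n) \<times> (real^'n)"
  have pre: "cvec -` box l u = box (fst ?l) (fst ?u) \<times> box (snd ?l) (snd ?u)"
    by (auto simp: box_def cvec_def inner_axis Basis_vec_def Basis_complex_def)
  have "emeasure (distr lborel borel cvec) (box l u) = emeasure lborel (box (fst ?l) (fst ?u) \<times> box (snd ?l) (snd ?u))"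
    by (subst emeasure_distr) (auto simp: pre)
  also have "\<dots> = emeasure lborel (box (fst ?l) (fst ?u)) * emeasure lborel (box (snd ?l) (snd ?u))"
    by (subst lborel_prod[symmetric], subst lborel.emeasure_pair_measure_Times) auto
  also have "\<dots> = ennreal (\<Prod>b\<in>Basis. (fst ?u - fst ?l) \<bullet> b) * ennreal (\<Prod>b\<in>Basis. (snd ?u - snd ?l) \<bullet> b)"
    by (subst (1 2) emeasure_lborel_box) (auto simp: inner_axis Basis_vec_def le')
  also have "\<dots> = ennreal (\<Prod>b\<in>Basis. (u - l) \<bullet> b)"
    unfolding Basis_vec_prod
    by (subst ennreal_mult[symmetric])
       (auto simp: inner_axis Basis_complex_def le' prod.distrib[symmetric] intro!: prod_nonneg)
  finally show "emeasure (distr lborel borel cvec) (box l u) = ennreal (\<Prod>b\<in>Basis. (u - l) \<bullet> b)" .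
qed simp

lemma smult_vec_measurable [measurable]: "(\<lambda>z. c *s z) \<in> borel_measurable (borel :: (complex^'n) measure)"
  by (intro borel_measurable_continuous_onI) 
     (auto simp: vector_scalar_mult_def intro!: continuous_on_vec_lambda continuous_intros continuous_on_component)

lemma norm_smult_vec [simp]: "norm (c *s z) = cmod c * norm z" for z :: "complex^'n"
proof -
  have "(norm (c *s z))\<^sup>2 = (cmod c * norm z)\<^sup>2"
    by (simp add: norm_sq_eq_sum norm_mult power_mult_distrib sum_distrib_left)
  then show ?thesis by (simp add: power2_eq_iff_nonneg)
qed

lemma distr_gauss_rotate:
  assumes "a > 0"
  shows "distr (gauss a) borel (\<lambda>z::complex^'n. cis \<theta> *s z) = gauss a"
proof (rule measure_eqI)
  fix A :: "(complex^'n) set" assume "A \<in> sets (distr (gauss a) borel (\<lambda>z::complex^'n. cis \<theta> *s z))"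
  then have [measurable]: "A \<in> sets borel" by simp
  define W where "W = (\<lambda>z::complex^'n. ennreal ((a / pi) ^ CARD('n) * exp (- a * (norm z)\<^sup>2)) * indicator A z)"
  have W[measurable]: "W \<in> borel_measurable borel" unfolding W_def by measurable
  have rot: "cis \<theta> *s cvec z = cvec (cos \<theta> *\<^sub>R fst z - sin \<theta> *\<^sub>R snd z, sin \<theta> *\<^sub>R fst z + cos \<theta> *\<^sub>R snd z)" for z :: "(real^'n) \<times> (real^'n)"
    by (simp add: cvec_def vec_eq_iff complex_eq_iff)
  have "emeasure (distr (gauss a) borel (\<lambda>z::complex^'n. cis \<theta> *s z)) A
      = (\<integral>\<^sup>+z. indicator A z \<partial>distr (gauss a) borel (\<lambda>z::complex^'n. cis \<theta> *s z))" by simp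
  also have "\<dots> = (\<integral>\<^sup>+z. indicator A (cis \<theta> *s z) \<partial>gauss a)"
    by (subst nn_integral_distr) auto
  also have "\<dots> = (\<integral>\<^sup>+z. W (cis \<theta> *s z) \<partial>lborel)"
    by (subst nn_integral_gauss) (auto simp: W_def)
  also have "\<dots> = (\<integral>\<^sup>+z. W (cis \<theta> *s cvec z) \<partial>lborel)"
    by (subst lborel_complex_vec, subst nn_integral_distr) auto
  also have "\<dots> = (\<integral>\<^sup>+z. W (cvec z) \<partial>lborel)"
    unfolding rot by (rule nn_integral_lborel_rotate[of "\<lambda>z. W (cvec z)"]) auto
  also have "\<dots> = (\<integral>\<^sup>+z. W z \<partial>lborel)"
    by (subst lborel_complex_vec, subst nn_integral_distr) auto
  also have "\<dots> = (\<integral>\<^sup>+z. indicator A z \<partial>gauss a)"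
    by (subst nn_integral_gauss) (auto simp: W_def)
  also have "\<dots> = emeasure (gauss a) A" by simp
  finally show "emeasure (distr (gauss a) borel (\<lambda>z::complex^'n. cis \<theta> *s z)) A = emeasure (gauss a) A" .
qed simp

text \<open>Completing the square, half of the Gaussian exponent absorbs \<open>C * norm z\<close>.
  What is left is \<open>K\<close> times the density of \<open>gauss (a/2)\<close>, where
  \<open>2 ^ CARD('n)\<close> is the quotient of the normalising constants.\<close>

lemma integrable_exp_norm_gauss:
  assumes "a > 0"
  shows "integrable (gauss a) (\<lambda>z::complex^'n. exp (C * norm z))"
proof (rule integrableI_bounded)
  interpret G: prob_space "gauss (a/2) :: (complex^'n) measure" using assms by (intro prob_space_gauss) auto
  define K where "K = 2 ^ CARD('n) * exp (C\<^sup>2 / (2 * a))"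
  have "(\<integral>\<^sup>+z. ennreal (norm (exp (C * norm (z::complex^'n)))) \<partial>gauss a)
      = (\<integral>\<^sup>+z. ennreal ((a / pi) ^ CARD('n) * exp (- a * (norm (z::complex^'n))\<^sup>2)) * ennreal (exp (C * norm z)) \<partial>lborel)"
    by (subst nn_integral_gauss) auto
  also have "\<dots> \<le> (\<integral>\<^sup>+z. ennreal K * ennreal ((a / 2 / pi) ^ CARD('n) * exp (- (a/2) * (norm (z::complex^'n))\<^sup>2)) \<partial>lborel)"
  proof (rule nn_integral_mono)
    fix z :: "complex^'n"
    have "0 \<le> (C / sqrt (2*a) - sqrt (2*a) / 2 * norm z)\<^sup>2" by simp
    also have "\<dots> = C\<^sup>2 / (2*a) + a / 2 * (norm z)\<^sup>2 - C * norm z"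
      using assms by (simp add: power2_diff power_divide power_mult_distrib)
    finally have "- a * (norm z)\<^sup>2 + C * norm z \<le> C\<^sup>2 / (2*a) - (a/2) * (norm z)\<^sup>2" by (simp add: field_simps)
    then have "exp (- a * (norm z)\<^sup>2) * exp (C * norm z) \<le> exp (C\<^sup>2 / (2*a)) * exp (- (a/2) * (norm z)\<^sup>2)"
      by (simp add: exp_add[symmetric])
    then have "(a / pi) ^ CARD('n) * (exp (- a * (norm z)\<^sup>2) * exp (C * norm z)) \<le> (a / pi) ^ CARD('n) * (exp (C\<^sup>2 / (2*a)) * exp (- (a/2) * (norm z)\<^sup>2))"
      using assms by (intro mult_left_mono) auto
    then have "(a / pi) ^ CARD('n) * exp (- a * (norm z)\<^sup>2) * exp (C * norm z) \<le> K * ((a / 2 / pi) ^ CARD('n) * exp (- (a/2) * (norm z)\<^sup>2))"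
      by (simp add: K_def mult.assoc power_divide mult.left_commute)
    then show "ennreal ((a / pi) ^ CARD('n) * exp (- a * (norm (z::complex^'n))\<^sup>2)) * ennreal (exp (C * norm z))
      \<le> ennreal K * ennreal ((a / 2 / pi) ^ CARD('n) * exp (- (a/2) * (norm (z::complex^'n))\<^sup>2))"
      using assms by (simp add: ennreal_mult'[symmetric] K_def del: ennreal_numeral)
  qed
  also have "\<dots> = ennreal K * emeasure (gauss (a/2)) (space (gauss (a/2) :: (complex^'n) measure))"
    by (subst nn_integral_cmult) (auto simp: gauss_def emeasure_density)
  also have "\<dots> < \<infinity>" by (simp only: G.emeasure_space_1) simp
  finally show "(\<integral>\<^sup>+z. ennreal (norm (exp (C * norm (z::complex^'n)))) \<partial>gauss a) < \<infinity>" .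
qed (measurable)


section \<open>Holomorphic functions of several variables and the Gaussian mean value
  property\<close>

lemma holo_Cn_continuous_on: "holo_Cn f \<Longrightarrow> continuous_on S f"
  by (metis holo_Cn_def has_derivative_continuous continuous_at_imp_continuous_on)

lemma holo_Cn_measurable [measurable_dest]: "holo_Cn f \<Longrightarrow> f \<in> borel_measurable borel"
  by (intro borel_measurable_continuous_onI holo_Cn_continuous_on)

lemma holo_Cn_const: "holo_Cn (\<lambda>_. c)"
  unfolding holo_Cn_def by (auto intro!: exI[of _ "\<lambda>_. 0"])

lemma holo_Cn_add: "holo_Cn f \<Longrightarrow> holo_Cn g \<Longrightarrow> holo_Cn (\<lambda>z. f z + g z)"
  unfolding holo_Cn_def
proof
  fix z assume f: "\<forall>z. \<exists>L. (f has_derivative L) (at z) \<and> (\<forall>c v. L (c *s v) = c * L v)"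
    and g: "\<forall>z. \<exists>L. (g has_derivative L) (at z) \<and> (\<forall>c v. L (c *s v) = c * L v)"
  obtain L M where "(f has_derivative L) (at z)" "\<forall>c v. L (c *s v) = c * L v"
    "(g has_derivative M) (at z)" "\<forall>c v. M (c *s v) = c * M v"
    using f g by metis
  then show "\<exists>L. ((\<lambda>z. f z + g z) has_derivative L) (at z) \<and> (\<forall>c v. L (c *s v) = c * L v)"
    by (intro exI[of _ "\<lambda>v. L v + M v"]) (auto intro!: derivative_eq_intros simp: algebra_simps)
qed

lemma holo_Cn_mult: "holo_Cn f \<Longrightarrow> holo_Cn g \<Longrightarrow> holo_Cn (\<lambda>z. f z * g z)"
  unfolding holo_Cn_def
proof
  fix z assume f: "\<forall>z. \<exists>L. (f has_derivative L) (at z) \<and> (\<forall>c v. L (c *s v) = c * L v)"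
    and g: "\<forall>z. \<exists>L. (g has_derivative L) (at z) \<and> (\<forall>c v. L (c *s v) = c * L v)"
  obtain L M where "(f has_derivative L) (at z)" "\<forall>c v. L (c *s v) = c * L v"
    "(g has_derivative M) (at z)" "\<forall>c v. M (c *s v) = c * M v"
    using f g by metis
  then show "\<exists>L. ((\<lambda>z. f z * g z) has_derivative L) (at z) \<and> (\<forall>c v. L (c *s v) = c * L v)"
    by (intro exI[of _ "\<lambda>v. f z * M v + L v * g z"]) (auto intro!: derivative_eq_intros simp: algebra_simps)
qed

lemma holo_Cn_sum: "(\<And>i. i \<in> I \<Longrightarrow> holo_Cn (f i)) \<Longrightarrow> holo_Cn (\<lambda>z. \<Sum>i\<in>I. f i z)"
  by (induction I rule: infinite_finite_induct) (auto intro: holo_Cn_const holo_Cn_add)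

lemma bounded_linear_cdot: "bounded_linear (\<lambda>z. cdot x z)"
proof (rule bounded_linear_intro[of _ "norm x"])
  show "cmod (cdot x z) \<le> norm z * norm x" for z
    using norm_cdot_le[of x z] by (simp add: mult.commute)
  show "cdot x (r *\<^sub>R y) = r *\<^sub>R cdot x y" for r y
    unfolding cdot_scaleR_right by (simp add: scaleR_conv_of_real)
qed (simp add: cdot_add_right)

lemma holo_Cn_exp_cdot: "holo_Cn (\<lambda>z. exp (cdot x z))"
  unfolding holo_Cn_def
proof
  fix z
  have "((\<lambda>z. exp (cdot x z)) has_derivative (\<lambda>v. exp (cdot x z) * cdot x v)) (at z)"
    by (rule has_derivative_compose[OF bounded_linear_imp_has_derivative[OF bounded_linear_cdot] DERIV_exp[unfolded has_field_derivative_def]])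
  then show "\<exists>L. ((\<lambda>z. exp (cdot x z)) has_derivative L) (at z) \<and> (\<forall>c v. L (c *s v) = c * L v)"
    by (intro exI[of _ "\<lambda>v. exp (cdot x z) * cdot x v"]) (auto simp: cdot_smult_right)
qed

lemma holo_Cn_translate:
  assumes "holo_Cn f"
  shows "holo_Cn (\<lambda>z. f (z + c))"
  unfolding holo_Cn_def
proof
  fix z
  obtain L where L: "(f has_derivative L) (at (z + c))" "\<forall>c v. L (c *s v) = c * L v"
    using assms unfolding holo_Cn_def by metis
  have "((\<lambda>z. f (z + c)) has_derivative (\<lambda>v. L v)) (at z)"
    by (rule has_derivative_compose[of "\<lambda>z. z + c" "\<lambda>v. v", OF _ L(1)]) (auto intro!: derivative_eq_intros)
  then show "\<exists>L. ((\<lambda>z. f (z + c)) has_derivative L) (at z) \<and> (\<forall>c v. L (c *s v) = c * L v)"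
    using L(2) by (intro exI[of _ L]) auto
qed

text \<open>Complex linearity of the derivative gives \<open>L (v *s w) = v * L w\<close>, which is
  a complex derivative in one variable; Cauchy's formula can then be applied on complex
  lines.\<close>

lemma holo_Cn_on_line:
  assumes "holo_Cn f"
  shows "(\<lambda>t. f (t *s w)) holomorphic_on UNIV"
proof (rule holomorphic_onI)
  fix t :: complex
  obtain L where L: "(f has_derivative L) (at (t *s w))" "\<forall>c v. L (c *s v) = c * L v"
    using assms unfolding holo_Cn_def by metis
  have "bounded_linear (\<lambda>t. t *s w)"
    by (rule bounded_linear_intro[of _ "norm w"]) (auto simp: vec_eq_iff algebra_simps)
  then have "((\<lambda>t. f (t *s w)) has_derivative (\<lambda>v. L (v *s w))) (at t)"
    by (rule has_derivative_compose[of "\<lambda>t. t *s w" "\<lambda>v. v *s w" t UNIV f L, OF bounded_linear_imp_has_derivative L(1)])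
  then have "((\<lambda>t. f (t *s w)) has_field_derivative (L w)) (at t)"
  proof -
    have "(\<lambda>v. L (v *s w)) = (*) (L w)" using L(2) by (auto simp: mult.commute)
    then show ?thesis unfolding has_field_derivative_def using \<open>((\<lambda>t. f (t *s w)) has_derivative (\<lambda>v. L (v *s w))) (at t)\<close> by argo
  qed
  then show "(\<lambda>t. f (t *s w)) field_differentiable at t within UNIV"
    by (auto simp: field_differentiable_def)
qed

text \<open>Cauchy's formula at 0 on the line through \<open>w\<close>. The factor
  \<open>1 / u\<close> cancels against the velocity of the circle and leaves a plain average over
  the angle; the radius is absorbed in \<open>w\<close>.\<close>

lemma holo_Cn_circle_mean:
  assumes "holo_Cn f"
  shows "((\<lambda>x. f (cis (2 * pi * x) *s w)) has_integral f 0) {0..1}"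
proof -
  have "(\<lambda>t. f (t *s w)) holomorphic_on cball 0 1"
    using holo_Cn_on_line[OF assms] holomorphic_on_subset by blast
  from Cauchy_integral_circlepath_simple[OF this, of 0]
  have "((\<lambda>u. f (u *s w) / u) has_contour_integral (2 * of_real pi * \<i> * f 0)) (circlepath 0 1)"
    by simp
  then have "((\<lambda>x. f (cis (2 * pi * x) *s w) * (2 * of_real pi * \<i>)) has_integral (2 * of_real pi * \<i> * f 0)) {0..1}"
    unfolding has_contour_integral_def
  proof (rule has_integral_eq[rotated])
    fix x :: real assume "x \<in> {0..1}"
    then have "vector_derivative (circlepath 0 1) (at x within {0..1}) = 2 * pi * \<i> * exp (2 * of_real pi * \<i> * x)"
      using vector_derivative_circlepath01[of x 0 1] by simp
    moreover have "circlepath 0 1 x = exp (2 * of_real pi * \<i> * x)" by (simp add: circlepath)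
    moreover have "cis (2 * pi * x) = exp (2 * of_real pi * \<i> * x)" by (simp add: cis_conv_exp mult_ac)
    ultimately show "f (circlepath 0 1 x *s w) / circlepath 0 1 x * vector_derivative (circlepath 0 1) (at x within {0..1})
       = f (cis (2 * pi * x) *s w) * (2 * of_real pi * \<i>)"
      by simp
  qed
  from has_integral_mult_left[OF this, of "1 / (2 * of_real pi * \<i>)"]
  show ?thesis by (simp add: mult.assoc)
qed

text \<open>Average over the rotations \<open>cis (2 * pi * t)\<close> with \<open>t\<close> uniform
  in the unit interval. Integrating over \<open>z\<close> first gives the Gaussian mean, by rotation
  invariance; integrating over \<open>t\<close> first gives \<open>k 0\<close> for every
  \<open>z\<close>. Fubini equates the two.\<close>

lemma gauss_mean_value:
  fixes k :: "complex^'n \<Rightarrow> complex"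
  assumes a: "a > 0" and h: "holo_Cn k" and int: "integrable (gauss a) k"
  shows "(\<integral>z. k z \<partial>gauss a) = k 0"
proof -
  interpret G: prob_space "gauss a :: (complex^'n) measure" using a by (rule prob_space_gauss)
  define U where "U = restrict_space lborel {0..1::real}"
  interpret U: prob_space U
    by standard (simp add: U_def emeasure_restrict_space space_restrict_space)
  interpret UG: pair_sigma_finite U "gauss a :: (complex^'n) measure" ..
  have [measurable]: "k \<in> borel_measurable borel" using h by (rule holo_Cn_measurable)
  define H where "H = (\<lambda>(t, z). k (cis (2 * pi * t) *s z))"
  have cH: "continuous_on UNIV H"
    unfolding H_def split_def vector_scalar_mult_def
    by (intro continuous_on_compose2[OF holo_Cn_continuous_on[OF h, of UNIV]] continuous_on_vec_lambda continuous_intros continuous_on_component) auto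
  then have [measurable]: "H \<in> borel_measurable (borel \<Otimes>\<^sub>M borel)"
    unfolding borel_prod by (rule borel_measurable_continuous_onI)
  have idU: "(\<lambda>x. x) \<in> measurable U borel" unfolding U_def by (intro measurable_restrict_space1) simp
  have [measurable]: "H \<in> borel_measurable (U \<Otimes>\<^sub>M gauss a)"
  proof -
    have "(\<lambda>p. (fst p, snd p)) \<in> measurable (U \<Otimes>\<^sub>M gauss a) (borel \<Otimes>\<^sub>M borel)"
      by (intro measurable_Pair measurable_compose[OF measurable_fst idU]) measurable
    from measurable_compose[OF this, of H borel] show ?thesis
      using \<open>H \<in> borel_measurable (borel \<Otimes>\<^sub>M borel)\<close> by (simp only: prod.collapse)
  qed
  have rot: "(\<integral>z. F (cis \<theta> *s z) \<partial>gauss a) = (\<integral>z. F z \<partial>gauss a)" 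
    if [measurable]: "F \<in> borel_measurable borel" for F :: "complex^'n \<Rightarrow> 'b::{banach,second_countable_topology}" and \<theta>
  proof -
    have "(\<integral>z. F z \<partial>gauss a) = (\<integral>z. F z \<partial>distr (gauss a) borel (\<lambda>z. cis \<theta> *s z))"
      by (simp add: distr_gauss_rotate[OF a])
    also have "\<dots> = (\<integral>z. F (cis \<theta> *s z) \<partial>gauss a)"
      by (subst integral_distr) auto
    finally show ?thesis ..
  qed
  have roti: "integrable (gauss a) (\<lambda>z. k (cis \<theta> *s z))" for \<theta>
  proof -
    have "integrable (distr (gauss a) borel (\<lambda>z. cis \<theta> *s z)) k"
      using int by (simp add: distr_gauss_rotate[OF a])
    then show ?thesis by (subst (asm) integrable_distr_eq) auto
  qed
  \<comment> \<open>The inner integral of the norm does not depend on the angle, so joint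
    integrability reduces to that of \<open>k\<close>.\<close>
  have intH: "integrable (U \<Otimes>\<^sub>M gauss a) H"
  proof (rule UG.Fubini_integrable)
    have "(\<integral>y. norm (H (x, y)) \<partial>gauss a) = (\<integral>y. norm (k y) \<partial>gauss a)" for x
      using rot[of "\<lambda>z. norm (k z)" "2 * pi * x"] by (simp add: H_def)
    then show "integrable U (\<lambda>x. \<integral>y. norm (H (x, y)) \<partial>gauss a)" by simp
    show "AE x in U. integrable (gauss a) (\<lambda>y. H (x, y))"
      using roti by (simp add: H_def)
  qed simp
  have inner: "(\<integral>x. H (x, z) \<partial>U) = k 0" for z
  proof -
    have c: "continuous_on {0..1} (\<lambda>x. H (x, z))"
      by (rule continuous_on_compose2[OF cH]) (auto intro!: continuous_intros)
    have "(\<integral>x. H (x, z) \<partial>U) = (LBINT x:{0..1}. H (x, z))"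
      unfolding U_def set_lebesgue_integral_def by (subst integral_restrict_space) auto
    also have "\<dots> = integral {0..1} (\<lambda>x. H (x, z))"
      by (rule set_borel_integral_eq_integral) (rule borel_integrable_atLeastAtMost'[OF c])
    also have "\<dots> = k 0"
      using holo_Cn_circle_mean[OF h, of z] by (simp add: H_def integral_unique)
    finally show ?thesis .
  qed
  have "(\<integral>z. k z \<partial>gauss a) = (\<integral>x. (\<integral>z. H (x, z) \<partial>gauss a) \<partial>U)"
    using rot[of k] by (simp add: H_def U.prob_space)
  also have "\<dots> = (\<integral>z. (\<integral>x. H (x, z) \<partial>U) \<partial>gauss a)"
    using UG.Fubini_integral[of "\<lambda>x z. H (x, z)"] intH by simp
  also have "\<dots> = k 0" by (simp add: inner G.prob_space[simplified])
  finally show ?thesis .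
qed

text \<open>The exponential is the quotient of the Gaussian densities at \<open>z + c\<close> and at
  \<open>z\<close>, found by expanding \<open>|z + c|^2\<close>. Both claims are thus translation
  invariance of Lebesgue measure (the Cameron-Martin formula).\<close>

lemma
  fixes F :: "complex^'n \<Rightarrow> 'b::{banach, second_countable_topology}"
  assumes a: "a > 0" and [measurable]: "F \<in> borel_measurable borel"
  shows integral_gauss_translate:
      "(\<integral>z. exp (- (a * (2 * Re (cdot z (vcnj c)) + (norm c)\<^sup>2))) *\<^sub>R F (z + c) \<partial>gauss a) = (\<integral>z. F z \<partial>gauss a)"
    and integrable_gauss_translate:
      "integrable (gauss a) (\<lambda>z. exp (- (a * (2 * Re (cdot z (vcnj c)) + (norm c)\<^sup>2))) *\<^sub>R F (z + c)) \<longleftrightarrow> integrable (gauss a) F"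
proof -
  define w where "w = (\<lambda>z::complex^'n. (a / pi) ^ CARD('n) * exp (- a * (norm z)\<^sup>2))"
  have [measurable]: "w \<in> borel_measurable borel" unfolding w_def by measurable
  have w0: "w z \<ge> 0" for z using a by (simp add: w_def)
  have gw: "gauss a = density lborel w" by (simp add: gauss_def w_def)
  have eq: "w z *\<^sub>R exp (- (a * (2 * Re (cdot z (vcnj c)) + (norm c)\<^sup>2))) *\<^sub>R F (z + c) = w (c + z) *\<^sub>R F (c + z)" for z
    unfolding w_def add.commute[of c] norm_add_vec_sq[of z c] by (simp add: exp_add[symmetric] algebra_simps)
  have "(\<integral>z. exp (- (a * (2 * Re (cdot z (vcnj c)) + (norm c)\<^sup>2))) *\<^sub>R F (z + c) \<partial>gauss a) = (\<integral>z. w (c + z) *\<^sub>R F (c + z) \<partial>lborel)"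
    unfolding gw by (subst integral_density) (auto simp: w0 eq simp del: scaleR_scaleR)
  also have "\<dots> = (\<integral>z. w z *\<^sub>R F z \<partial>distr lborel borel ((+) c))"
    by (subst integral_distr) auto
  also have "\<dots> = (\<integral>z. F z \<partial>gauss a)"
    unfolding gw lborel_distr_plus by (subst integral_density) (auto simp: w0)
  finally show "(\<integral>z. exp (- (a * (2 * Re (cdot z (vcnj c)) + (norm c)\<^sup>2))) *\<^sub>R F (z + c) \<partial>gauss a) = (\<integral>z. F z \<partial>gauss a)" .
  have "integrable (gauss a) (\<lambda>z. exp (- (a * (2 * Re (cdot z (vcnj c)) + (norm c)\<^sup>2))) *\<^sub>R F (z + c))
    \<longleftrightarrow> integrable lborel (\<lambda>z. w (c + z) *\<^sub>R F (c + z))"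
    unfolding gw by (subst integrable_density) (auto simp: w0 eq simp del: scaleR_scaleR)
  also have "\<dots> \<longleftrightarrow> integrable (distr lborel borel ((+) c)) (\<lambda>z. w z *\<^sub>R F z)"
    by (subst integrable_distr_eq) auto
  also have "\<dots> \<longleftrightarrow> integrable (gauss a) F"
    unfolding gw lborel_distr_plus by (subst integrable_density) (auto simp: w0)
  finally show "integrable (gauss a) (\<lambda>z. exp (- (a * (2 * Re (cdot z (vcnj c)) + (norm c)\<^sup>2))) *\<^sub>R F (z + c)) \<longleftrightarrow> integrable (gauss a) F" .
qed

text \<open>Translate by \<open>c = (1/a) y\<close>. The Cameron-Martin factor contains
  \<open>cdot z (vcnj c)\<close> and its conjugate, and the latter cancels the antiholomorphic
  exponential. The new integrand \<open>G\<close> is holomorphic, so its mean is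
  \<open>G 0\<close>.\<close>

lemma gauss_reproducing:
  fixes k :: "complex^'n \<Rightarrow> complex"
  assumes a: "a > 0" and h: "holo_Cn k" and int: "integrable (gauss a) (\<lambda>z. k z * exp (cdot y (vcnj z)))"
  shows "(\<integral>z. k z * exp (cdot y (vcnj z)) \<partial>gauss a) = k ((1/a) *\<^sub>R y)"
proof -
  define c where "c = (1/a) *\<^sub>R y"
  have y: "y = a *\<^sub>R c" using a by (simp add: c_def)
  define F where "F = (\<lambda>z. k z * exp (cdot y (vcnj z)))"
  define G where "G = (\<lambda>z. k (z + c) * exp (cdot (- (a *\<^sub>R vcnj c)) z))"
  note [measurable] = holo_Cn_measurable[OF h]
  have [measurable]: "F \<in> borel_measurable borel" unfolding F_def by measurable
  have FG: "exp (- (a * (2 * Re (cdot z (vcnj c)) + (norm c)\<^sup>2))) *\<^sub>R F (z + c) = G z" for z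
  proof -
    have 1: "of_real (2 * Re (cdot z (vcnj c))) = cdot z (vcnj c) + cdot c (vcnj z)"
      using complex_add_cnj[of "cdot z (vcnj c)"] by (simp add: cnj_cdot cdot_commute)
    have "exp (- (a * (2 * Re (cdot z (vcnj c)) + (norm c)\<^sup>2))) *\<^sub>R F (z + c)
       = k (z + c) * (exp (of_real (- (a * (2 * Re (cdot z (vcnj c)) + (norm c)\<^sup>2)))) * exp (cdot y (vcnj (z + c))))"
      by (simp only: F_def scaleR_conv_of_real exp_of_real mult_ac)
    also have "\<dots> = k (z + c) * exp (of_real (- (a * (2 * Re (cdot z (vcnj c)) + (norm c)\<^sup>2))) + cdot y (vcnj (z + c)))"
      by (simp only: exp_add)
    also have "of_real (- (a * (2 * Re (cdot z (vcnj c)) + (norm c)\<^sup>2))) + cdot y (vcnj (z + c)) 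
        = - of_real a * (of_real (2 * Re (cdot z (vcnj c))) + of_real ((norm c)\<^sup>2)) + of_real a * (cdot c (vcnj z) + of_real ((norm c)\<^sup>2))"
      unfolding y vcnj_add cdot_scaleR_left cdot_add_right cdot_vcnj_self by (simp add: distrib_left)
    also have "\<dots> = - of_real a * cdot z (vcnj c)"
      unfolding 1 by (simp add: algebra_simps)
    also have "\<dots> = cdot (- (a *\<^sub>R vcnj c)) z"
      using cdot_scaleR_left[of "-a" "vcnj c" z] by (simp add: cdot_commute)
    finally show ?thesis by (simp add: G_def)
  qed
  have hG: "holo_Cn G" unfolding G_def by (intro holo_Cn_mult holo_Cn_translate h holo_Cn_exp_cdot)
  have iG: "integrable (gauss a) G"
    using integrable_gauss_translate[OF a, of F c] int by (simp add: FG F_def[symmetric])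
  have "(\<integral>z. F z \<partial>gauss a) = (\<integral>z. G z \<partial>gauss a)"
    using integral_gauss_translate[OF a, of F c] by (simp add: FG)
  also have "\<dots> = G 0" by (rule gauss_mean_value[OF a hG iG])
  finally show ?thesis by (simp add: F_def G_def c_def)
qed

text \<open>On these functions the Bargmann projection is explicit: for \<open>gauss a\<close> it
  sends \<open>expf x y\<close> to \<open>exp (cdot x y / a) * expf x 0\<close>, by the reproducing
  formula.\<close>

definition expf :: "complex^'n \<Rightarrow> complex^'n \<Rightarrow> complex^'n \<Rightarrow> complex" where
  "expf x y z = exp (cdot x z + cdot y (vcnj z))"

lemma expf_measurable [measurable]: "expf x y \<in> borel_measurable borel"
  unfolding expf_def[abs_def] by (intro borel_measurable_continuous_onI continuous_intros)

lemma norm_expf_le: "cmod (expf x y z) \<le> exp ((norm x + norm y) * norm z)"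
proof -
  have "Re (cdot x z + cdot y (vcnj z)) \<le> cmod (cdot x z + cdot y (vcnj z))" by (rule complex_Re_le_cmod)
  also have "\<dots> \<le> norm x * norm z + norm y * norm z"
    by (intro order_trans[OF norm_triangle_ineq] add_mono norm_cdot_le order_trans[OF norm_cdot_le]) auto
  finally show ?thesis by (simp add: expf_def algebra_simps)
qed

lemma integrable_expf:
  assumes "a > 0" shows "integrable (gauss a) (expf x y)"
  by (rule Bochner_Integration.integrable_bound[OF integrable_exp_norm_gauss[OF assms, of "norm x + norm y"]])
     (auto simp: norm_expf_le)

lemma integral_expf:
  assumes "a > 0"
  shows "(\<integral>z. expf x y z \<partial>gauss a) = exp (cdot x y / of_real a)"
proof -
  have "(\<integral>z. exp (cdot x z) * exp (cdot y (vcnj z)) \<partial>gauss a) = exp (cdot x ((1/a) *\<^sub>R y))"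
    using integrable_expf[OF assms, of x y]
    by (intro gauss_reproducing assms holo_Cn_exp_cdot) (simp add: expf_def[abs_def] exp_add)
  then show ?thesis by (simp add: expf_def exp_add cdot_scaleR_right divide_inverse mult.commute)
qed

section \<open>The inequalities of Young and Jensen\<close>

lemma powr_le_Young:
  fixes x :: real
  assumes "x \<ge> 0" "p > 1" "1/p + 1/q = 1"
  shows "x \<le> x powr p / p + 1 / q"
proof -
  have "q > 1"
  proof -
    have "1/p < 1" using assms by simp
    then have "0 < 1/q" "1/q < 1" using assms by (smt (verit) divide_pos_pos)+
    then show ?thesis by (simp add: field_split_simps split: if_splits)
  qed
  then show ?thesis
    using Youngs_inequality[of p q x 1] assms by simp
qed

text \<open>Young's inequality against the constant 1 gives integrability at once. Applied to
  \<open>u / N\<close>, with \<open>N\<close> the p-norm, and integrated, it has right-hand side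
  \<open>1/p + 1/q = 1\<close>. If \<open>N = 0\<close> the function vanishes almost
  everywhere.\<close>

lemma (in prob_space) integral_norm_le_powr:
  fixes u :: "'a \<Rightarrow> 'b::{banach, second_countable_topology}"
  assumes p: "p > 1" and u[measurable]: "u \<in> borel_measurable M" and int: "integrable M (\<lambda>x. norm (u x) powr p)"
  shows "integrable M u" "(\<integral>x. norm (u x) \<partial>M) \<le> (\<integral>x. norm (u x) powr p \<partial>M) powr (1/p)"
proof -
  define q where "q = p / (p - 1)"
  have pq: "1/p + 1/q = 1" using p by (simp add: q_def field_simps)
  have q: "q > 0" using p by (simp add: q_def)
  show iu: "integrable M u"
  proof (rule Bochner_Integration.integrable_bound)
    show "integrable M (\<lambda>x. norm (u x) powr p / p + 1 / q)" using int by simp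
    show "AE x in M. norm (u x) \<le> norm (norm (u x) powr p / p + 1 / q)"
      using powr_le_Young[OF norm_ge_zero p pq] p q by auto
  qed simp
  define N where "N = (\<integral>x. norm (u x) powr p \<partial>M) powr (1/p)"
  have I0: "(\<integral>x. norm (u x) powr p \<partial>M) \<ge> 0" by simp
  show "(\<integral>x. norm (u x) \<partial>M) \<le> N"
  proof (cases "N = 0")
    case True
    then have "(\<integral>x. norm (u x) powr p \<partial>M) = 0" by (simp add: N_def)
    then have "AE x in M. norm (u x) powr p = 0"
      using integral_nonneg_eq_0_iff_AE[OF int] by simp
    then have "AE x in M. norm (u x) = 0" by simp
    then have "(\<integral>x. norm (u x) \<partial>M) = (\<integral>x. 0 \<partial>M)"
      by (intro integral_cong_AE) auto
    then show ?thesis by (simp add: N_def)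
  next
    case False
    then have N: "N > 0" by (simp add: N_def)
    have Np: "N powr p = (\<integral>x. norm (u x) powr p \<partial>M)"
      using p I0 by (simp add: N_def powr_powr)
    have "(\<integral>x. norm (u x) / N \<partial>M) \<le> (\<integral>x. (norm (u x) powr p / N powr p) / p + 1 / q \<partial>M)"
    proof (rule integral_mono)
      show "integrable M (\<lambda>x. norm (u x) / N)" using iu by simp
      show "integrable M (\<lambda>x. (norm (u x) powr p / N powr p) / p + 1 / q)" using int by simp
      show "norm (u x) / N \<le> (norm (u x) powr p / N powr p) / p + 1 / q" for x
        using powr_le_Young[of "norm (u x) / N", OF _ p pq] N by (simp add: powr_divide)
    qed
    also have "\<dots> = (\<integral>x. norm (u x) powr p \<partial>M) / N powr p / p + 1 / q"
      using int by (simp add: prob_space)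
    also have "\<dots> = 1" using Np N pq by (simp add: Np[symmetric])
    finally show ?thesis using N by (simp add: field_simps)
  qed
qed

section \<open>Second order expansion of Gaussian means\<close>

text \<open>Derivatives of the regularised power involve exponents of either sign. For negative ones
  the shift keeps the base away from 0; positive ones are rounded up to an integer. Polynomial
  growth is what makes the later errors integrable against exponentials.\<close>

lemma powr_poly_bound:
  fixes \<epsilon> s :: real
  assumes "\<epsilon> > 0"
  obtains K N where "K \<ge> 0" "\<And>\<tau>. \<tau> \<ge> 0 \<Longrightarrow> (\<tau> + \<epsilon>) powr s \<le> K * (1 + \<tau>) ^ N"
proof (cases "s \<le> 0")
  case True
  show ?thesis
  proof (rule that[of "\<epsilon> powr s" 0])
    show "(\<tau> + \<epsilon>) powr s \<le> \<epsilon> powr s * (1 + \<tau>) ^ 0" if "\<tau> \<ge> 0" for \<tau>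
      using powr_mono2'[OF True, of \<epsilon> "\<tau> + \<epsilon>"] assms that by simp
  qed simp
next
  case False
  define N where "N = nat \<lceil>s\<rceil>"
  have sN: "s \<le> real N" unfolding N_def by linarith
  show ?thesis
  proof (rule that[of "(1 + \<epsilon>) powr s" N])
    fix \<tau> :: real assume t: "\<tau> \<ge> 0"
    have "(\<tau> + \<epsilon>) powr s \<le> ((1 + \<epsilon>) * (1 + \<tau>)) powr s"
      using False assms t by (intro powr_mono2) (auto simp: algebra_simps)
    also have "\<dots> = (1 + \<epsilon>) powr s * (1 + \<tau>) powr s"
      using assms t by (simp add: powr_mult)
    also have "(1 + \<tau>) powr s \<le> (1 + \<tau>) powr real N"
      using sN t by (intro powr_mono) auto
    also have "(1 + \<tau>) powr real N = (1 + \<tau>) ^ N"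
      using t by (simp add: powr_realpow)
    finally show "(\<tau> + \<epsilon>) powr s \<le> (1 + \<epsilon>) powr s * (1 + \<tau>) ^ N"
      by (simp add: mult_left_mono)
  qed simp
qed

text \<open>The map \<open>y \<mapsto> |y|\<^sup>p\<close> is not smooth at \<open>0\<close> for small \<open>p\<close>; it is replaced by \<open>(|y|\<^sup>2 + \<epsilon>) powr (p/2)\<close>, and
  \<open>\<epsilon>\<close> tends to \<open>0\<close> at the very end.\<close>

definition shift_powr :: "real \<Rightarrow> real \<Rightarrow> real \<Rightarrow> real" where
  "shift_powr e \<epsilon> m = (m + \<epsilon>) powr e"

definition shift_powr1 :: "real \<Rightarrow> real \<Rightarrow> real \<Rightarrow> real" where
  "shift_powr1 e \<epsilon> m = e * (m + \<epsilon>) powr (e - 1)"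

definition shift_powr2 :: "real \<Rightarrow> real \<Rightarrow> real \<Rightarrow> real" where
  "shift_powr2 e \<epsilon> m = e * (e - 1) * (m + \<epsilon>) powr (e - 2)"

text \<open>Lagrange remainder of order 3. The intermediate point lies between \<open>m0\<close> and
  \<open>m\<close>, hence below \<open>m0 + m\<close>, so the polynomial bound on the third
  derivative can be stated at \<open>m0 + m\<close>.\<close>

lemma shift_powr_taylor:
  fixes \<epsilon> e :: real
  assumes eps: "\<epsilon> > 0"
  obtains K N where "K \<ge> 0" 
    "\<And>m m0. m \<ge> 0 \<Longrightarrow> m0 \<ge> 0 \<Longrightarrow>
       \<bar>shift_powr e \<epsilon> m - (shift_powr e \<epsilon> m0 + shift_powr1 e \<epsilon> m0 * (m - m0) + shift_powr2 e \<epsilon> m0 / 2 * (m - m0)\<^sup>2)\<bar> \<le> K * (1 + m0 + m) ^ N * \<bar>m - m0\<bar> ^ 3"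
proof -
  obtain K N where K: "K \<ge> 0" "\<And>\<tau>. \<tau> \<ge> 0 \<Longrightarrow> (\<tau> + \<epsilon>) powr (e - 3) \<le> K * (1 + \<tau>) ^ N"
    using powr_poly_bound[OF eps, of "e - 3"] by blast
  define c where "c = \<bar>e * (e - 1) * (e - 2)\<bar>"
  show ?thesis
  proof (rule that[of "c * K" N])
    show "c * K \<ge> 0" using K by (simp add: c_def)
    fix m m0 :: real assume m: "m \<ge> 0" "m0 \<ge> 0"
    show "\<bar>shift_powr e \<epsilon> m - (shift_powr e \<epsilon> m0 + shift_powr1 e \<epsilon> m0 * (m - m0) + shift_powr2 e \<epsilon> m0 / 2 * (m - m0)\<^sup>2)\<bar> \<le> c * K * (1 + m0 + m) ^ N * \<bar>m - m0\<bar> ^ 3"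
    proof (cases "m = m0")
      case False
      define df where "df = (\<lambda>i::nat. if i = 0 then shift_powr e \<epsilon> else if i = 1 then shift_powr1 e \<epsilon> else if i = 2 then shift_powr2 e \<epsilon>
          else (\<lambda>m. e * (e - 1) * (e - 2) * (m + \<epsilon>) powr (e - 3)))"
      have "\<exists>t. (if m < m0 then m < t \<and> t < m0 else m0 < t \<and> t < m) \<and>
        shift_powr e \<epsilon> m = (\<Sum>i<3. (df i m0 / fact i) * (m - m0) ^ i) + (df 3 t / fact 3) * (m - m0) ^ 3"
      proof (rule Taylor[where a = 0 and b = "m + m0"])
        show "\<forall>i t. i < 3 \<and> 0 \<le> t \<and> t \<le> m + m0 \<longrightarrow> (df i has_real_derivative df (Suc i) t) (at t)"
        proof safe
          fix i :: nat and t :: real assume "i < 3" "0 \<le> t"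
          have tp: "t + \<epsilon> > 0" using eps \<open>0 \<le> t\<close> by simp
          have "((\<lambda>t. (t + \<epsilon>) powr s) has_real_derivative s * (t + \<epsilon>) powr (s - 1)) (at t)" for s
            using tp by (auto intro!: derivative_eq_intros simp: powr_diff)
          note d = this
          have d0: "(shift_powr e \<epsilon> has_real_derivative shift_powr1 e \<epsilon> t) (at t)"
            unfolding shift_powr_def[abs_def] shift_powr1_def by (rule d)
          have d1: "(shift_powr1 e \<epsilon> has_real_derivative shift_powr2 e \<epsilon> t) (at t)"
            unfolding shift_powr1_def[abs_def] shift_powr2_def using DERIV_cmult[OF d[of "e - 1"], of e] by (simp add: mult.assoc)
          have d2: "(shift_powr2 e \<epsilon> has_real_derivative (e * (e - 1) * (e - 2) * (t + \<epsilon>) powr (e - 3))) (at t)"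
            unfolding shift_powr2_def[abs_def] using DERIV_cmult[OF d[of "e - 2"], of "e * (e - 1)"] by (simp add: mult.assoc)
          consider "i = 0" | "i = 1" | "i = 2" using \<open>i < 3\<close> by linarith
          then show "(df i has_real_derivative df (Suc i) t) (at t)"
            by cases (use d0 d1 d2 in \<open>auto simp: df_def\<close>)
        qed
      qed (use m False in \<open>auto simp: df_def\<close>)
      then obtain t where t: "if m < m0 then m < t \<and> t < m0 else m0 < t \<and> t < m" and
        eq: "shift_powr e \<epsilon> m = (\<Sum>i<3. (df i m0 / fact i) * (m - m0) ^ i) + (df 3 t / fact 3) * (m - m0) ^ 3" by blast
      have t0: "0 \<le> t" "t \<le> m0 + m" using t m by (auto split: if_splits)
      have "\<bar>shift_powr e \<epsilon> m - (shift_powr e \<epsilon> m0 + shift_powr1 e \<epsilon> m0 * (m - m0) + shift_powr2 e \<epsilon> m0 / 2 * (m - m0)\<^sup>2)\<bar> = \<bar>(df 3 t / 6) * (m - m0) ^ 3\<bar>"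
        unfolding eq by (simp add: df_def eval_nat_numeral)
      also have "\<dots> = \<bar>df 3 t\<bar> / 6 * \<bar>m - m0\<bar> ^ 3" by (simp add: abs_mult power_abs)
      also have "\<dots> \<le> c * K * (1 + m0 + m) ^ N * \<bar>m - m0\<bar> ^ 3"
      proof (intro mult_right_mono)
        have "\<bar>df 3 t\<bar> = c * (t + \<epsilon>) powr (e - 3)" by (simp add: df_def c_def abs_mult)
        also have "\<dots> \<le> c * (K * (1 + t) ^ N)" using K t0 by (intro mult_left_mono) (auto simp: c_def)
        also have "\<dots> \<le> c * (K * (1 + m0 + m) ^ N)" using K t0 by (intro mult_left_mono power_mono) (auto simp: c_def)
        finally have "\<bar>df 3 t\<bar> \<le> c * K * (1 + m0 + m) ^ N" by (simp add: mult.assoc)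
        then show "\<bar>df 3 t\<bar> / 6 \<le> c * K * (1 + m0 + m) ^ N" by linarith
      qed simp
      finally show ?thesis .
    qed (simp)
  qed
qed

definition reg_powr :: "real \<Rightarrow> real \<Rightarrow> complex \<Rightarrow> real" where
  "reg_powr e \<epsilon> y = shift_powr e \<epsilon> ((cmod y)\<^sup>2)"

text \<open>The second order Taylor polynomial of \<open>reg_powr\<close> at \<open>S\<close> in
  direction \<open>Y\<close>. With \<open>x = 2 * Re (cnj S * Y)\<close> the last bracket is
  \<open>x\<^sup>2 / 2\<close>, split into the terms in \<open>|Y|^2\<close> and
  \<open>Y\<^sup>2\<close>, so that its mean requires only the means of \<open>Y\<close>,
  \<open>Y\<^sup>2\<close> and \<open>Y * cnj Y\<close>.\<close>

definition reg_taylor :: "real \<Rightarrow> real \<Rightarrow> complex \<Rightarrow> complex \<Rightarrow> real" where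
  "reg_taylor e \<epsilon> S Y = shift_powr e \<epsilon> ((cmod S)\<^sup>2) + shift_powr1 e \<epsilon> ((cmod S)\<^sup>2) * (2 * Re (cnj S * Y) + (cmod Y)\<^sup>2)
     + shift_powr2 e \<epsilon> ((cmod S)\<^sup>2) * ((cmod S)\<^sup>2 * (cmod Y)\<^sup>2 + Re ((cnj S)\<^sup>2 * Y\<^sup>2))"

text \<open>Two errors are cubic in \<open>Y\<close>: the Taylor remainder in
  \<open>m = |S + Y|^2\<close>, because \<open>m - m0\<close> is of first order in \<open>Y\<close>,
  and the part of \<open>(m - m0)\<^sup>2\<close> beyond \<open>x\<^sup>2\<close>, which
  \<open>reg_taylor\<close> omits.\<close>

lemma reg_powr_taylor:
  fixes \<epsilon> e :: real
  assumes eps: "\<epsilon> > 0"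
  obtains K N where "K \<ge> 0" "\<And>S Y. \<bar>reg_powr e \<epsilon> (S + Y) - reg_taylor e \<epsilon> S Y\<bar> \<le> K * (1 + cmod S + cmod Y) ^ N * cmod Y ^ 3"
proof -
  obtain K N where K: "K \<ge> 0" and KN: "\<And>m m0. m \<ge> 0 \<Longrightarrow> m0 \<ge> 0 \<Longrightarrow>
       \<bar>shift_powr e \<epsilon> m - (shift_powr e \<epsilon> m0 + shift_powr1 e \<epsilon> m0 * (m - m0) + shift_powr2 e \<epsilon> m0 / 2 * (m - m0)\<^sup>2)\<bar> \<le> K * (1 + m0 + m) ^ N * \<bar>m - m0\<bar> ^ 3"
    using shift_powr_taylor[OF eps, of e] by blast
  obtain K2 N2 where K2: "K2 \<ge> 0" "\<And>\<tau>. \<tau> \<ge> 0 \<Longrightarrow> (\<tau> + \<epsilon>) powr (e - 2) \<le> K2 * (1 + \<tau>) ^ N2"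
    using powr_poly_bound[OF eps, of "e - 2"] by blast
  define c where "c = \<bar>e * (e - 1)\<bar>"
  \<comment> \<open>The powers of 3 come from \<open>1 + m0 + m \<le> 3 * W\<^sup>2\<close>, the
    factor 8 from \<open>|m - m0| \<le> 2 * W * cmod Y\<close> cubed, and the factor 2 from the
    bound \<open>4 * W * cmod Y ^ 3\<close> for the omitted part of the square, halved.\<close>
  define A where "A = K * 3 ^ N * 8"
  define B where "B = c * K2 * 3 ^ N2 * 2"
  show ?thesis
  proof (rule that[of "A + B" "2 * N + 2 * N2 + 3"])
    show "A + B \<ge> 0" using K K2 by (simp add: A_def B_def c_def)
    fix S Y :: complex
    define W where "W = 1 + cmod S + cmod Y"
    have W1: "W \<ge> 1" "cmod S \<le> W" "cmod Y \<le> W" by (auto simp: W_def)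
    define m0 where "m0 = (cmod S)\<^sup>2"
    define m where "m = (cmod (S + Y))\<^sup>2"
    define x where "x = 2 * Re (cnj S * Y)"
    have h: "m - m0 = x + (cmod Y)\<^sup>2"
      unfolding m_def m0_def x_def cmod_power2 by (simp add: power2_eq_square algebra_simps)
    have xb: "\<bar>x\<bar> \<le> 2 * (cmod S * cmod Y)"
      using abs_Re_le_cmod[of "cnj S * Y"] by (simp add: x_def norm_mult)
    have hb: "\<bar>m - m0\<bar> \<le> 2 * W * cmod Y"
    proof -
      have "\<bar>m - m0\<bar> \<le> 2 * (cmod S * cmod Y) + cmod Y * cmod Y"
        unfolding h power2_eq_square using xb zero_le_square[of "cmod Y"] by linarith
      also have "\<dots> \<le> 2 * W * cmod Y" by (simp add: W_def algebra_simps)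
      finally show ?thesis .
    qed
    have m0b: "m0 \<le> W\<^sup>2" using W1 by (simp add: m0_def)
    have mb: "m \<le> W\<^sup>2" unfolding m_def W_def by (intro power_mono) (use norm_triangle_ineq[of S Y] in auto)
    have W2: "1 \<le> W\<^sup>2" using W1 by simp
    have pw: "(3 * W\<^sup>2) ^ n = 3 ^ n * W ^ (2 * n)" for n by (simp add: power_mult_distrib power_mult)
    have 1: "\<bar>shift_powr e \<epsilon> m - (shift_powr e \<epsilon> m0 + shift_powr1 e \<epsilon> m0 * (m - m0) + shift_powr2 e \<epsilon> m0 / 2 * (m - m0)\<^sup>2)\<bar> \<le> A * W ^ (2 * N + 3) * cmod Y ^ 3"
    proof -
      have "K * (1 + m0 + m) ^ N * \<bar>m - m0\<bar> ^ 3 \<le> K * (3 * W\<^sup>2) ^ N * (2 * W * cmod Y) ^ 3"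
        using K hb m0b mb W2 by (intro mult_mono power_mono mult_left_mono) (auto simp: m0_def m_def)
      also have "\<dots> = A * W ^ (2 * N + 3) * cmod Y ^ 3"
        by (simp add: A_def pw power_mult_distrib power_add power_mult)
      finally show ?thesis using KN[of m m0] by (force simp: m_def m0_def)
    qed
    have 2: "\<bar>shift_powr2 e \<epsilon> m0 / 2 * ((m - m0)\<^sup>2 - x\<^sup>2)\<bar> \<le> B * W ^ (2 * N2 + 1) * cmod Y ^ 3"
    proof -
      have "(m - m0)\<^sup>2 - x\<^sup>2 = (2 * x + (cmod Y)\<^sup>2) * (cmod Y)\<^sup>2"
        unfolding h by (simp add: power2_eq_square algebra_simps)
      then have "\<bar>(m - m0)\<^sup>2 - x\<^sup>2\<bar> = \<bar>2 * x + (cmod Y)\<^sup>2\<bar> * (cmod Y)\<^sup>2" by (simp add: abs_mult)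
      also have "\<dots> \<le> (4 * W * cmod Y) * (cmod Y)\<^sup>2"
      proof (rule mult_right_mono)
        have "\<bar>2 * x + (cmod Y)\<^sup>2\<bar> \<le> 4 * (cmod S * cmod Y) + cmod Y * cmod Y"
          unfolding power2_eq_square using xb zero_le_square[of "cmod Y"] by linarith
        also have "\<dots> \<le> 4 * W * cmod Y" by (simp add: W_def algebra_simps)
        finally show "\<bar>2 * x + (cmod Y)\<^sup>2\<bar> \<le> 4 * W * cmod Y" .
      qed simp
      finally have a: "\<bar>(m - m0)\<^sup>2 - x\<^sup>2\<bar> \<le> 4 * W * cmod Y ^ 3" by (simp add: power2_eq_square power3_eq_cube mult_ac)
      have "\<bar>shift_powr2 e \<epsilon> m0\<bar> = c * (m0 + \<epsilon>) powr (e - 2)" by (simp add: shift_powr2_def c_def abs_mult)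
      also have "\<dots> \<le> c * (K2 * (1 + m0) ^ N2)" using K2(2)[of m0] by (intro mult_left_mono) (auto simp: c_def m0_def)
      also have "\<dots> \<le> c * (K2 * (3 * W\<^sup>2) ^ N2)" using K2 m0b W2 by (intro mult_left_mono power_mono) (auto simp: c_def m0_def)
      finally have b: "\<bar>shift_powr2 e \<epsilon> m0 / 2\<bar> \<le> c * K2 * 3 ^ N2 * W ^ (2 * N2) / 2" by (simp add: pw mult.assoc power_mult)
      have "\<bar>shift_powr2 e \<epsilon> m0 / 2 * ((m - m0)\<^sup>2 - x\<^sup>2)\<bar> \<le> (c * K2 * 3 ^ N2 * W ^ (2 * N2) / 2) * (4 * W * cmod Y ^ 3)"
        unfolding abs_mult using a b K2 W1 by (intro mult_mono) (auto simp: c_def)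
      also have "\<dots> = B * W ^ (2 * N2 + 1) * cmod Y ^ 3" by (simp add: B_def)
      finally show ?thesis .
    qed
    have xx: "m0 * (cmod Y)\<^sup>2 + Re ((cnj S)\<^sup>2 * Y\<^sup>2) = x\<^sup>2 / 2"
    proof -
      define w where "w = cnj S * Y"
      have "2 * (Re w)\<^sup>2 = (cmod w)\<^sup>2 + Re (w\<^sup>2)"
        unfolding cmod_power2 by (simp add: power2_eq_square)
      moreover have "x\<^sup>2 / 2 = 2 * (Re w)\<^sup>2" unfolding x_def w_def[symmetric] by (simp add: power_mult_distrib)
      moreover have "(cmod w)\<^sup>2 = m0 * (cmod Y)\<^sup>2" by (simp add: m0_def w_def norm_mult power_mult_distrib)
      moreover have "w\<^sup>2 = (cnj S)\<^sup>2 * Y\<^sup>2" by (simp add: w_def power_mult_distrib)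
      ultimately show ?thesis by simp
    qed
    have "reg_powr e \<epsilon> (S + Y) - reg_taylor e \<epsilon> S Y = (shift_powr e \<epsilon> m - (shift_powr e \<epsilon> m0 + shift_powr1 e \<epsilon> m0 * (m - m0) + shift_powr2 e \<epsilon> m0 / 2 * (m - m0)\<^sup>2))
       + shift_powr2 e \<epsilon> m0 / 2 * ((m - m0)\<^sup>2 - x\<^sup>2)"
      unfolding reg_powr_def reg_taylor_def m0_def[symmetric] m_def[symmetric] x_def[symmetric] xx h[symmetric]
      by (simp add: algebra_simps)
    then have "\<bar>reg_powr e \<epsilon> (S + Y) - reg_taylor e \<epsilon> S Y\<bar> \<le> A * W ^ (2 * N + 3) * cmod Y ^ 3 + B * W ^ (2 * N2 + 1) * cmod Y ^ 3"
      using 1 2 by linarith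
    also have "\<dots> \<le> A * W ^ (2 * N + 2 * N2 + 3) * cmod Y ^ 3 + B * W ^ (2 * N + 2 * N2 + 3) * cmod Y ^ 3"
      using W1 K K2 by (intro add_mono mult_right_mono mult_left_mono power_increasing) (auto simp: A_def B_def c_def)
    finally show "\<bar>reg_powr e \<epsilon> (S + Y) - reg_taylor e \<epsilon> S Y\<bar> \<le> (A + B) * (1 + cmod S + cmod Y) ^ (2 * N + 2 * N2 + 3) * cmod Y ^ 3"
      by (simp add: W_def algebra_simps)
  qed
qed

section \<open>Moments of increments of exponential sums\<close>

definition rem2 :: "complex \<Rightarrow> real" where
  "rem2 w = (cmod w)\<^sup>2 * exp (cmod w)"

lemma rem2_nonneg: "rem2 w \<ge> 0" by (simp add: rem2_def)

lemma norm_exp_linear: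
  assumes "0 \<le> t" "t \<le> 1"
  shows "cmod (exp (of_real t * w) - (1 + of_real t * w)) \<le> t\<^sup>2 * rem2 w"
proof -
  have "cmod (exp (of_real t * w) - (1 + of_real t * w)) \<le> exp (cmod (of_real t * w)) * (cmod (of_real t * w))\<^sup>2"
    using Taylor_exp_field[of "of_real t * w" 1] by (simp add: power2_eq_square)
  also have "\<dots> \<le> exp (cmod w) * (t\<^sup>2 * (cmod w)\<^sup>2)"
    using assms by (intro mult_mono) (auto simp: norm_mult power_mult_distrib mult_left_le_one_le)
  finally show ?thesis by (simp add: rem2_def mult_ac)
qed

lemma norm_exp_sub_one: "cmod (exp w - 1) \<le> cmod w * exp (cmod w)"
  using Taylor_exp_field[of w 0] by (simp add: mult.commute)

text \<open>An exponential after a step of variance \<open>t\<close>: the Gaussian variable is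
  scaled by \<open>sqrt t\<close> and the drift \<open>d\<close> by \<open>t\<close>. The drift
  \<open>cdot x y\<close> accompanies the projected exponentials, drift 0 the original ones.\<close>

definition scaled_expf :: "real \<Rightarrow> complex \<Rightarrow> complex^'n \<Rightarrow> complex^'n \<Rightarrow> complex^'n \<Rightarrow> complex" where
  "scaled_expf t d x y z = exp (of_real t * d) * expf (sqrt t *\<^sub>R x) (sqrt t *\<^sub>R y) z"

lemma scaled_expf_measurable [measurable]: "scaled_expf t d x y \<in> borel_measurable borel"
  unfolding scaled_expf_def[abs_def] by measurable

lemma scaled_expf_mult: "scaled_expf t d x y z * scaled_expf t d' x' y' z = scaled_expf t (d + d') (x + x') (y + y') z"
  by (simp add: scaled_expf_def expf_def exp_add[symmetric] scaleR_add_right cdot_add_left algebra_simps)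

lemma cnj_scaled_expf: "cnj (scaled_expf t d x y z) = scaled_expf t (cnj d) (vcnj y) (vcnj x) z"
  by (simp add: scaled_expf_def expf_def exp_cnj cnj_cdot vcnj_scaleR add.commute)

lemma integrable_scaled_expf: "integrable (gauss 1) (scaled_expf t d x y)"
  unfolding scaled_expf_def[abs_def] by (intro integrable_mult_right integrable_expf) simp

lemma integral_scaled_expf:
  assumes "t \<ge> 0"
  shows "(\<integral>z. scaled_expf t d x y z \<partial>gauss 1) = exp (of_real t * (d + cdot x y))"
proof -
  have "(of_real (sqrt t) :: complex) * of_real (sqrt t) = of_real t"
    using assms by (simp flip: of_real_mult)
  then show ?thesis
    using integral_expf[of 1 "sqrt t *\<^sub>R x" "sqrt t *\<^sub>R y"]
    by (simp add: scaled_expf_def cdot_scaleR_left cdot_scaleR_right distrib_left exp_add mult.assoc[symmetric])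
qed

lemma norm_double_sum_le:
  fixes v u :: "'i \<Rightarrow> complex" and c :: "'i \<Rightarrow> 'i \<Rightarrow> complex"
  assumes "\<And>k l. k \<in> I \<Longrightarrow> l \<in> I \<Longrightarrow> cmod (c k l) \<le> B" "\<And>k. k \<in> I \<Longrightarrow> cmod (u k) = cmod (v k)"
  shows "cmod (\<Sum>k\<in>I. \<Sum>l\<in>I. v k * u l * c k l) \<le> B * (\<Sum>k\<in>I. cmod (v k))\<^sup>2"
proof -
  have "cmod (\<Sum>k\<in>I. \<Sum>l\<in>I. v k * u l * c k l) \<le> (\<Sum>k\<in>I. \<Sum>l\<in>I. cmod (v k) * cmod (v l) * B)"
    by (intro sum_norm_le) (auto simp: norm_mult assms intro!: mult_left_mono)
  also have "\<dots> = B * (\<Sum>k\<in>I. cmod (v k))\<^sup>2"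
    by (simp add: power2_eq_square sum_product sum_distrib_left mult_ac)
  finally show ?thesis .
qed

text \<open>The mean of a product of two increments is a second difference of exponentials of this
  kind. Each of the three exponentials is linearised, and each contributes one remainder
  \<open>t\<^sup>2 * R\<close>.\<close>

lemma norm_second_difference:
  assumes t: "0 \<le> t" "t \<le> 1" and R: "rem2 x \<le> R" "rem2 y \<le> R" "rem2 w \<le> R"
  shows "cmod (exp (of_real t * w) - exp (of_real t * x) - exp (of_real t * y) + 1 - of_real t * (w - x - y)) \<le> 3 * t\<^sup>2 * R"
proof -
  have b: "cmod (exp (of_real t * u) - (1 + of_real t * u)) \<le> t\<^sup>2 * R" if "rem2 u \<le> R" for u
    using norm_exp_linear[OF t, of u] mult_left_mono[OF that, of "t\<^sup>2"] by simp
  have "exp (of_real t * w) - exp (of_real t * x) - exp (of_real t * y) + 1 - of_real t * (w - x - y)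
     = (exp (of_real t * w) - (1 + of_real t * w)) - (exp (of_real t * x) - (1 + of_real t * x)) - (exp (of_real t * y) - (1 + of_real t * y))"
    by (simp add: algebra_simps)
  also have "cmod \<dots> \<le> t\<^sup>2 * R + t\<^sup>2 * R + t\<^sup>2 * R"
    by (intro order_trans[OF norm_triangle_ineq4] add_mono b R)
  finally show ?thesis by (simp add: mult_ac)
qed

text \<open>\<open>R\<close> dominates the Taylor remainders of all exponents that occur in the first and second moments of the increment.\<close>

locale exp_increment =
  fixes I :: "'i set" and a b :: "'i \<Rightarrow> complex^'n" and d :: "'i \<Rightarrow> complex" and R :: real
  assumes fin: "finite I"
    and R1: "k \<in> I \<Longrightarrow> rem2 (d k + cdot (a k) (b k)) \<le> R"
    and R1c: "k \<in> I \<Longrightarrow> rem2 (cnj (d k + cdot (a k) (b k))) \<le> R"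
    and R2: "k \<in> I \<Longrightarrow> l \<in> I \<Longrightarrow> rem2 (d k + d l + cdot (a k + a l) (b k + b l)) \<le> R"
    and R3: "k \<in> I \<Longrightarrow> l \<in> I \<Longrightarrow> rem2 (d k + cnj (d l) + cdot (a k + vcnj (b l)) (b k + vcnj (a l))) \<le> R"
begin

abbreviation mass :: "('i \<Rightarrow> complex) \<Rightarrow> real" where
  "mass v \<equiv> \<Sum>k\<in>I. cmod (v k)"

definition "increment t v z = (\<Sum>k\<in>I. v k * (scaled_expf t (d k) (a k) (b k) z - 1))"

lemma increment_measurable [measurable]: "increment t v \<in> borel_measurable borel"
  unfolding increment_def[abs_def] by measurable

lemma increment_sq: "(increment t v z)\<^sup>2 = (\<Sum>k\<in>I. \<Sum>l\<in>I. v k * v l * (scaled_expf t (d k + d l) (a k + a l) (b k + b l) z 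
     - scaled_expf t (d k) (a k) (b k) z - scaled_expf t (d l) (a l) (b l) z + 1))"
  unfolding increment_def power2_eq_square sum_product scaled_expf_mult[symmetric]
  by (intro sum.cong refl) (simp add: algebra_simps)

lemma increment_cnj: "increment t v z * cnj (increment t v z) = (\<Sum>k\<in>I. \<Sum>l\<in>I. v k * cnj (v l) * (scaled_expf t (d k + cnj (d l)) (a k + vcnj (b l)) (b k + vcnj (a l)) z 
     - scaled_expf t (d k) (a k) (b k) z - scaled_expf t (cnj (d l)) (vcnj (b l)) (vcnj (a l)) z + 1))"
  unfolding increment_def cnj_sum sum_product scaled_expf_mult[symmetric] complex_cnj_mult complex_cnj_diff cnj_scaled_expf complex_cnj_one
  by (intro sum.cong refl) (simp add: algebra_simps)

lemma integrable_increment: "integrable (gauss 1) (increment t v)"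
  unfolding increment_def[abs_def] by (intro Bochner_Integration.integrable_sum integrable_mult_right Bochner_Integration.integrable_diff integrable_scaled_expf)
     (simp add: prob_space.finite_measure[OF prob_space_gauss] finite_measure.integrable_const)

lemma integrable_gauss_const: "integrable (gauss 1 :: (complex^'n) measure) (\<lambda>_. c :: complex)"
  by (simp add: prob_space.finite_measure[OF prob_space_gauss] finite_measure.integrable_const)

lemma integrable_increment_sq: "integrable (gauss 1) (\<lambda>z. (increment t v z)\<^sup>2)"
  unfolding increment_sq by (intro Bochner_Integration.integrable_sum integrable_mult_right Bochner_Integration.integrable_diff 
     Bochner_Integration.integrable_add integrable_scaled_expf integrable_gauss_const)

lemma integrable_increment_cnj: "integrable (gauss 1) (\<lambda>z. increment t v z * cnj (increment t v z))"
  unfolding increment_cnj by (intro Bochner_Integration.integrable_sum integrable_mult_right Bochner_Integration.integrable_diff 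
     Bochner_Integration.integrable_add integrable_scaled_expf integrable_gauss_const)

lemmas int_rules = Bochner_Integration.integrable_sum integrable_mult_right Bochner_Integration.integrable_diff 
     Bochner_Integration.integrable_add integrable_scaled_expf integrable_gauss_const

context
  fixes t :: real and v :: "'i \<Rightarrow> complex"
  assumes t: "0 \<le> t" "t \<le> 1"
begin

lemma mean_increment: "cmod ((\<integral>z. increment t v z \<partial>gauss 1) - of_real t * (\<Sum>k\<in>I. v k * (d k + cdot (a k) (b k)))) \<le> t\<^sup>2 * R * mass v"
proof -
  have "(\<integral>z. increment t v z \<partial>gauss 1) = (\<Sum>k\<in>I. v k * (exp (of_real t * (d k + cdot (a k) (b k))) - 1))"
    unfolding increment_def
    by (subst Bochner_Integration.integral_sum)
       (auto intro!: int_rules sum.cong simp: integral_scaled_expf t Bochner_Integration.integral_diff integrable_gauss_const integrable_scaled_expf)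
  then have "(\<integral>z. increment t v z \<partial>gauss 1) - of_real t * (\<Sum>k\<in>I. v k * (d k + cdot (a k) (b k)))
     = (\<Sum>k\<in>I. v k * (exp (of_real t * (d k + cdot (a k) (b k))) - (1 + of_real t * (d k + cdot (a k) (b k)))))"
    by (simp add: sum_distrib_left sum_subtractf[symmetric] algebra_simps)
  also have "cmod \<dots> \<le> (\<Sum>k\<in>I. cmod (v k) * (t\<^sup>2 * R))"
    using R1 by (intro sum_norm_le) (auto simp: norm_mult intro!: mult_left_mono order_trans[OF norm_exp_linear[OF t]])
  also have "\<dots> = t\<^sup>2 * R * mass v" by (simp add: sum_distrib_left mult_ac)
  finally show ?thesis .
qed

text \<open>The exponents of the second difference are linear in \<open>d\<close> and quadratic in
  the vectors. Its first order part therefore loses \<open>d\<close> and the diagonal products and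
  keeps the cross terms of \<open>a\<close> with \<open>b\<close>.\<close>

lemma mean_increment_sq: "cmod ((\<integral>z. (increment t v z)\<^sup>2 \<partial>gauss 1) - of_real t * (\<Sum>k\<in>I. \<Sum>l\<in>I. v k * v l * (cdot (a k) (b l) + cdot (a l) (b k)))) \<le> 3 * t\<^sup>2 * R * (mass v)\<^sup>2"
proof -
  define X where "X k = d k + cdot (a k) (b k)" for k
  define X2 where "X2 k l = d k + d l + cdot (a k + a l) (b k + b l)" for k l
  have "(\<integral>z. (increment t v z)\<^sup>2 \<partial>gauss 1) = (\<Sum>k\<in>I. \<Sum>l\<in>I. v k * v l * (exp (of_real t * X2 k l) - exp (of_real t * X k) - exp (of_real t * X l) + 1))"
    unfolding increment_sq X_def X2_def
    by (simp add: int_rules integral_scaled_expf t integrable_gauss_const Bochner_Integration.integral_sum)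
  moreover have "X2 k l - X k - X l = cdot (a k) (b l) + cdot (a l) (b k)" for k l
    by (simp add: X_def X2_def cdot_add_left cdot_add_right)
  ultimately have "(\<integral>z. (increment t v z)\<^sup>2 \<partial>gauss 1) - of_real t * (\<Sum>k\<in>I. \<Sum>l\<in>I. v k * v l * (cdot (a k) (b l) + cdot (a l) (b k)))
    = (\<Sum>k\<in>I. \<Sum>l\<in>I. v k * v l * (exp (of_real t * X2 k l) - exp (of_real t * X k) - exp (of_real t * X l) + 1 - of_real t * (X2 k l - X k - X l)))"
    by (simp add: sum_distrib_left right_diff_distrib sum_subtractf mult_ac)
  also have "cmod \<dots> \<le> 3 * t\<^sup>2 * R * (mass v)\<^sup>2"
    by (rule norm_double_sum_le) (auto intro!: norm_second_difference t R1[unfolded X_def[symmetric]] R2[unfolded X2_def[symmetric]])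
  finally show ?thesis .
qed

text \<open>Conjugation exchanges the holomorphic and antiholomorphic exponents, so here the
  surviving cross terms pair \<open>a\<close> with \<open>a\<close> and \<open>b\<close> with
  \<open>b\<close>. They sum to the squared norms of the two gradients.\<close>

lemma mean_increment_cnj: "cmod ((\<integral>z. increment t v z * cnj (increment t v z) \<partial>gauss 1) - of_real t * (\<Sum>k\<in>I. \<Sum>l\<in>I. v k * cnj (v l) * (cdot (a k) (vcnj (a l)) + cdot (b k) (vcnj (b l))))) \<le> 3 * t\<^sup>2 * R * (mass v)\<^sup>2"
proof -
  define X where "X k = d k + cdot (a k) (b k)" for k
  define X2 where "X2 k l = d k + cnj (d l) + cdot (a k + vcnj (b l)) (b k + vcnj (a l))" for k l
  have Xc: "cnj (X l) = cnj (d l) + cdot (vcnj (b l)) (vcnj (a l))" for l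
    by (simp add: X_def cnj_cdot cdot_commute)
  have "(\<integral>z. increment t v z * cnj (increment t v z) \<partial>gauss 1) = (\<Sum>k\<in>I. \<Sum>l\<in>I. v k * cnj (v l) * (exp (of_real t * X2 k l) - exp (of_real t * X k) - exp (of_real t * cnj (X l)) + 1))"
    unfolding increment_cnj Xc unfolding X_def X2_def
    by (simp add: int_rules integral_scaled_expf t integrable_gauss_const Bochner_Integration.integral_sum)
  moreover have "X2 k l - X k - cnj (X l) = cdot (a k) (vcnj (a l)) + cdot (b k) (vcnj (b l))" for k l
    unfolding Xc by (simp add: X_def X2_def cdot_add_left cdot_add_right cdot_commute[of "vcnj (b l)" "b k"])
  ultimately have "(\<integral>z. increment t v z * cnj (increment t v z) \<partial>gauss 1) - of_real t * (\<Sum>k\<in>I. \<Sum>l\<in>I. v k * cnj (v l) * (cdot (a k) (vcnj (a l)) + cdot (b k) (vcnj (b l))))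
    = (\<Sum>k\<in>I. \<Sum>l\<in>I. v k * cnj (v l) * (exp (of_real t * X2 k l) - exp (of_real t * X k) - exp (of_real t * cnj (X l)) + 1 - of_real t * (X2 k l - X k - cnj (X l))))"
    by (simp add: sum_distrib_left right_diff_distrib sum_subtractf mult_ac)
  also have "cmod \<dots> \<le> 3 * t\<^sup>2 * R * (mass v)\<^sup>2"
    by (rule norm_double_sum_le) (auto intro!: norm_second_difference t R1[unfolded X_def[symmetric]] R1c[unfolded X_def[symmetric]] R3[unfolded X2_def[symmetric]])
  finally show ?thesis .
qed

text \<open>Pointwise the increment has size \<open>sqrt t\<close>, up to an exponential factor
  whose powers are Gaussian integrable. Cubing this is the origin of the error
  \<open>t * sqrt t\<close>.\<close>

lemma norm_increment_le:
  assumes C0: "\<And>k. k \<in> I \<Longrightarrow> cmod (d k) + norm (a k) + norm (b k) \<le> C0"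
  shows "cmod (increment t v z) \<le> sqrt t * mass v * exp (2 * C0 * (1 + norm z))"
proof -
  have st: "t \<le> sqrt t" "0 \<le> sqrt t" "sqrt t \<le> 1"
    using t by (auto simp: real_le_rsqrt power2_eq_square mult_left_le_one_le)
  have e: "cmod (scaled_expf t (d k) (a k) (b k) z - 1) \<le> sqrt t * exp (2 * C0 * (1 + norm z))" if k: "k \<in> I" for k
  proof -
    define w where "w = of_real t * d k + (cdot (sqrt t *\<^sub>R a k) z + cdot (sqrt t *\<^sub>R b k) (vcnj z))"
    have C00: "C0 \<ge> 0" using C0[OF k] norm_ge_zero[of "d k"] norm_ge_zero[of "a k"] norm_ge_zero[of "b k"] by linarith
    have "cmod w \<le> t * cmod (d k) + (sqrt t * norm (a k) * norm z + sqrt t * norm (b k) * norm z)"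
      unfolding w_def
      by (intro order_trans[OF norm_triangle_ineq] add_mono) 
         (use t in \<open>auto simp: norm_mult intro!: order_trans[OF norm_cdot_le]\<close>)
    also have "\<dots> \<le> sqrt t * cmod (d k) * (1 + norm z) + (sqrt t * norm (a k) * (1 + norm z) + sqrt t * norm (b k) * (1 + norm z))"
    proof (intro add_mono mult_left_mono)
      have "t * cmod (d k) \<le> sqrt t * cmod (d k)" using st by (intro mult_right_mono) auto
      also have "\<dots> \<le> sqrt t * cmod (d k) * (1 + norm z)" using st by (simp add: algebra_simps)
      finally show "t * cmod (d k) \<le> sqrt t * cmod (d k) * (1 + norm z)" .
    qed (use st in auto)
    also have "\<dots> = sqrt t * ((cmod (d k) + norm (a k) + norm (b k)) * (1 + norm z))" by (simp add: algebra_simps)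
    also have "\<dots> \<le> sqrt t * (C0 * (1 + norm z))" using C0[OF k] st by (intro mult_left_mono mult_right_mono) auto
    finally have w: "cmod w \<le> sqrt t * (C0 * (1 + norm z))" .
    have w': "cmod w \<le> C0 * (1 + norm z)"
      using w mult_left_le_one_le[of "C0 * (1 + norm z)" "sqrt t"] st C00 by simp
    have "cmod (exp w - 1) \<le> cmod w * exp (cmod w)" by (rule norm_exp_sub_one)
    also have "\<dots> \<le> (sqrt t * (C0 * (1 + norm z))) * exp (C0 * (1 + norm z))"
      using w w' st C00 by (intro mult_mono) auto
    \<comment> \<open>The linear factor \<open>C0 * (1 + norm z)\<close> is absorbed in a second
      copy of the exponential, hence the 2 in the final exponent.\<close>
    also have "\<dots> \<le> (sqrt t * exp (C0 * (1 + norm z))) * exp (C0 * (1 + norm z))"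
    proof -
      have "C0 * (1 + norm z) \<le> exp (C0 * (1 + norm z))"
        using exp_ge_add_one_self[of "C0 * (1 + norm z)"] by linarith
      then show ?thesis using st by (intro mult_right_mono mult_left_mono) auto
    qed
    also have "\<dots> = sqrt t * exp (2 * C0 * (1 + norm z))" by (simp add: exp_add[symmetric] mult.assoc)
    finally show ?thesis by (simp add: scaled_expf_def expf_def w_def exp_add)
  qed
  have "cmod (increment t v z) \<le> (\<Sum>k\<in>I. cmod (v k) * (sqrt t * exp (2 * C0 * (1 + norm z))))"
    unfolding increment_def by (intro sum_norm_le) (auto simp: norm_mult e mult_left_mono)
  also have "\<dots> = sqrt t * mass v * exp (2 * C0 * (1 + norm z))"
    by (simp add: sum_distrib_left sum_distrib_right mult_ac)
  finally show ?thesis .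
qed

end

text \<open>The derivative at \<open>t = 0\<close> of the mean of \<open>reg_powr e \<epsilon> (\<Sum>k\<in>I. v k * scaled_expf t (d k) (a k) (b k) z)\<close>, as a function of
  the vector \<open>v\<close> of summands.\<close>

definition "generator e \<epsilon> v = (let S = (\<Sum>k\<in>I. v k); D = (\<Sum>k\<in>I. v k *s a k); F = (\<Sum>k\<in>I. v k *s b k) in
   shift_powr1 e \<epsilon> ((cmod S)\<^sup>2) * (2 * Re (cnj S * (\<Sum>k\<in>I. v k * (d k + cdot (a k) (b k)))) + (norm D)\<^sup>2 + (norm F)\<^sup>2)
   + shift_powr2 e \<epsilon> ((cmod S)\<^sup>2) * ((cmod S)\<^sup>2 * ((norm D)\<^sup>2 + (norm F)\<^sup>2) + 2 * Re ((cnj S)\<^sup>2 * cdot D F)))"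

lemma cdot_sum_smult:
  fixes v u :: "'i \<Rightarrow> complex" and x y :: "'i \<Rightarrow> complex^'n"
  shows "cdot (\<Sum>k\<in>I. v k *s x k) (\<Sum>k\<in>I. u k *s y k) = (\<Sum>k\<in>I. \<Sum>l\<in>I. v k * u l * cdot (x k) (y l))"
proof -
  have 1: "cdot (\<Sum>k\<in>J. v k *s x k) w = (\<Sum>k\<in>J. v k * cdot (x k) w)" for w J and v :: "'i \<Rightarrow> complex" and x :: "'i \<Rightarrow> complex^'n"
    by (induction J rule: infinite_finite_induct) (simp_all add: cdot_add_left cdot_smult_left)
  have 2: "cdot w (\<Sum>l\<in>I. u l *s y l) = (\<Sum>l\<in>I. u l * cdot w (y l))" for w
    using 1[of u y I w] by (simp add: cdot_commute)
  show ?thesis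
    unfolding 1 2 sum_distrib_left by (subst sum.swap) (simp add: mult_ac)
qed

lemma vcnj_sum_smult: "vcnj (\<Sum>k\<in>I. v k *s x k) = (\<Sum>k\<in>I. cnj (v k) *s vcnj (x k))"
  by (simp add: vec_eq_iff)

lemma reg_taylor_integral:
  assumes t: "0 \<le> t" "t \<le> 1"
  shows "integrable (gauss 1) (\<lambda>z. reg_taylor e \<epsilon> S (increment t v z))"
    "(\<integral>z. reg_taylor e \<epsilon> S (increment t v z) \<partial>gauss 1) = 
      shift_powr e \<epsilon> ((cmod S)\<^sup>2) + shift_powr1 e \<epsilon> ((cmod S)\<^sup>2) * (2 * Re (cnj S * (\<integral>z. increment t v z \<partial>gauss 1)) + Re (\<integral>z. increment t v z * cnj (increment t v z) \<partial>gauss 1))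
     + shift_powr2 e \<epsilon> ((cmod S)\<^sup>2) * ((cmod S)\<^sup>2 * Re (\<integral>z. increment t v z * cnj (increment t v z) \<partial>gauss 1) + Re ((cnj S)\<^sup>2 * (\<integral>z. (increment t v z)\<^sup>2 \<partial>gauss 1)))"
proof -
  interpret prob_space "gauss 1 :: (complex^'n) measure" by (rule prob_space_gauss) simp
  have c: "(cmod y)\<^sup>2 = Re (y * cnj y)" for y unfolding cmod_power2 by (simp add: power2_eq_square)
  have i1: "integrable (gauss 1) (\<lambda>z. Re (cnj S * increment t v z))"
    by (intro integrable_Re integrable_mult_right integrable_increment)
  have i2: "integrable (gauss 1) (\<lambda>z. Re (increment t v z * cnj (increment t v z)))"
    by (intro integrable_Re integrable_increment_cnj)
  have i3: "integrable (gauss 1) (\<lambda>z. Re ((cnj S)\<^sup>2 * (increment t v z)\<^sup>2))"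
    by (intro integrable_Re integrable_mult_right integrable_increment_sq)
  have e1: "(\<integral>z. Re (cnj S * increment t v z) \<partial>gauss 1) = Re (cnj S * (\<integral>z. increment t v z \<partial>gauss 1))"
    by (subst integral_Re) (auto intro: integrable_mult_right integrable_increment)
  have e2: "(\<integral>z. Re (increment t v z * cnj (increment t v z)) \<partial>gauss 1) = Re (\<integral>z. increment t v z * cnj (increment t v z) \<partial>gauss 1)"
    by (subst integral_Re) (auto intro: integrable_increment_cnj)
  have e3: "(\<integral>z. Re ((cnj S)\<^sup>2 * (increment t v z)\<^sup>2) \<partial>gauss 1) = Re ((cnj S)\<^sup>2 * (\<integral>z. (increment t v z)\<^sup>2 \<partial>gauss 1))"
    by (subst integral_Re) (auto intro: integrable_mult_right integrable_increment_sq)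
  show "integrable (gauss 1) (\<lambda>z. reg_taylor e \<epsilon> S (increment t v z))"
    unfolding reg_taylor_def c[of "increment t v _"]
    by (intro Bochner_Integration.integrable_add integrable_mult_right i1 i2 i3 integrable_const)
  have "(\<integral>z. reg_taylor e \<epsilon> S (increment t v z) \<partial>gauss 1) = 
     (\<integral>z. shift_powr e \<epsilon> ((cmod S)\<^sup>2) \<partial>(gauss 1 :: (complex^'n) measure)) + shift_powr1 e \<epsilon> ((cmod S)\<^sup>2) * (2 * (\<integral>z. Re (cnj S * increment t v z) \<partial>gauss 1) + (\<integral>z. Re (increment t v z * cnj (increment t v z)) \<partial>gauss 1))
     + shift_powr2 e \<epsilon> ((cmod S)\<^sup>2) * ((cmod S)\<^sup>2 * (\<integral>z. Re (increment t v z * cnj (increment t v z)) \<partial>gauss 1) + (\<integral>z. Re ((cnj S)\<^sup>2 * (increment t v z)\<^sup>2) \<partial>gauss 1))"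
    unfolding reg_taylor_def c[of "increment t v _"]
    by (simp only: Bochner_Integration.integral_add integral_mult_right_zero Bochner_Integration.integrable_add integrable_mult_right i1 i2 i3 integrable_const)
  then show "(\<integral>z. reg_taylor e \<epsilon> S (increment t v z) \<partial>gauss 1) = 
      shift_powr e \<epsilon> ((cmod S)\<^sup>2) + shift_powr1 e \<epsilon> ((cmod S)\<^sup>2) * (2 * Re (cnj S * (\<integral>z. increment t v z \<partial>gauss 1)) + Re (\<integral>z. increment t v z * cnj (increment t v z) \<partial>gauss 1))
     + shift_powr2 e \<epsilon> ((cmod S)\<^sup>2) * ((cmod S)\<^sup>2 * Re (\<integral>z. increment t v z * cnj (increment t v z) \<partial>gauss 1) + Re ((cnj S)\<^sup>2 * (\<integral>z. (increment t v z)\<^sup>2 \<partial>gauss 1)))"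
    unfolding e1 e2 e3 by simp
qed

text \<open>The three moments are replaced by their first order parts, which assemble to
  \<open>generator\<close>. The constant 5 is \<open>2 * 1 + 3\<close>, from the doubled first
  moment and the mean of the squared modulus; 6 is \<open>3 + 3\<close>, from the two second
  moments.\<close>

lemma reg_taylor_integral_bound:
  assumes t: "0 \<le> t" "t \<le> 1" and S: "S = (\<Sum>k\<in>I. v k)" and V: "V = mass v"
  shows "\<bar>(\<integral>z. reg_taylor e \<epsilon> S (increment t v z) \<partial>gauss 1) - (shift_powr e \<epsilon> ((cmod S)\<^sup>2) + t * generator e \<epsilon> v)\<bar>
    \<le> t\<^sup>2 * R * (\<bar>shift_powr1 e \<epsilon> ((cmod S)\<^sup>2)\<bar> * (5 * V\<^sup>2) + \<bar>shift_powr2 e \<epsilon> ((cmod S)\<^sup>2)\<bar> * (6 * V ^ 4))"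
proof -
  define p1 where "p1 = shift_powr1 e \<epsilon> ((cmod S)\<^sup>2)"
  define p2 where "p2 = shift_powr2 e \<epsilon> ((cmod S)\<^sup>2)"
  define D where "D = (\<Sum>k\<in>I. v k *s a k)"
  define F where "F = (\<Sum>k\<in>I. v k *s b k)"
  define L where "L = (\<Sum>k\<in>I. v k * (d k + cdot (a k) (b k)))"
  define M1 where "M1 = (\<integral>z. increment t v z \<partial>gauss 1)"
  define M2 where "M2 = (\<integral>z. (increment t v z)\<^sup>2 \<partial>gauss 1)"
  define Mc where "Mc = (\<integral>z. increment t v z * cnj (increment t v z) \<partial>gauss 1)"
  have SV: "cmod S \<le> V" unfolding S V by (rule norm_sum)
  have V0: "V \<ge> 0" using SV norm_ge_zero order_trans by blast
  have b1: "cmod (M1 - of_real t * L) \<le> t\<^sup>2 * R * V"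
    unfolding M1_def L_def V by (rule mean_increment[OF t])
  have b2: "cmod (M2 - of_real t * (2 * cdot D F)) \<le> 3 * t\<^sup>2 * R * V\<^sup>2"
  proof -
    have "(\<Sum>k\<in>I. \<Sum>l\<in>I. v k * v l * (cdot (a k) (b l) + cdot (a l) (b k))) = 2 * cdot D F"
      using sum.swap[of "\<lambda>k l. v k * v l * cdot (a l) (b k)" I I]
      by (simp add: D_def F_def cdot_sum_smult distrib_left sum.distrib mult.commute[of "v _" "v _"])
    then show ?thesis using mean_increment_sq[OF t, of v] unfolding M2_def V by simp
  qed
  have bc: "cmod (Mc - of_real t * of_real ((norm D)\<^sup>2 + (norm F)\<^sup>2)) \<le> 3 * t\<^sup>2 * R * V\<^sup>2"
  proof -
    have "(\<Sum>k\<in>I. \<Sum>l\<in>I. v k * cnj (v l) * (cdot (a k) (vcnj (a l)) + cdot (b k) (vcnj (b l)))) = cdot D (vcnj D) + cdot F (vcnj F)"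
      unfolding D_def F_def vcnj_sum_smult cdot_sum_smult by (simp add: distrib_left sum.distrib)
    then show ?thesis using mean_increment_cnj[OF t, of v] unfolding Mc_def V cdot_vcnj_self by simp
  qed
  have Re_lin: "Re (A * (M - of_real t * L)) = Re (A * M) - t * Re (A * L)" for A M L :: complex
    by (simp add: algebra_simps)
  have Re_two: "Re (2 * w) = 2 * Re w" for w :: complex by simp
  have r1: "\<bar>Re (cnj S * M1) - t * Re (cnj S * L)\<bar> \<le> t\<^sup>2 * R * V\<^sup>2"
  proof -
    have "\<bar>Re (cnj S * M1) - t * Re (cnj S * L)\<bar> = \<bar>Re (cnj S * (M1 - of_real t * L))\<bar>"
      by (simp only: Re_lin)
    also have "\<dots> \<le> cmod S * cmod (M1 - of_real t * L)"
      using abs_Re_le_cmod[of "cnj S * (M1 - of_real t * L)"] by (simp add: norm_mult)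
    also have "\<dots> \<le> V * (t\<^sup>2 * R * V)" by (intro mult_mono SV b1 V0 norm_ge_zero)
    finally show ?thesis by (simp add: power2_eq_square mult_ac)
  qed
  have rc: "\<bar>Re Mc - t * ((norm D)\<^sup>2 + (norm F)\<^sup>2)\<bar> \<le> 3 * t\<^sup>2 * R * V\<^sup>2"
  proof -
    have "\<bar>Re Mc - t * ((norm D)\<^sup>2 + (norm F)\<^sup>2)\<bar> = \<bar>Re (Mc - of_real t * of_real ((norm D)\<^sup>2 + (norm F)\<^sup>2))\<bar>"
      using Re_lin[of 1 Mc "of_real ((norm D)\<^sup>2 + (norm F)\<^sup>2)"] by (simp only: mult_1 Re_complex_of_real)
    then show ?thesis using order_trans[OF abs_Re_le_cmod bc] by simp
  qed
  have r2: "\<bar>Re ((cnj S)\<^sup>2 * M2) - t * (2 * Re ((cnj S)\<^sup>2 * cdot D F))\<bar> \<le> 3 * t\<^sup>2 * R * V ^ 4"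
  proof -
    have "\<bar>Re ((cnj S)\<^sup>2 * M2) - t * (2 * Re ((cnj S)\<^sup>2 * cdot D F))\<bar> = \<bar>Re ((cnj S)\<^sup>2 * (M2 - of_real t * (2 * cdot D F)))\<bar>"
    proof -
      have "Re ((cnj S)\<^sup>2 * (2 * cdot D F)) = 2 * Re ((cnj S)\<^sup>2 * cdot D F)"
        unfolding mult.left_commute[of _ 2] by (simp only: Re_two)
      then show ?thesis by (simp only: Re_lin)
    qed
    also have "\<dots> \<le> (cmod S)\<^sup>2 * cmod (M2 - of_real t * (2 * cdot D F))"
      using abs_Re_le_cmod[of "(cnj S)\<^sup>2 * (M2 - of_real t * (2 * cdot D F))"] by (simp add: norm_mult norm_power)
    also have "\<dots> \<le> V\<^sup>2 * (3 * t\<^sup>2 * R * V\<^sup>2)" by (intro mult_mono power_mono SV b2 V0 norm_ge_zero zero_le_power)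
    finally show ?thesis by (simp add: power2_eq_square power4_eq_xxxx mult_ac)
  qed
  have rc2: "\<bar>(cmod S)\<^sup>2 * Re Mc - t * ((cmod S)\<^sup>2 * ((norm D)\<^sup>2 + (norm F)\<^sup>2))\<bar> \<le> 3 * t\<^sup>2 * R * V ^ 4"
  proof -
    have "\<bar>(cmod S)\<^sup>2 * Re Mc - t * ((cmod S)\<^sup>2 * ((norm D)\<^sup>2 + (norm F)\<^sup>2))\<bar> = (cmod S)\<^sup>2 * \<bar>Re Mc - t * ((norm D)\<^sup>2 + (norm F)\<^sup>2)\<bar>"
    proof -
      have "(cmod S)\<^sup>2 * Re Mc - t * ((cmod S)\<^sup>2 * ((norm D)\<^sup>2 + (norm F)\<^sup>2)) = (cmod S)\<^sup>2 * (Re Mc - t * ((norm D)\<^sup>2 + (norm F)\<^sup>2))"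
        by (simp add: algebra_simps)
      then show ?thesis by (simp add: abs_mult)
    qed
    also have "\<dots> \<le> V\<^sup>2 * (3 * t\<^sup>2 * R * V\<^sup>2)" by (intro mult_mono power_mono SV rc V0 norm_ge_zero zero_le_power abs_ge_zero)
    finally show ?thesis by (simp add: power2_eq_square power4_eq_xxxx mult_ac)
  qed
  have eq: "(\<integral>z. reg_taylor e \<epsilon> S (increment t v z) \<partial>gauss 1) - (shift_powr e \<epsilon> ((cmod S)\<^sup>2) + t * generator e \<epsilon> v)
     = p1 * (2 * (Re (cnj S * M1) - t * Re (cnj S * L)) + (Re Mc - t * ((norm D)\<^sup>2 + (norm F)\<^sup>2)))
     + p2 * (((cmod S)\<^sup>2 * Re Mc - t * ((cmod S)\<^sup>2 * ((norm D)\<^sup>2 + (norm F)\<^sup>2))) + (Re ((cnj S)\<^sup>2 * M2) - t * (2 * Re ((cnj S)\<^sup>2 * cdot D F))))"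
    unfolding reg_taylor_integral(2)[OF t] generator_def Let_def S[symmetric] D_def[symmetric] F_def[symmetric] L_def[symmetric]
      p1_def[symmetric] p2_def[symmetric] M1_def[symmetric] M2_def[symmetric] Mc_def[symmetric]
    by (simp add: distrib_left right_diff_distrib mult_ac)
  have "\<bar>(\<integral>z. reg_taylor e \<epsilon> S (increment t v z) \<partial>gauss 1) - (shift_powr e \<epsilon> ((cmod S)\<^sup>2) + t * generator e \<epsilon> v)\<bar> \<le> \<bar>p1\<bar> * (2 * (t\<^sup>2 * R * V\<^sup>2) + 3 * t\<^sup>2 * R * V\<^sup>2) + \<bar>p2\<bar> * (3 * t\<^sup>2 * R * V ^ 4 + 3 * t\<^sup>2 * R * V ^ 4)"
  proof -
    have *: "\<bar>2 * x + y\<bar> \<le> 2 * X + Z" and **: "\<bar>x + y\<bar> \<le> X + Z" if "\<bar>x\<bar> \<le> X" "\<bar>y\<bar> \<le> Z" for x y X Z :: real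
      using that by linarith+
    have p: "\<bar>p1 * x + p2 * y\<bar> \<le> \<bar>p1\<bar> * X + \<bar>p2\<bar> * Z" if "\<bar>x\<bar> \<le> X" "\<bar>y\<bar> \<le> Z" for x y X Z
    proof -
      have "\<bar>p1 * x\<bar> \<le> \<bar>p1\<bar> * X" "\<bar>p2 * y\<bar> \<le> \<bar>p2\<bar> * Z"
        unfolding abs_mult by (rule mult_left_mono[OF that(1) abs_ge_zero], rule mult_left_mono[OF that(2) abs_ge_zero])
      then show ?thesis using abs_triangle_ineq[of "p1 * x" "p2 * y"] by linarith
    qed
    have q: "\<bar>2 * (Re (cnj S * M1) - t * Re (cnj S * L)) + (Re Mc - t * ((norm D)\<^sup>2 + (norm F)\<^sup>2))\<bar> \<le> 2 * (t\<^sup>2 * R * V\<^sup>2) + 3 * t\<^sup>2 * R * V\<^sup>2"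
      by (rule *[OF r1 rc])
    have r: "\<bar>((cmod S)\<^sup>2 * Re Mc - t * ((cmod S)\<^sup>2 * ((norm D)\<^sup>2 + (norm F)\<^sup>2))) + (Re ((cnj S)\<^sup>2 * M2) - t * (2 * Re ((cnj S)\<^sup>2 * cdot D F)))\<bar> \<le> 3 * t\<^sup>2 * R * V ^ 4 + 3 * t\<^sup>2 * R * V ^ 4"
      by (rule **[OF rc2 r2])
    show ?thesis unfolding eq by (rule p[OF q r])
  qed
  also have "\<dots> = t\<^sup>2 * R * (\<bar>p1\<bar> * (5 * V\<^sup>2) + \<bar>p2\<bar> * (6 * V ^ 4))"
  proof -
    have "A * (2 * (s * R * u) + 3 * s * R * u) + B * (3 * s * R * w + 3 * s * R * w) = s * R * (A * (5 * u) + B * (6 * w))" for A B s u w :: real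
      by (simp add: algebra_simps)
    then show ?thesis .
  qed
  finally show ?thesis unfolding p1_def p2_def .
qed

end

section \<open>First order expansion in the step size\<close>

lemma reg_powr_nonneg: "reg_powr e \<epsilon> y \<ge> 0"
  by (simp add: reg_powr_def shift_powr_def)

lemma continuous_on_reg_powr: "\<epsilon> > 0 \<Longrightarrow> continuous_on UNIV (reg_powr e \<epsilon>)"
  unfolding reg_powr_def[abs_def] shift_powr_def
proof (intro continuous_intros ballI)
  fix x :: complex assume "\<epsilon> > 0"
  then have "(cmod x)\<^sup>2 + \<epsilon> > 0" by (intro add_nonneg_pos) auto
  then show "(cmod x)\<^sup>2 + \<epsilon> \<noteq> 0" by simp
qed

lemma reg_powr_measurable [measurable]: "\<epsilon> > 0 \<Longrightarrow> reg_powr e \<epsilon> \<in> borel_measurable borel"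
  by (intro borel_measurable_continuous_onI continuous_on_reg_powr)

context exp_increment
begin

text \<open>The mean of the Taylor polynomial is known from the moments up to
  \<open>t\<^sup>2\<close>, and the cubic remainder contributes \<open>t * sqrt t\<close>. The error
  is polynomial in \<open>mass v\<close>, uniformly in \<open>v\<close>, because \<open>v\<close>
  will itself be random and the error will be integrated over it.\<close>

lemma expansion:
  fixes \<epsilon> e :: real
  assumes eps: "\<epsilon> > 0"
  obtains C N where "C \<ge> 0" "\<And>v t. 0 \<le> t \<Longrightarrow> t \<le> 1 \<Longrightarrow> integrable (gauss 1) (\<lambda>z. reg_powr e \<epsilon> ((\<Sum>k\<in>I. v k) + increment t v z))"
    "\<And>v t. 0 \<le> t \<Longrightarrow> t \<le> 1 \<Longrightarrow>
       \<bar>(\<integral>z. reg_powr e \<epsilon> ((\<Sum>k\<in>I. v k) + increment t v z) \<partial>gauss 1) - (shift_powr e \<epsilon> ((cmod (\<Sum>k\<in>I. v k))\<^sup>2) + t * generator e \<epsilon> v)\<bar>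
         \<le> C * (t * sqrt t) * (1 + mass v) ^ N"
proof -
  interpret P: prob_space "gauss 1 :: (complex^'n) measure" by (rule prob_space_gauss) simp
  obtain K N where K: "K \<ge> 0" and KN: "\<And>S increment. \<bar>reg_powr e \<epsilon> (S + increment) - reg_taylor e \<epsilon> S increment\<bar> \<le> K * (1 + cmod S + cmod increment) ^ N * cmod increment ^ 3"
    using reg_powr_taylor[OF eps] by blast
  obtain K1 N1 where K1: "K1 \<ge> 0" "\<And>\<tau>. \<tau> \<ge> 0 \<Longrightarrow> (\<tau> + \<epsilon>) powr (e - 1) \<le> K1 * (1 + \<tau>) ^ N1"
    using powr_poly_bound[OF eps, of "e - 1"] by blast
  obtain K2 N2 where K2: "K2 \<ge> 0" "\<And>\<tau>. \<tau> \<ge> 0 \<Longrightarrow> (\<tau> + \<epsilon>) powr (e - 2) \<le> K2 * (1 + \<tau>) ^ N2"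
    using powr_poly_bound[OF eps, of "e - 2"] by blast
  define C0 where "C0 = (\<Sum>k\<in>I. cmod (d k) + norm (a k) + norm (b k))"
  have C0: "cmod (d k) + norm (a k) + norm (b k) \<le> C0" if "k \<in> I" for k
    unfolding C0_def using that fin by (intro member_le_sum) auto
  have C00: "C0 \<ge> 0" unfolding C0_def by (intro sum_nonneg) auto
  \<comment> \<open>Majorant for the increments. Being at least 1, it can be inserted into any
    factor, and all its powers are integrable.\<close>
  define G where "G = (\<lambda>z::complex^'n. exp (2 * C0 * (1 + norm z)))"
  have G1: "G z \<ge> 1" for z using C00 by (simp add: G_def)
  have Gint: "integrable (gauss 1) (\<lambda>z. G z ^ n)" for n
  proof -
    have "G z ^ n = exp (real n * (2 * C0)) * exp ((real n * (2 * C0)) * norm z)" for z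
      by (simp add: G_def exp_of_nat_mult[symmetric] exp_add[symmetric] algebra_simps)
    then show ?thesis using integrable_exp_norm_gauss[of 1] by simp
  qed
  define M where "M = (\<integral>z. G z ^ (N + 3) \<partial>gauss 1)"
  have M0: "M \<ge> 0" unfolding M_def by (intro integral_nonneg_AE AE_I2 zero_le_power) (use G1 order_trans[OF zero_le_one] in blast)
  define R' where "R' = \<bar>R\<bar>"
  define c1 where "c1 = \<bar>e\<bar> * K1"
  define c2 where "c2 = \<bar>e * (e - 1)\<bar> * K2"
  \<comment> \<open>A common exponent for three error terms: \<open>N + 3\<close> from the cubic
    remainder, \<open>2 * N1 + 2\<close> and \<open>2 * N2 + 4\<close> from the derivatives
    multiplied by \<open>V\<^sup>2\<close> and \<open>V ^ 4\<close>.\<close>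
  define NN where "NN = N + 3 + (2 * N1 + 2) + (2 * N2 + 4)"
  define C where "C = K * 2 ^ N * M + R' * (c1 * 5 + c2 * 6)"
  have rem: "\<bar>reg_powr e \<epsilon> (S + increment t v z) - reg_taylor e \<epsilon> S (increment t v z)\<bar> \<le> K * 2 ^ N * (t * sqrt t) * (1 + V) ^ (N + 3) * G z ^ (N + 3)"
    if t: "0 \<le> t" "t \<le> 1" and S: "S = (\<Sum>k\<in>I. v k)" and V: "V = mass v" for t v z S V
  proof -
    have SV: "cmod S \<le> V" unfolding S V by (rule norm_sum)
    have V0: "V \<ge> 0" using SV norm_ge_zero order_trans by blast
    have st: "0 \<le> sqrt t" "sqrt t \<le> 1" using t by auto
    have Yb: "cmod (increment t v z) \<le> sqrt t * V * G z" unfolding V G_def by (rule norm_increment_le[OF t C0])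
    have Yb2: "cmod (increment t v z) \<le> V * G z"
    proof -
      have "sqrt t * (V * G z) \<le> V * G z" using st V0 G1[of z] by (intro mult_left_le_one_le) auto
      then show ?thesis using Yb by (simp add: mult.assoc)
    qed
    have "1 + cmod S + cmod (increment t v z) \<le> (1 + V) + V * G z" using SV Yb2 by linarith
    also have "\<dots> \<le> (1 + V) * G z + (1 + V) * G z"
    proof (rule add_mono)
      show "1 + V \<le> (1 + V) * G z" using mult_left_mono[OF G1[of z], of "1 + V"] V0 by simp
      show "V * G z \<le> (1 + V) * G z" using G1[of z] by (intro mult_right_mono) auto
    qed
    finally have W: "1 + cmod S + cmod (increment t v z) \<le> 2 * ((1 + V) * G z)" by (simp add: mult_ac)
    have Y3: "cmod (increment t v z) \<le> sqrt t * ((1 + V) * G z)"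
    proof -
      have "sqrt t * V * G z \<le> sqrt t * (1 + V) * G z" using st G1[of z] by (intro mult_right_mono mult_left_mono) auto
      then show ?thesis using Yb by (simp add: mult.assoc)
    qed
    have "K * (1 + cmod S + cmod (increment t v z)) ^ N * cmod (increment t v z) ^ 3 \<le> K * (2 * ((1 + V) * G z)) ^ N * (sqrt t * ((1 + V) * G z)) ^ 3"
      using K W Y3 by (intro mult_mono mult_left_mono power_mono) (auto intro!: mult_nonneg_nonneg zero_le_power, (use V0 G1[of z] in linarith)+)
    also have "\<dots> = K * 2 ^ N * (sqrt t ^ 3) * (1 + V) ^ (N + 3) * G z ^ (N + 3)"
      by (simp only: power_mult_distrib power_add mult_ac)
    also have "sqrt t ^ 3 = t * sqrt t" using t by (simp add: power3_eq_cube)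
    finally show ?thesis using KN[of S "increment t v z"] by simp
  qed
  have remi: "integrable (gauss 1) (\<lambda>z. reg_powr e \<epsilon> (S + increment t v z) - reg_taylor e \<epsilon> S (increment t v z))"
    if t: "0 \<le> t" "t \<le> 1" and S: "S = (\<Sum>k\<in>I. v k)" for t v S
  proof (rule Bochner_Integration.integrable_bound)
    show "integrable (gauss 1) (\<lambda>z. K * 2 ^ N * (t * sqrt t) * (1 + mass v) ^ (N + 3) * G z ^ (N + 3))"
      by (intro integrable_mult_right Gint)
    show "(\<lambda>z. reg_powr e \<epsilon> (S + increment t v z) - reg_taylor e \<epsilon> S (increment t v z)) \<in> borel_measurable (gauss 1)"
    proof -
      have "(\<lambda>z. reg_powr e \<epsilon> (S + increment t v z)) \<in> borel_measurable borel"
        using eps by measurable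
      then show ?thesis using borel_measurable_integrable[OF reg_taylor_integral(1)[OF t, of e \<epsilon> S v]]
        by (intro borel_measurable_diff) auto
    qed
    show "AE z in gauss 1. norm (reg_powr e \<epsilon> (S + increment t v z) - reg_taylor e \<epsilon> S (increment t v z)) \<le> norm (K * 2 ^ N * (t * sqrt t) * (1 + mass v) ^ (N + 3) * G z ^ (N + 3))"
      using rem[OF t S refl] by (intro AE_I2) (simp add: order_trans[OF _ abs_ge_self])
  qed
  have Thi: "integrable (gauss 1) (\<lambda>z. reg_powr e \<epsilon> (S + increment t v z))"
    if t: "0 \<le> t" "t \<le> 1" and S: "S = (\<Sum>k\<in>I. v k)" for t v S
    using Bochner_Integration.integrable_add[OF remi[OF t S] reg_taylor_integral(1)[OF t, of e \<epsilon> S v]] by simp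
  show ?thesis
  proof (rule that[of C NN])
    show "C \<ge> 0" using K K1 K2 M0 by (simp add: C_def c1_def c2_def R'_def)
    show "integrable (gauss 1) (\<lambda>z. reg_powr e \<epsilon> ((\<Sum>k\<in>I. v k) + increment t v z))" if "0 \<le> t" "t \<le> 1" for t v
      using Thi[OF that refl] .
    fix v :: "'i \<Rightarrow> complex" and t :: real assume t: "0 \<le> t" "t \<le> 1"
    define S where "S = (\<Sum>k\<in>I. v k)"
    define V where "V = mass v"
    have SV: "cmod S \<le> V" unfolding S_def V_def by (rule norm_sum)
    have V0: "V \<ge> 0" using SV norm_ge_zero order_trans by blast
    have V1: "1 + V \<ge> 1" using V0 by simp
    have st: "t * t \<le> t * sqrt t" "0 \<le> t * sqrt t"
      using t by (auto intro!: mult_left_mono simp: real_le_rsqrt power2_eq_square mult_left_le_one_le)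
    have "\<bar>(\<integral>z. reg_powr e \<epsilon> (S + increment t v z) \<partial>gauss 1) - (\<integral>z. reg_taylor e \<epsilon> S (increment t v z) \<partial>gauss 1)\<bar>
       = \<bar>\<integral>z. reg_powr e \<epsilon> (S + increment t v z) - reg_taylor e \<epsilon> S (increment t v z) \<partial>gauss 1\<bar>"
      by (subst Bochner_Integration.integral_diff) (auto intro: Thi[OF t S_def] reg_taylor_integral(1)[OF t])
    also have "\<dots> \<le> (\<integral>z. \<bar>reg_powr e \<epsilon> (S + increment t v z) - reg_taylor e \<epsilon> S (increment t v z)\<bar> \<partial>gauss 1)"
      by (rule integral_abs_bound)
    also have "\<dots> \<le> (\<integral>z. K * 2 ^ N * (t * sqrt t) * (1 + V) ^ (N + 3) * G z ^ (N + 3) \<partial>gauss 1)"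
      by (intro integral_mono integrable_abs remi[OF t S_def] integrable_mult_right Gint rem[OF t S_def V_def])
    also have "\<dots> = K * 2 ^ N * (t * sqrt t) * (1 + V) ^ (N + 3) * M" by (simp add: M_def)
    also have "\<dots> \<le> K * 2 ^ N * (t * sqrt t) * (1 + V) ^ NN * M"
      using K st M0 V1 by (intro mult_right_mono mult_left_mono power_increasing) (auto simp: NN_def)
    finally have A: "\<bar>(\<integral>z. reg_powr e \<epsilon> (S + increment t v z) \<partial>gauss 1) - (\<integral>z. reg_taylor e \<epsilon> S (increment t v z) \<partial>gauss 1)\<bar> \<le> K * 2 ^ N * (t * sqrt t) * (1 + V) ^ NN * M" .
    have one: "1 + (cmod S)\<^sup>2 \<le> (1 + V)\<^sup>2" 
    proof -
      have "(cmod S)\<^sup>2 \<le> V\<^sup>2" by (rule power_mono[OF SV norm_ge_zero])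
      moreover have "(1 + V)\<^sup>2 = 1 + 2 * V + V\<^sup>2" by (simp add: power2_sum)
      ultimately show ?thesis using V0 by linarith
    qed
    have p1: "\<bar>shift_powr1 e \<epsilon> ((cmod S)\<^sup>2)\<bar> * (5 * V\<^sup>2) \<le> c1 * 5 * (1 + V) ^ NN"
    proof -
      have "\<bar>shift_powr1 e \<epsilon> ((cmod S)\<^sup>2)\<bar> = \<bar>e\<bar> * ((cmod S)\<^sup>2 + \<epsilon>) powr (e - 1)" by (simp add: shift_powr1_def abs_mult)
      also have "\<dots> \<le> \<bar>e\<bar> * (K1 * ((1 + V)\<^sup>2) ^ N1)"
        using K1 one by (intro mult_left_mono order_trans[OF K1(2)] power_mono) auto
      finally have "\<bar>shift_powr1 e \<epsilon> ((cmod S)\<^sup>2)\<bar> \<le> c1 * (1 + V) ^ (2 * N1)" by (simp add: c1_def power_mult mult.assoc)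
      moreover have "V\<^sup>2 \<le> (1 + V)\<^sup>2" using V0 by (intro power_mono) auto
      ultimately have "\<bar>shift_powr1 e \<epsilon> ((cmod S)\<^sup>2)\<bar> * (5 * V\<^sup>2) \<le> c1 * (1 + V) ^ (2 * N1) * (5 * (1 + V)\<^sup>2)"
        using K1 V0 by (intro mult_mono) (auto simp: c1_def)
      also have "\<dots> = c1 * 5 * (1 + V) ^ (2 * N1 + 2)" by (simp add: power_add power2_eq_square)
      also have "\<dots> \<le> c1 * 5 * (1 + V) ^ NN"
        using V1 K1 by (intro mult_left_mono power_increasing) (auto simp: NN_def c1_def)
      finally show ?thesis .
    qed
    have p2: "\<bar>shift_powr2 e \<epsilon> ((cmod S)\<^sup>2)\<bar> * (6 * V ^ 4) \<le> c2 * 6 * (1 + V) ^ NN"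
    proof -
      have "\<bar>shift_powr2 e \<epsilon> ((cmod S)\<^sup>2)\<bar> = \<bar>e * (e - 1)\<bar> * ((cmod S)\<^sup>2 + \<epsilon>) powr (e - 2)" by (simp add: shift_powr2_def abs_mult)
      also have "\<dots> \<le> \<bar>e * (e - 1)\<bar> * (K2 * ((1 + V)\<^sup>2) ^ N2)"
        using K2 one by (intro mult_left_mono order_trans[OF K2(2)] power_mono) auto
      finally have "\<bar>shift_powr2 e \<epsilon> ((cmod S)\<^sup>2)\<bar> \<le> c2 * (1 + V) ^ (2 * N2)" by (simp add: c2_def power_mult mult.assoc)
      moreover have "V ^ 4 \<le> (1 + V) ^ 4" using V0 by (intro power_mono) auto
      ultimately have "\<bar>shift_powr2 e \<epsilon> ((cmod S)\<^sup>2)\<bar> * (6 * V ^ 4) \<le> c2 * (1 + V) ^ (2 * N2) * (6 * (1 + V) ^ 4)"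
        using K2 V0 by (intro mult_mono) (auto simp: c2_def)
      also have "\<dots> = c2 * 6 * (1 + V) ^ (2 * N2 + 4)" by (simp add: power_add)
      also have "\<dots> \<le> c2 * 6 * (1 + V) ^ NN"
        using V1 K2 by (intro mult_left_mono power_increasing) (auto simp: NN_def c2_def)
      finally show ?thesis .
    qed
    have "\<bar>(\<integral>z. reg_taylor e \<epsilon> S (increment t v z) \<partial>gauss 1) - (shift_powr e \<epsilon> ((cmod S)\<^sup>2) + t * generator e \<epsilon> v)\<bar>
      \<le> t\<^sup>2 * R * (\<bar>shift_powr1 e \<epsilon> ((cmod S)\<^sup>2)\<bar> * (5 * V\<^sup>2) + \<bar>shift_powr2 e \<epsilon> ((cmod S)\<^sup>2)\<bar> * (6 * V ^ 4))"
      by (rule reg_taylor_integral_bound[OF t S_def V_def])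
    also have "\<dots> \<le> (t * sqrt t) * R' * (c1 * 5 * (1 + V) ^ NN + c2 * 6 * (1 + V) ^ NN)"
    proof (rule mult_mono)
      have "t\<^sup>2 * R \<le> t\<^sup>2 * R'" by (intro mult_left_mono) (auto simp: R'_def)
      also have "\<dots> \<le> (t * sqrt t) * R'" using st by (intro mult_right_mono) (auto simp: R'_def power2_eq_square)
      finally show "t\<^sup>2 * R \<le> (t * sqrt t) * R'" .
      show "0 \<le> (t * sqrt t) * R'" using st by (simp add: R'_def)
    qed (intro add_mono p1 p2, use V0 in simp)
    finally have B: "\<bar>(\<integral>z. reg_taylor e \<epsilon> S (increment t v z) \<partial>gauss 1) - (shift_powr e \<epsilon> ((cmod S)\<^sup>2) + t * generator e \<epsilon> v)\<bar>
      \<le> (t * sqrt t) * R' * (c1 * 5 * (1 + V) ^ NN + c2 * 6 * (1 + V) ^ NN)" .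
    have "C * (t * sqrt t) * (1 + V) ^ NN = K * 2 ^ N * (t * sqrt t) * (1 + V) ^ NN * M + (t * sqrt t) * R' * (c1 * 5 * (1 + V) ^ NN + c2 * 6 * (1 + V) ^ NN)"
      by (simp add: C_def algebra_simps)
    then show "\<bar>(\<integral>z. reg_powr e \<epsilon> ((\<Sum>k\<in>I. v k) + increment t v z) \<partial>gauss 1) - (shift_powr e \<epsilon> ((cmod (\<Sum>k\<in>I. v k))\<^sup>2) + t * generator e \<epsilon> v)\<bar>
         \<le> C * (t * sqrt t) * (1 + mass v) ^ NN"
      unfolding S_def[symmetric] V_def[symmetric] using A B by linarith
  qed
qed

end

lemma exp_increment_exists:
  fixes a b :: "'i \<Rightarrow> complex^'n"
  assumes fin: "finite I"
  obtains R where "exp_increment I a b d R"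
proof -
  define f where "f k l = rem2 (d k + cdot (a k) (b k)) + rem2 (cnj (d k + cdot (a k) (b k)))
     + rem2 (d k + d l + cdot (a k + a l) (b k + b l)) + rem2 (d k + cnj (d l) + cdot (a k + vcnj (b l)) (b k + vcnj (a l)))" for k l
  define R where "R = (\<Sum>k\<in>I. \<Sum>l\<in>I. f k l)"
  have f0: "f k l \<ge> 0" for k l by (simp add: f_def rem2_nonneg)
  have fR: "f k l \<le> R" if "k \<in> I" "l \<in> I" for k l
  proof -
    have "f k l \<le> (\<Sum>l\<in>I. f k l)" using that fin f0 by (intro member_le_sum) auto
    also have "\<dots> \<le> R" unfolding R_def using that fin f0 by (intro member_le_sum sum_nonneg) auto
    finally show ?thesis .
  qed
  show ?thesis
  proof (rule that[of R], unfold_locales)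
    show "rem2 (d k + cdot (a k) (b k)) \<le> R" "rem2 (cnj (d k + cdot (a k) (b k))) \<le> R" if "k \<in> I" for k
      using fR[OF that that] rem2_nonneg unfolding f_def by (smt (verit))+
    show "rem2 (d k + d l + cdot (a k + a l) (b k + b l)) \<le> R" 
      "rem2 (d k + cnj (d l) + cdot (a k + vcnj (b l)) (b k + vcnj (a l))) \<le> R" if "k \<in> I" "l \<in> I" for k l
      using fR[OF that] rem2_nonneg unfolding f_def by (smt (verit))+
  qed (rule fin)
qed

section \<open>Contractivity of the dilated Bargmann projection\<close>

text \<open>This is the only place where the dilation factor \<open>r\<close> matters: below, \<open>\<rho>\<^sup>2 = 1 - r\<^sup>2\<close>, and the inequality is sharp as
  \<open>\<epsilon> \<rightarrow> 0\<close>.\<close>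

lemma generator_algebra:
  fixes e \<epsilon> m x y w P1 P2 :: real
  assumes e: "e > 0" and m: "m \<ge> 0" and eps: "\<epsilon> > 0" and P1: "P1 \<ge> 0" and P2: "P2 = P1 * (e - 1) / (m + \<epsilon>)"
    and xy: "x \<ge> 0" "y \<ge> 0" and w: "\<bar>w\<bar> \<le> m * (x * y)"
  defines "\<rho> \<equiv> \<bar>e - 1\<bar> / e"
  shows "0 \<le> P1 * (\<rho>\<^sup>2 * x\<^sup>2 + y\<^sup>2) + P2 * (m * (\<rho>\<^sup>2 * x\<^sup>2 + y\<^sup>2) + 2 * w)"
proof -
  define \<theta> where "\<theta> = m / (m + \<epsilon>)"
  have th: "0 \<le> \<theta>" "\<theta> \<le> 1" using m eps by (auto simp: \<theta>_def)
  define \<kappa> where "\<kappa> = (e - 1) * \<theta>"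
  have k1: "1 + \<kappa> > 0"
  proof (cases "e \<ge> 1")
    case True then show ?thesis using th by (simp add: \<kappa>_def add_pos_nonneg)
  next
    case False
    then have "(1 - e) * \<theta> \<le> (1 - e) * 1" using th by (intro mult_left_mono) auto
    then show ?thesis using e by (simp add: \<kappa>_def algebra_simps)
  qed
  \<comment> \<open>This is the sharp comparison: for \<open>\<theta> = 1\<close>, the limit
    \<open>\<epsilon> \<rightarrow> 0\<close> with \<open>m > 0\<close>, both sides equal
    \<open>|e - 1|\<close>. In general it reduces to
    \<open>e * \<theta> \<le> 1 + \<kappa>\<close>.\<close>
  have kr: "\<bar>\<kappa>\<bar> \<le> (1 + \<kappa>) * \<rho>"
  proof -
    have "e * \<theta> \<le> 1 + \<kappa>" using th by (simp add: \<kappa>_def algebra_simps)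
    then have "\<bar>e - 1\<bar> * (e * \<theta>) \<le> \<bar>e - 1\<bar> * (1 + \<kappa>)" by (intro mult_left_mono) auto
    moreover have "\<bar>\<kappa>\<bar> = \<bar>e - 1\<bar> * \<theta>" using th by (simp add: \<kappa>_def abs_mult)
    ultimately show ?thesis using e by (simp add: \<rho>_def pos_le_divide_eq mult_ac)
  qed
  have P2m: "P2 * m = P1 * \<kappa>" by (simp add: P2 \<kappa>_def \<theta>_def)
  have "- (P2 * w) \<le> \<bar>P2\<bar> * \<bar>w\<bar>" by (simp add: abs_mult[symmetric])
  also have "\<dots> \<le> \<bar>P2\<bar> * (m * (x * y))" using w by (intro mult_left_mono) auto
  also have "\<dots> = \<bar>P2 * m\<bar> * (x * y)" using m by (simp add: abs_mult)
  also have "\<dots> = P1 * (\<bar>\<kappa>\<bar> * (x * y))" using P1 by (simp add: P2m abs_mult)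
  also have "\<dots> \<le> P1 * ((1 + \<kappa>) * \<rho> * (x * y))" using P1 kr xy by (intro mult_left_mono mult_right_mono) auto
  finally have 1: "- (P2 * w) \<le> P1 * ((1 + \<kappa>) * (\<rho> * (x * y)))" by (simp add: mult.assoc)
  \<comment> \<open>The square supplies the arithmetic-geometric inequality between
    \<open>\<rho> * x\<close> and \<open>y\<close>, whose product bounds the mixed term
    \<open>P2 * w\<close> by the previous estimate.\<close>
  have "0 \<le> P1 * ((1 + \<kappa>) * (\<rho> * x - y)\<^sup>2)" using P1 k1 by simp
  also have "\<dots> = P1 * ((1 + \<kappa>) * (\<rho>\<^sup>2 * x\<^sup>2 + y\<^sup>2)) - 2 * (P1 * ((1 + \<kappa>) * (\<rho> * (x * y))))"
    by (simp add: power2_diff power_mult_distrib algebra_simps)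
  also have "\<dots> \<le> P1 * ((1 + \<kappa>) * (\<rho>\<^sup>2 * x\<^sup>2 + y\<^sup>2)) + 2 * (P2 * w)" using 1 by linarith
  also have "\<dots> = P1 * (\<rho>\<^sup>2 * x\<^sup>2 + y\<^sup>2) + (P1 * \<kappa>) * (\<rho>\<^sup>2 * x\<^sup>2 + y\<^sup>2) + 2 * (P2 * w)" by (simp add: algebra_simps)
  also have "\<dots> = P1 * (\<rho>\<^sup>2 * x\<^sup>2 + y\<^sup>2) + P2 * (m * (\<rho>\<^sup>2 * x\<^sup>2 + y\<^sup>2) + 2 * w)"
    unfolding P2m[symmetric] by (simp add: algebra_simps)
  finally show ?thesis .
qed

text \<open>\<open>D\<close> and \<open>F\<close> are the holomorphic and antiholomorphic gradients.
  The drift terms agree: on the left \<open>cdot (a k) (b k)\<close> is prescribed as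
  \<open>d\<close>, on the right it arises as the mean of the exponential. The projected side keeps
  only the gradient \<open>r *\<^sub>R D\<close>, so the difference is a quadratic form in
  \<open>D\<close> and \<open>F\<close>, to which \<open>generator_algebra\<close> applies.\<close>

lemma generator_le:
  fixes a b :: "'i \<Rightarrow> complex^'n"
  assumes p: "p > 1" and eps: "\<epsilon> > 0" and r: "r = 2 * sqrt (p - 1) / p"
    and A: "exp_increment I (\<lambda>k. r *\<^sub>R a k) (\<lambda>_. 0) (\<lambda>k. cdot (a k) (b k)) RA"
    and B: "exp_increment I a b (\<lambda>_. 0) RB"
  shows "exp_increment.generator I (\<lambda>k. r *\<^sub>R a k) (\<lambda>_. 0) (\<lambda>k. cdot (a k) (b k)) (p/2) \<epsilon> v
     \<le> exp_increment.generator I a b (\<lambda>_. 0) (p/2) \<epsilon> v"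
proof -
  define e where "e = p / 2"
  define S where "S = (\<Sum>k\<in>I. v k)"
  define D where "D = (\<Sum>k\<in>I. v k *s a k)"
  define F where "F = (\<Sum>k\<in>I. v k *s b k)"
  define m where "m = (cmod S)\<^sup>2"
  define L where "L = Re (cnj S * (\<Sum>k\<in>I. v k * cdot (a k) (b k)))"
  define w where "w = Re ((cnj S)\<^sup>2 * cdot D F)"
  define \<rho> where "\<rho> = \<bar>e - 1\<bar> / e"
  have e0: "e > 0" using p by (simp add: e_def)
  have rD: "(\<Sum>k\<in>I. v k *s (r *\<^sub>R a k)) = r *\<^sub>R D"
    by (simp add: D_def scaleR_sum_right vec_eq_iff)
  \<comment> \<open>Here \<open>\<rho> = |p - 2| / p\<close>, and
    \<open>p\<^sup>2 - (p - 2)\<^sup>2 = 4 * (p - 1)\<close>. This fixes the dilation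
    factor.\<close>
  have r2: "r\<^sup>2 = 1 - \<rho>\<^sup>2"
  proof -
    have "\<rho> = \<bar>p - 2\<bar> / p" using p by (simp add: \<rho>_def e_def field_simps)
    then have "\<rho>\<^sup>2 = (p - 2)\<^sup>2 / p\<^sup>2" by (simp add: power_divide)
    moreover have "r\<^sup>2 = 4 * (p - 1) / p\<^sup>2" using p by (simp add: r power_divide power_mult_distrib)
    moreover have "1 - (p - 2)\<^sup>2 / p\<^sup>2 = 4 * (p - 1) / p\<^sup>2" using p by (simp add: field_simps power2_eq_square)
    ultimately show ?thesis by simp
  qed
  have pos: "m + \<epsilon> > 0" using eps by (simp add: m_def add_nonneg_pos)
  have shift_powr2: "shift_powr2 e \<epsilon> m = shift_powr1 e \<epsilon> m * (e - 1) / (m + \<epsilon>)"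
    using pos powr_diff[of "m + \<epsilon>" "e - 1" 1] by (simp add: shift_powr1_def shift_powr2_def algebra_simps)
  have wb: "\<bar>w\<bar> \<le> m * (norm D * norm F)"
  proof -
    have "\<bar>w\<bar> \<le> cmod ((cnj S)\<^sup>2 * cdot D F)" unfolding w_def by (rule abs_Re_le_cmod)
    also have "\<dots> = m * cmod (cdot D F)" by (simp add: norm_mult norm_power m_def)
    also have "\<dots> \<le> m * (norm D * norm F)" by (intro mult_left_mono norm_cdot_le) (simp add: m_def)
    finally show ?thesis .
  qed
  have alg: "0 \<le> shift_powr1 e \<epsilon> m * (\<rho>\<^sup>2 * (norm D)\<^sup>2 + (norm F)\<^sup>2) + shift_powr2 e \<epsilon> m * (m * (\<rho>\<^sup>2 * (norm D)\<^sup>2 + (norm F)\<^sup>2) + 2 * w)"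
    unfolding \<rho>_def by (rule generator_algebra[OF e0 _ eps _ shift_powr2 _ _ wb]) (use e0 in \<open>auto simp: m_def shift_powr1_def\<close>)
  have genA: "exp_increment.generator I (\<lambda>k. r *\<^sub>R a k) (\<lambda>_. 0) (\<lambda>k. cdot (a k) (b k)) e \<epsilon> v
     = shift_powr1 e \<epsilon> m * (2 * L + r\<^sup>2 * (norm D)\<^sup>2) + shift_powr2 e \<epsilon> m * (m * (r\<^sup>2 * (norm D)\<^sup>2))"
  proof -
    have z: "(\<Sum>k\<in>I. v k *s (0 :: complex^'n)) = 0" by simp
    show ?thesis
      unfolding exp_increment.generator_def[OF A] Let_def rD z cdot_zero add_0_right S_def[symmetric] m_def[symmetric] L_def[symmetric]
      by (simp add: power_mult_distrib)
  qed
  have genB: "exp_increment.generator I a b (\<lambda>_. 0) e \<epsilon> v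
     = shift_powr1 e \<epsilon> m * (2 * L + (norm D)\<^sup>2 + (norm F)\<^sup>2) + shift_powr2 e \<epsilon> m * (m * ((norm D)\<^sup>2 + (norm F)\<^sup>2) + 2 * w)"
    unfolding exp_increment.generator_def[OF B] Let_def S_def[symmetric] D_def[symmetric] F_def[symmetric] w_def[symmetric] m_def[symmetric] add_0 L_def ..
  have "shift_powr1 e \<epsilon> m * (2 * L + (norm D)\<^sup>2 + (norm F)\<^sup>2) + shift_powr2 e \<epsilon> m * (m * ((norm D)\<^sup>2 + (norm F)\<^sup>2) + 2 * w)
     - (shift_powr1 e \<epsilon> m * (2 * L + r\<^sup>2 * (norm D)\<^sup>2) + shift_powr2 e \<epsilon> m * (m * (r\<^sup>2 * (norm D)\<^sup>2)))
     = shift_powr1 e \<epsilon> m * (\<rho>\<^sup>2 * (norm D)\<^sup>2 + (norm F)\<^sup>2) + shift_powr2 e \<epsilon> m * (m * (\<rho>\<^sup>2 * (norm D)\<^sup>2 + (norm F)\<^sup>2) + 2 * w)"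
    unfolding r2 by (simp add: algebra_simps)
  then show ?thesis using alg unfolding genA[unfolded e_def] genB[unfolded e_def] e_def by linarith
qed

section \<open>Moving variance between the projected and the original variable\<close>

lemma scaled_expf_expf: "scaled_expf t d x y z = exp (of_real t * d) * expf x y (sqrt t *\<^sub>R z)"
  by (simp add: scaled_expf_def expf_def cdot_scaleR_left cdot_scaleR_right vcnj_scaleR)

lemma expf_add: "expf x y (z + w) = expf x y z * expf x y w"
  by (simp add: expf_def cdot_add_right vcnj_add exp_add[symmetric] algebra_simps)

lemma vcnj_zero [simp]: "vcnj 0 = 0"
  by (simp add: vec_eq_iff)

lemma expf_zero [simp]: "expf x y 0 = 1"
  by (simp add: expf_def)

text \<open>Variances of independent Gaussians add. After division by \<open>sqrt (s + t)\<close>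
  the coefficients satisfy the hypothesis of \<open>gauss_convolution\<close>; the case of total
  variance 0 is separate.\<close>

lemma nn_gauss_conv:
  fixes F :: "complex^'n \<Rightarrow> ennreal"
  assumes [measurable]: "F \<in> borel_measurable borel" and st: "s \<ge> 0" "t \<ge> 0"
  shows "(\<integral>\<^sup>+x. \<integral>\<^sup>+y. F (sqrt s *\<^sub>R x + sqrt t *\<^sub>R y) \<partial>gauss 1 \<partial>gauss 1) = (\<integral>\<^sup>+z. F (sqrt (s + t) *\<^sub>R z) \<partial>gauss 1)"
proof (cases "s + t = 0")
  case True
  interpret prob_space "gauss 1 :: (complex^'n) measure" by (rule prob_space_gauss) simp
  have "s = 0" "t = 0" using True st by auto
  then show ?thesis using emeasure_space_1 by simp
next
  case False
  interpret G: prob_space "gauss 1 :: (complex^'n) measure" by (rule prob_space_gauss) simp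
  define q where "q = sqrt (s + t)"
  have q: "q > 0" "q\<^sup>2 = s + t" using False st by (auto simp: q_def)
  have cs: "(sqrt t / q)\<^sup>2 + (sqrt s / q)\<^sup>2 = 1"
    using False st by (simp add: power_divide q add_divide_distrib[symmetric])
  have "(\<integral>\<^sup>+z. F (q *\<^sub>R z) \<partial>gauss 1) = (\<integral>\<^sup>+z. F (q *\<^sub>R z) \<partial>distr (gauss 1 \<Otimes>\<^sub>M gauss 1) borel (\<lambda>z. (sqrt s / q) *\<^sub>R fst z + (sqrt t / q) *\<^sub>R snd z))"
    by (simp add: gauss_convolution[OF _ cs])
  also have "\<dots> = (\<integral>\<^sup>+z. F (sqrt s *\<^sub>R fst z + sqrt t *\<^sub>R snd z) \<partial>(gauss 1 \<Otimes>\<^sub>M gauss 1))"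
    using q by (subst nn_integral_distr) (auto simp: scaleR_add_right)
  also have "\<dots> = (\<integral>\<^sup>+x. \<integral>\<^sup>+y. F (sqrt s *\<^sub>R x + sqrt t *\<^sub>R y) \<partial>gauss 1 \<partial>gauss 1)"
    by (subst G.nn_integral_fst[symmetric]) auto
  finally show ?thesis by (simp add: q_def)
qed


lemma scaled_expf_norm_le:
  assumes "0 \<le> t" "t \<le> 1"
  shows "cmod (scaled_expf t d x y z) \<le> exp (cmod d + (norm x + norm y) * norm z)"
proof -
  have "Re (of_real t * d) \<le> cmod (of_real t * d)" by (rule complex_Re_le_cmod)
  also have "\<dots> \<le> cmod d" using assms by (simp add: norm_mult mult_left_le_one_le)
  finally have 1: "cmod (exp (of_real t * d)) \<le> exp (cmod d)" by simp
  have "cmod (expf x y (sqrt t *\<^sub>R z)) \<le> exp ((norm x + norm y) * norm (sqrt t *\<^sub>R z))" by (rule norm_expf_le)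
  also have "\<dots> \<le> exp ((norm x + norm y) * norm z)"
  proof -
    have "norm (sqrt t *\<^sub>R z) \<le> norm z" using assms by (simp add: mult_left_le_one_le)
    then show ?thesis by (simp add: mult_left_mono)
  qed
  finally have 2: "cmod (expf x y (sqrt t *\<^sub>R z)) \<le> exp ((norm x + norm y) * norm z)" .
  show ?thesis unfolding scaled_expf_expf norm_mult exp_add by (intro mult_mono 1 2) auto
qed

locale mixed_flow =
  fixes I :: "'i set" and a b :: "'i \<Rightarrow> complex^'n" and c :: "'i \<Rightarrow> complex" and p r \<epsilon> :: real
  assumes fin: "finite I" and p: "p > 1" and r: "r = 2 * sqrt (p - 1) / p" and eps: "\<epsilon> > 0"
begin

abbreviation \<Theta> :: "complex \<Rightarrow> real" where
  "\<Theta> \<equiv> reg_powr (p/2) \<epsilon>"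

abbreviation mass :: "('i \<Rightarrow> complex) \<Rightarrow> real" where
  "mass v \<equiv> \<Sum>k\<in>I. cmod (v k)"

abbreviation holo_step :: "real \<Rightarrow> ('i \<Rightarrow> complex) \<Rightarrow> complex^'n \<Rightarrow> complex" where
  "holo_step t v z \<equiv> \<Sum>k\<in>I. v k * scaled_expf t (cdot (a k) (b k)) (r *\<^sub>R a k) 0 z"

abbreviation mixed_step :: "real \<Rightarrow> ('i \<Rightarrow> complex) \<Rightarrow> complex^'n \<Rightarrow> complex" where
  "mixed_step t v z \<equiv> \<Sum>k\<in>I. v k * scaled_expf t 0 (a k) (b k) z"

definition "flow_term s s' x w k = c k * scaled_expf s (cdot (a k) (b k)) (r *\<^sub>R a k) 0 x * scaled_expf s' 0 (a k) (b k) w"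

text \<open>The Bargmann projection, dilated by \<open>r\<close>, has been applied to the portion \<open>s\<close> of the variance of the Gaussian variable and not to the
  remaining portion \<open>s'\<close>.\<close>

definition "flow s s' = (\<integral>\<^sup>+x. \<integral>\<^sup>+w. ennreal (\<Theta> (\<Sum>k\<in>I. flow_term s s' x w k)) \<partial>gauss 1 \<partial>gauss 1)"

lemma meas_reg_powr_sum:
  "(\<lambda>z. ennreal (\<Theta> (\<Sum>k\<in>I. f k z))) \<in> borel_measurable M" 
  if "\<And>k. k \<in> I \<Longrightarrow> f k \<in> borel_measurable M"
proof -
  have "(\<lambda>z. \<Sum>k\<in>I. f k z) \<in> borel_measurable M" using that by (intro borel_measurable_sum) auto
  from measurable_compose[OF this reg_powr_measurable[OF eps]] show ?thesis by simp
qed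

text \<open>At \<open>t = 0\<close> both means equal the regularised power of the sum of
  \<open>v\<close>, and \<open>generator_le\<close> orders their derivatives there. Everything else
  goes into the error of the two expansions.\<close>

lemma flow_local:
  obtains C N where "C \<ge> 0" "\<And>v t. 0 \<le> t \<Longrightarrow> t \<le> 1 \<Longrightarrow>
     (\<integral>\<^sup>+z. ennreal (\<Theta> (holo_step t v z)) \<partial>gauss 1)
       \<le> (\<integral>\<^sup>+z. ennreal (\<Theta> (mixed_step t v z)) \<partial>gauss 1)
        + ennreal (C * (t * sqrt t) * (1 + mass v) ^ N)"
proof -
  obtain RA where A: "exp_increment I (\<lambda>k. r *\<^sub>R a k) (\<lambda>_. 0) (\<lambda>k. cdot (a k) (b k)) RA"
    using exp_increment_exists[OF fin] by blast
  obtain RB where B: "exp_increment I a b (\<lambda>_. 0) RB"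
    using exp_increment_exists[OF fin] by blast
  interpret A: exp_increment I "\<lambda>k. r *\<^sub>R a k" "\<lambda>_. 0" "\<lambda>k. cdot (a k) (b k)" RA by (rule A)
  interpret B: exp_increment I a b "\<lambda>_. 0" RB by (rule B)
  obtain CA NA where CA: "CA \<ge> 0" and iA: "\<And>v t. 0 \<le> t \<Longrightarrow> t \<le> 1 \<Longrightarrow> integrable (gauss 1) (\<lambda>z. \<Theta> ((\<Sum>k\<in>I. v k) + A.increment t v z))"
    and eA: "\<And>v t. 0 \<le> t \<Longrightarrow> t \<le> 1 \<Longrightarrow>
       \<bar>(\<integral>z. \<Theta> ((\<Sum>k\<in>I. v k) + A.increment t v z) \<partial>gauss 1) - (shift_powr (p/2) \<epsilon> ((cmod (\<Sum>k\<in>I. v k))\<^sup>2) + t * A.generator (p/2) \<epsilon> v)\<bar>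
         \<le> CA * (t * sqrt t) * (1 + mass v) ^ NA"
    using A.expansion[OF eps, of "p/2"] by blast
  obtain CB NB where CB: "CB \<ge> 0" and iB: "\<And>v t. 0 \<le> t \<Longrightarrow> t \<le> 1 \<Longrightarrow> integrable (gauss 1) (\<lambda>z. \<Theta> ((\<Sum>k\<in>I. v k) + B.increment t v z))"
    and eB: "\<And>v t. 0 \<le> t \<Longrightarrow> t \<le> 1 \<Longrightarrow>
       \<bar>(\<integral>z. \<Theta> ((\<Sum>k\<in>I. v k) + B.increment t v z) \<partial>gauss 1) - (shift_powr (p/2) \<epsilon> ((cmod (\<Sum>k\<in>I. v k))\<^sup>2) + t * B.generator (p/2) \<epsilon> v)\<bar>
         \<le> CB * (t * sqrt t) * (1 + mass v) ^ NB"
    using B.expansion[OF eps, of "p/2"] by blast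
  show ?thesis
  proof (rule that[of "CA + CB" "NA + NB"])
    show "CA + CB \<ge> 0" using CA CB by simp
    fix v :: "'i \<Rightarrow> complex" and t :: real assume t: "0 \<le> t" "t \<le> 1"
    have YA: "(\<Sum>k\<in>I. v k) + A.increment t v z = (holo_step t v z)" for z
      unfolding A.increment_def sum.distrib[symmetric] by (simp add: algebra_simps)
    have YB: "(\<Sum>k\<in>I. v k) + B.increment t v z = (mixed_step t v z)" for z
      unfolding B.increment_def sum.distrib[symmetric] by (simp add: algebra_simps)
    define W where "W = 1 + mass v"
    have W: "W \<ge> 1" by (simp add: W_def sum_nonneg)
    have st: "t * sqrt t \<ge> 0" using t by simp
    have generator: "t * A.generator (p/2) \<epsilon> v \<le> t * B.generator (p/2) \<epsilon> v"
      by (intro mult_left_mono generator_le[OF p eps r A B] t)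
    have wA: "CA * (t * sqrt t) * W ^ NA \<le> CA * (t * sqrt t) * W ^ (NA + NB)"
      and wB: "CB * (t * sqrt t) * W ^ NB \<le> CB * (t * sqrt t) * W ^ (NA + NB)"
      using CA CB st W by (auto intro!: mult_left_mono power_increasing)
    have "(\<integral>z. \<Theta> (holo_step t v z) \<partial>gauss 1)
       \<le> (\<integral>z. \<Theta> (mixed_step t v z) \<partial>gauss 1) + (CA + CB) * (t * sqrt t) * W ^ (NA + NB)"
      using eA[OF t, of v] eB[OF t, of v] generator wA wB unfolding YA YB W_def[symmetric] distrib_right by linarith
    then have "ennreal (\<integral>z. \<Theta> (holo_step t v z) \<partial>gauss 1)
       \<le> ennreal ((\<integral>z. \<Theta> (mixed_step t v z) \<partial>gauss 1) + (CA + CB) * (t * sqrt t) * W ^ (NA + NB))"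
      by (rule ennreal_leI)
    also have "\<dots> = ennreal (\<integral>z. \<Theta> (mixed_step t v z) \<partial>gauss 1) + ennreal ((CA + CB) * (t * sqrt t) * W ^ (NA + NB))"
      using CA CB st W by (intro ennreal_plus) (auto simp: reg_powr_nonneg)
    finally show "(\<integral>\<^sup>+z. ennreal (\<Theta> (holo_step t v z)) \<partial>gauss 1)
       \<le> (\<integral>\<^sup>+z. ennreal (\<Theta> (mixed_step t v z)) \<partial>gauss 1)
        + ennreal ((CA + CB) * (t * sqrt t) * (1 + mass v) ^ (NA + NB))"
      using nn_integral_eq_integral[OF iA[OF t, of v]] nn_integral_eq_integral[OF iB[OF t, of v]]
      unfolding YA YB W_def by (simp add: reg_powr_nonneg)
  qed
qed

lemma flow_term_measurable [measurable]: "(\<lambda>z. flow_term s s' (fst z) (snd z) k) \<in> borel_measurable (gauss 1 \<Otimes>\<^sub>M gauss 1)"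
  "(\<lambda>w. flow_term s s' x w k) \<in> borel_measurable borel" "(\<lambda>x. flow_term s s' x w k) \<in> borel_measurable borel"
  unfolding flow_term_def by measurable

text \<open>Split an independent variable \<open>y\<close> of variance \<open>t\<close> off the
  projected variable. For fixed \<open>x\<close> and \<open>w\<close> the summands form a constant
  vector, so the local comparison makes \<open>y\<close> an unprojected variable, and convolution
  merges it with \<open>w\<close>. The constant \<open>K\<close> is independent of the position
  along the flow, so that the errors can be summed.\<close>

lemma flow_step:
  obtains K where "K \<ge> 0" "\<And>s s' t. 0 \<le> s \<Longrightarrow> s \<le> 1 \<Longrightarrow> 0 \<le> s' \<Longrightarrow> s' \<le> 1 \<Longrightarrow> 0 \<le> t \<Longrightarrow> t \<le> 1 \<Longrightarrow> 
     flow (s + t) s' \<le> flow s (s' + t) + ennreal (K * (t * sqrt t))"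
proof -
  interpret G: prob_space "gauss 1 :: (complex^'n) measure" by (rule prob_space_gauss) simp
  interpret GG: pair_sigma_finite "gauss 1 :: (complex^'n) measure" "gauss 1 :: (complex^'n) measure" ..
  obtain C N where C: "C \<ge> 0" and CN: "\<And>v t. 0 \<le> t \<Longrightarrow> t \<le> 1 \<Longrightarrow>
     (\<integral>\<^sup>+z. ennreal (\<Theta> (holo_step t v z)) \<partial>gauss 1)
       \<le> (\<integral>\<^sup>+z. ennreal (\<Theta> (mixed_step t v z)) \<partial>gauss 1)
        + ennreal (C * (t * sqrt t) * (1 + mass v) ^ N)"
    using flow_local by blast
  define B where "B = (\<Sum>k\<in>I. cmod (cdot (a k) (b k)) + norm (r *\<^sub>R a k) + norm (a k) + norm (b k))"
  have B: "cmod (cdot (a k) (b k)) + norm (r *\<^sub>R a k) + norm (a k) + norm (b k) \<le> B" if "k \<in> I" for k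
    unfolding B_def using that fin by (intro member_le_sum) auto
  have B0: "B \<ge> 0" unfolding B_def by (intro sum_nonneg) auto
  define Vc where "Vc = (\<Sum>k\<in>I. cmod (c k))"
  have Vc0: "Vc \<ge> 0" unfolding Vc_def by (intro sum_nonneg) auto
  define E where "E = (\<lambda>z::complex^'n. exp (real N * B * norm z))"
  define J where "J = (\<integral>z. E z \<partial>gauss 1)"
  have J: "(\<integral>\<^sup>+z. ennreal (E z) \<partial>gauss 1) = ennreal J" "J \<ge> 0"
    unfolding J_def using integrable_exp_norm_gauss[of 1 "real N * B"]
    by (auto simp: E_def intro!: nn_integral_eq_integral integral_nonneg_AE)
  define Q where "Q = ((1 + Vc) * exp B) ^ N"
  \<comment> \<open>One factor \<open>J\<close> for each of the two Gaussian variables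
    \<open>x\<close> and \<open>w\<close> over which the polynomial in the mass is
    integrated.\<close>
  define K where "K = C * Q * J * J"
  have V: "(1 + mass (flow_term s s' x w)) ^ N \<le> Q * E x * E w" if s: "0 \<le> s" "s \<le> 1" "0 \<le> s'" "s' \<le> 1" for s s' x w
  proof -
    have "cmod (flow_term s s' x w k) \<le> cmod (c k) * (exp B * exp (B * norm x) * exp (B * norm w))" if k: "k \<in> I" for k
    proof -
      have "cmod (flow_term s s' x w k) \<le> cmod (c k) * (exp (cmod (cdot (a k) (b k)) + (norm (r *\<^sub>R a k) + norm (0::complex^'n)) * norm x)) * exp (cmod 0 + (norm (a k) + norm (b k)) * norm w)"
        unfolding flow_term_def norm_mult by (intro mult_mono scaled_expf_norm_le s order_refl norm_ge_zero mult_nonneg_nonneg exp_ge_zero)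
      also have "\<dots> \<le> cmod (c k) * exp (B + B * norm x) * exp (0 + B * norm w)"
      proof -
        have h: "cmod (cdot (a k) (b k)) \<le> B" "norm (r *\<^sub>R a k) + norm (0::complex^'n) \<le> B" "norm (a k) + norm (b k) \<le> B"
          using B[OF k] norm_ge_zero[of "a k"] norm_ge_zero[of "b k"] norm_ge_zero[of "r *\<^sub>R a k"] norm_ge_zero[of "cdot (a k) (b k)"]
            norm_zero[where 'a = "complex^'n"]
          by linarith+
        have "cmod (cdot (a k) (b k)) + (norm (r *\<^sub>R a k) + norm (0::complex^'n)) * norm x \<le> B + B * norm x"
          by (intro add_mono mult_right_mono h norm_ge_zero)
        moreover have "cmod 0 + (norm (a k) + norm (b k)) * norm w \<le> 0 + B * norm w"
          by (intro add_mono mult_right_mono h norm_ge_zero) simp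
        ultimately show ?thesis by (intro mult_mono mult_left_mono) auto
      qed
      finally show ?thesis by (simp add: exp_add mult.assoc)
    qed
    then have "mass (flow_term s s' x w) \<le> (\<Sum>k\<in>I. cmod (c k) * (exp B * exp (B * norm x) * exp (B * norm w)))"
      by (intro sum_mono) auto
    also have "\<dots> = Vc * (exp B * exp (B * norm x) * exp (B * norm w))" by (simp add: Vc_def sum_distrib_right)
    finally have "1 + mass (flow_term s s' x w) \<le> 1 * (exp B * exp (B * norm x) * exp (B * norm w)) + Vc * (exp B * exp (B * norm x) * exp (B * norm w))"
      using B0 by (intro add_mono) (auto simp: exp_add[symmetric])
    also have "\<dots> = (1 + Vc) * exp B * exp (B * norm x) * exp (B * norm w)" by (simp add: algebra_simps)
    finally have "(1 + mass (flow_term s s' x w)) ^ N \<le> ((1 + Vc) * exp B * exp (B * norm x) * exp (B * norm w)) ^ N"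
      by (intro power_mono) (auto intro!: add_nonneg_nonneg sum_nonneg)
    also have "\<dots> = Q * E x * E w"
      by (simp add: Q_def E_def power_mult_distrib exp_of_nat_mult[symmetric] mult.assoc)
    finally show ?thesis .
  qed
  show ?thesis
  proof (rule that[of K])
    show "K \<ge> 0" using C J Vc0 by (simp add: K_def Q_def)
    fix s s' t :: real assume s: "0 \<le> s" "s \<le> 1" "0 \<le> s'" "s' \<le> 1" and t: "0 \<le> t" "t \<le> 1"
    define H where "H w x = (\<integral>\<^sup>+y. ennreal (\<Theta> (mixed_step t (flow_term s s' x w) y)) \<partial>gauss 1)" for w x
    have Hm: "(\<lambda>(w, x). H w x) \<in> borel_measurable (gauss 1 \<Otimes>\<^sub>M gauss 1)"
      unfolding H_def split_def
      by (intro G.borel_measurable_nn_integral) (auto simp: split_def flow_term_def intro!: meas_reg_powr_sum)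
    \<comment> \<open>The integral over \<open>x\<close> is moved inside, since the variance
      \<open>s + t\<close> of \<open>x\<close> is to be split for each fixed
      \<open>w\<close>.\<close>
    have "flow (s + t) s' = (\<integral>\<^sup>+w. \<integral>\<^sup>+x. ennreal (\<Theta> (\<Sum>k\<in>I. flow_term (s + t) s' x w k)) \<partial>gauss 1 \<partial>gauss 1)"
      unfolding flow_def by (subst GG.Fubini'[symmetric]) (auto intro!: meas_reg_powr_sum simp: split_def)
    also have "\<dots> = (\<integral>\<^sup>+w. \<integral>\<^sup>+x. \<integral>\<^sup>+y. ennreal (\<Theta> (holo_step t (flow_term s s' x w) y)) \<partial>gauss 1 \<partial>gauss 1 \<partial>gauss 1)"
    proof (rule nn_integral_cong)
      fix w :: "complex^'n"
      define F where "F = (\<lambda>X. ennreal (\<Theta> (\<Sum>k\<in>I. c k * (exp (of_real (s + t) * cdot (a k) (b k)) * expf (r *\<^sub>R a k) 0 X) * scaled_expf s' 0 (a k) (b k) w)))"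
      have F: "F \<in> borel_measurable borel" unfolding F_def by (intro meas_reg_powr_sum) measurable
      have "F (sqrt (s + t) *\<^sub>R x) = ennreal (\<Theta> (\<Sum>k\<in>I. flow_term (s + t) s' x w k))" for x
        by (simp add: F_def flow_term_def scaled_expf_expf)
      moreover have "F (sqrt s *\<^sub>R x + sqrt t *\<^sub>R y) = ennreal (\<Theta> (holo_step t (flow_term s s' x w) y))" for x y
      proof -
        have e: "exp (of_real (s + t) * d) = exp (of_real s * d) * exp (of_real t * d)" for d :: complex
          by (simp add: distrib_right exp_add)
        show ?thesis unfolding F_def flow_term_def scaled_expf_expf expf_add e by (simp add: mult_ac)
      qed
      ultimately show "(\<integral>\<^sup>+x. ennreal (\<Theta> (\<Sum>k\<in>I. flow_term (s + t) s' x w k)) \<partial>gauss 1)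
         = (\<integral>\<^sup>+x. \<integral>\<^sup>+y. ennreal (\<Theta> (holo_step t (flow_term s s' x w) y)) \<partial>gauss 1 \<partial>gauss 1)"
        using nn_gauss_conv[OF F s(1) t(1)] by simp
    qed
    \<comment> \<open>The summands \<open>flow_term s s' x w\<close> now play the role of
      \<open>v\<close>; their mass grows at most exponentially in \<open>x\<close> and
      \<open>w\<close>, which the functions \<open>E\<close> record.\<close>
    also have "\<dots> \<le> (\<integral>\<^sup>+w. \<integral>\<^sup>+x. ((\<integral>\<^sup>+y. ennreal (\<Theta> (mixed_step t (flow_term s s' x w) y)) \<partial>gauss 1)
         + ennreal (C * (t * sqrt t) * Q) * ennreal (E x) * ennreal (E w)) \<partial>gauss 1 \<partial>gauss 1)"
    proof (intro nn_integral_mono order_trans[OF CN[OF t]] add_left_mono)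
      fix w x :: "complex^'n"
      have "C * (t * sqrt t) * (1 + mass (flow_term s s' x w)) ^ N \<le> C * (t * sqrt t) * (Q * E x * E w)"
        using C t by (intro mult_left_mono V s) auto
      then show "ennreal (C * (t * sqrt t) * (1 + mass (flow_term s s' x w)) ^ N) \<le> ennreal (C * (t * sqrt t) * Q) * ennreal (E x) * ennreal (E w)"
        using C t Vc0 by (simp add: ennreal_mult'[symmetric] E_def mult.assoc Q_def ennreal_leI)
    qed
    also have "\<dots> = (\<integral>\<^sup>+w. \<integral>\<^sup>+x. H w x \<partial>gauss 1 \<partial>gauss 1)
        + (\<integral>\<^sup>+w. \<integral>\<^sup>+x. ennreal (C * (t * sqrt t) * Q) * ennreal (E x) * ennreal (E w) \<partial>gauss 1 \<partial>gauss 1)"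
    proof -
      have [measurable]: "(\<lambda>x. H w x) \<in> borel_measurable (gauss 1)" for w
        using measurable_compose_Pair1[of w "gauss 1", OF _ Hm] by simp
      have [measurable]: "(\<lambda>w. \<integral>\<^sup>+x. H w x \<partial>gauss 1) \<in> borel_measurable (gauss 1)"
        by (rule G.borel_measurable_nn_integral[OF Hm])
      have [measurable]: "E \<in> borel_measurable borel" unfolding E_def by measurable
      show ?thesis unfolding H_def[symmetric]
        by (subst nn_integral_add[symmetric]) (auto intro!: nn_integral_cong nn_integral_add)
    qed
    also have "(\<integral>\<^sup>+w. \<integral>\<^sup>+x. ennreal (C * (t * sqrt t) * Q) * ennreal (E x) * ennreal (E w) \<partial>gauss 1 \<partial>gauss 1) = ennreal (K * (t * sqrt t))"
    proof -
      have [measurable]: "E \<in> borel_measurable borel" unfolding E_def by measurable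
      have "(\<integral>\<^sup>+w. \<integral>\<^sup>+x. ennreal (C * (t * sqrt t) * Q) * ennreal (E x) * ennreal (E w) \<partial>gauss 1 \<partial>gauss 1) = ennreal (C * (t * sqrt t) * Q) * ennreal J * ennreal J"
        by (simp add: nn_integral_multc nn_integral_cmult J)
      also have "\<dots> = ennreal (K * (t * sqrt t))"
        using C t Vc0 J by (simp add: ennreal_mult'[symmetric] K_def Q_def mult_ac)
      finally show ?thesis .
    qed
    \<comment> \<open>The order is reversed again so that \<open>w\<close>, now innermost, can
      absorb \<open>y\<close>.\<close>
    also have "(\<integral>\<^sup>+w. \<integral>\<^sup>+x. H w x \<partial>gauss 1 \<partial>gauss 1) = (\<integral>\<^sup>+x. \<integral>\<^sup>+w. H w x \<partial>gauss 1 \<partial>gauss 1)"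
      by (rule GG.Fubini'[OF Hm, symmetric])
    also have "\<dots> = flow s (s' + t)"
      unfolding flow_def
    proof (rule nn_integral_cong)
      fix x :: "complex^'n"
      define F where "F = (\<lambda>X. ennreal (\<Theta> (\<Sum>k\<in>I. c k * scaled_expf s (cdot (a k) (b k)) (r *\<^sub>R a k) 0 x * expf (a k) (b k) X)))"
      have F: "F \<in> borel_measurable borel" unfolding F_def by (intro meas_reg_powr_sum) measurable
      have "F (sqrt (s' + t) *\<^sub>R w) = ennreal (\<Theta> (\<Sum>k\<in>I. flow_term s (s' + t) x w k))" for w
        by (simp add: F_def flow_term_def scaled_expf_expf[of _ 0])
      moreover have "F (sqrt s' *\<^sub>R w + sqrt t *\<^sub>R y) = ennreal (\<Theta> (mixed_step t (flow_term s s' x w) y))" for w y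
        by (simp add: F_def flow_term_def scaled_expf_expf[of _ 0] expf_add mult_ac)
      ultimately show "(\<integral>\<^sup>+w. H w x \<partial>gauss 1) = (\<integral>\<^sup>+w. ennreal (\<Theta> (\<Sum>k\<in>I. flow_term s (s' + t) x w k)) \<partial>gauss 1)"
        using nn_gauss_conv[OF F s(3) t(1)] by (simp add: H_def)
    qed
    finally show "flow (s + t) s' \<le> flow s (s' + t) + ennreal (K * (t * sqrt t))" .
  qed
qed

text \<open>The total error of \<open>N\<close> steps of size \<open>1 / N\<close> is
  \<open>N * K * (1 / N) * sqrt (1 / N) = K * sqrt (1 / N)\<close>, which tends to 0. An error of
  order \<open>t\<close> per step would not disappear.\<close>

lemma flow_le: "flow 1 0 \<le> flow 0 1"
proof -
  obtain K where K: "K \<ge> 0" and step: "\<And>s s' t. 0 \<le> s \<Longrightarrow> s \<le> 1 \<Longrightarrow> 0 \<le> s' \<Longrightarrow> s' \<le> 1 \<Longrightarrow> 0 \<le> t \<Longrightarrow> t \<le> 1 \<Longrightarrow> 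
     flow (s + t) s' \<le> flow s (s' + t) + ennreal (K * (t * sqrt t))"
    using flow_step by blast
  have main: "flow 1 0 \<le> flow 0 1 + ennreal (K * sqrt (1 / real N))" if N: "N > 0" for N :: nat
  proof -
    define \<delta> where "\<delta> = 1 / real N"
    have d: "0 \<le> \<delta>" "\<delta> \<le> 1" using N by (auto simp: \<delta>_def)
    \<comment> \<open>In the state with index \<open>j\<close>, exactly \<open>j\<close> of the
      \<open>N\<close> portions of variance are projected; the induction releases them one at a
      time.\<close>
    have "flow (real j * \<delta>) (real (N - j) * \<delta>) \<le> flow 0 1 + ennreal (real j * (K * (\<delta> * sqrt \<delta>)))" if "j \<le> N" for j
      using that
    proof (induction j)
      case 0
      then show ?case using N by (simp add: \<delta>_def)
    next
      case (Suc j)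
      have b: "real i * \<delta> \<le> 1" if "i \<le> N" for i using that N by (simp add: \<delta>_def)
      have "flow (real (Suc j) * \<delta>) (real (N - Suc j) * \<delta>) = flow (real j * \<delta> + \<delta>) (real (N - Suc j) * \<delta>)"
        by (simp add: algebra_simps)
      also have "\<dots> \<le> flow (real j * \<delta>) (real (N - Suc j) * \<delta> + \<delta>) + ennreal (K * (\<delta> * sqrt \<delta>))"
        proof (rule step)
        show "real j * \<delta> \<le> 1" using b[of j] Suc.prems by linarith
        show "real (N - Suc j) * \<delta> \<le> 1" by (rule b) simp
      qed (use d in simp_all)
      also have "real (N - Suc j) * \<delta> + \<delta> = real (N - j) * \<delta>"
      proof -
        have "real (N - j) = real (N - Suc j) + 1" using Suc.prems by (simp add: of_nat_diff)
        then show ?thesis by (simp add: algebra_simps)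
      qed
      also have "flow (real j * \<delta>) (real (N - j) * \<delta>) + ennreal (K * (\<delta> * sqrt \<delta>)) \<le> flow 0 1 + ennreal (real j * (K * (\<delta> * sqrt \<delta>))) + ennreal (K * (\<delta> * sqrt \<delta>))"
        using Suc by (intro add_right_mono) auto
      also have "\<dots> = flow 0 1 + ennreal (real (Suc j) * (K * (\<delta> * sqrt \<delta>)))"
      proof -
        define X where "X = K * (\<delta> * sqrt \<delta>)"
        have X: "X \<ge> 0" using K d by (simp add: X_def)
        have "ennreal (real j * X) + ennreal X = ennreal (real j * X + X)"
          using X by (intro ennreal_plus[symmetric]) auto
        also have "real j * X + X = real (Suc j) * X" by (simp add: distrib_right)
        finally show ?thesis unfolding X_def[symmetric] add.assoc by (rule arg_cong)
      qed
      finally show ?case .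
    qed
    from this[of N] have "flow 1 0 \<le> flow 0 1 + ennreal (real N * (K * (\<delta> * sqrt \<delta>)))" using N by (simp add: \<delta>_def)
    also have "real N * (K * (\<delta> * sqrt \<delta>)) = K * sqrt (1 / real N)" using N by (simp add: \<delta>_def)
    finally show ?thesis .
  qed
  show ?thesis
  proof (rule ennreal_le_epsilon)
    fix e :: real assume e: "e > 0"
    have "(\<lambda>N. K * sqrt (1 / real N)) \<longlonglongrightarrow> K * sqrt 0"
      by (intro tendsto_intros lim_1_over_n)
    then have "eventually (\<lambda>N. K * sqrt (1 / real N) < e) sequentially"
      using e by (intro order_tendstoD(2)) auto
    then have "eventually (\<lambda>N. K * sqrt (1 / real N) < e \<and> N > 0) sequentially"
      using eventually_gt_at_top[of 0] by eventually_elim auto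
    then obtain N where N: "K * sqrt (1 / real N) < e" "N > 0"
      using eventually_happens'[OF sequentially_bot] by blast
    have "flow 1 0 \<le> flow 0 1 + ennreal (K * sqrt (1 / real N))" by (rule main[OF N(2)])
    also have "\<dots> \<le> flow 0 1 + ennreal e" using N(1) by (intro add_left_mono ennreal_leI) auto
    finally show "flow 1 0 \<le> flow 0 1 + ennreal e" .
  qed
qed

lemma reg_powr_contraction:
  "(\<integral>\<^sup>+z. ennreal (\<Theta> (\<Sum>k\<in>I. c k * exp (cdot (a k) (b k)) * expf (r *\<^sub>R a k) 0 z)) \<partial>gauss 1)
     \<le> (\<integral>\<^sup>+z. ennreal (\<Theta> (\<Sum>k\<in>I. c k * expf (a k) (b k) z)) \<partial>gauss 1)"
proof -
  interpret G: prob_space "gauss 1 :: (complex^'n) measure" by (rule prob_space_gauss) simp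
  have "flow 1 0 = (\<integral>\<^sup>+z. ennreal (\<Theta> (\<Sum>k\<in>I. c k * exp (cdot (a k) (b k)) * expf (r *\<^sub>R a k) 0 z)) \<partial>gauss 1)"
    using G.emeasure_space_1 by (simp add: flow_def flow_term_def scaled_expf_expf mult.assoc)
  moreover have "flow 0 1 = (\<integral>\<^sup>+z. ennreal (\<Theta> (\<Sum>k\<in>I. c k * expf (a k) (b k) z)) \<partial>gauss 1)"
    using G.emeasure_space_1 by (simp add: flow_def flow_term_def scaled_expf_expf)
  ultimately show ?thesis using flow_le by simp
qed

end

section \<open>Removing the regularisation\<close>

lemma integrable_reg_powr_expf:
  fixes a b :: "'i \<Rightarrow> complex^'n"
  assumes "finite I" "\<epsilon> > 0"
  shows "integrable (gauss 1) (\<lambda>z. reg_powr e \<epsilon> (\<Sum>k\<in>I. c k * expf (a k) (b k) z))"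
proof -
  obtain R where R: "exp_increment I a b (\<lambda>_. 0) R"
    using exp_increment_exists[OF assms(1)] by blast
  interpret exp_increment I a b "\<lambda>_. 0" R by (rule R)
  have "(\<Sum>k\<in>I. c k) + increment 1 c z = (\<Sum>k\<in>I. c k * expf (a k) (b k) z)" for z
    unfolding increment_def sum.distrib[symmetric] by (simp add: algebra_simps scaled_expf_expf)
  moreover have "integrable (gauss 1) (\<lambda>z. reg_powr e \<epsilon> ((\<Sum>k\<in>I. c k) + increment 1 c z))"
    using expansion[OF assms(2), of e] by (metis order_refl zero_le_one)
  ultimately show ?thesis by simp
qed

lemma powr_le_reg_powr: 
  assumes "p > 0" "\<epsilon> > 0"
  shows "cmod y powr p \<le> reg_powr (p/2) \<epsilon> y"
proof -
  have "cmod y powr p = ((cmod y)\<^sup>2) powr (p/2)"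
    by (cases "y = 0") (simp_all add: powr_powr flip: powr_numeral)
  also have "\<dots> \<le> reg_powr (p/2) \<epsilon> y"
    unfolding reg_powr_def shift_powr_def using assms by (intro powr_mono2) auto
  finally show ?thesis .
qed

lemma reg_powr_tendsto:
  assumes "p > 0"
  shows "(\<lambda>n. reg_powr (p/2) (1 / real (Suc n)) y) \<longlonglongrightarrow> cmod y powr p"
proof -
  have "(\<lambda>n. ((cmod y)\<^sup>2 + 1 / real (Suc n)) powr (p/2)) \<longlonglongrightarrow> ((cmod y)\<^sup>2 + 0) powr (p/2)"
    using assms by (intro tendsto_powr2 tendsto_intros LIMSEQ_Suc[OF lim_1_over_n]) (auto intro!: always_eventually)
  moreover have "((cmod y)\<^sup>2 + 0) powr (p/2) = cmod y powr p"
    by (cases "y = 0") (simp_all add: powr_powr flip: powr_numeral)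
  ultimately show ?thesis by (simp add: reg_powr_def shift_powr_def)
qed

text \<open>On the left the regularisation only enlarges the integrand, so it is simply inserted. On
  the right it is removed along \<open>\<epsilon> = 1 / Suc n\<close> by dominated convergence, with
  the integrand for \<open>\<epsilon> = 1\<close> as majorant.\<close>

lemma bargmann_contraction:
  fixes a b :: "'i \<Rightarrow> complex^'n"
  assumes fin: "finite I" and p: "p > 1"
  shows "(\<integral>\<^sup>+z. ennreal (cmod (\<Sum>k\<in>I. c k * exp (cdot (a k) (b k)) * expf ((2 * sqrt (p - 1) / p) *\<^sub>R a k) 0 z) powr p) \<partial>gauss 1)
     \<le> (\<integral>\<^sup>+z. ennreal (cmod (\<Sum>k\<in>I. c k * expf (a k) (b k) z) powr p) \<partial>gauss 1)"
proof -
  define f where "f = (\<lambda>z. \<Sum>k\<in>I. c k * expf (a k) (b k) z)"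
  define A where "A = (\<integral>\<^sup>+z. ennreal (cmod (\<Sum>k\<in>I. c k * exp (cdot (a k) (b k)) * expf ((2 * sqrt (p - 1) / p) *\<^sub>R a k) 0 z) powr p) \<partial>gauss 1)"
  have [measurable]: "f \<in> borel_measurable borel" unfolding f_def by measurable
  have le: "A \<le> (\<integral>\<^sup>+z. ennreal (reg_powr (p/2) (1 / real (Suc n)) (f z)) \<partial>gauss 1)" for n
  proof -
    interpret mixed_flow I a b c p "2 * sqrt (p - 1) / p" "1 / real (Suc n)"
      by unfold_locales (use fin p in auto)
    have "A \<le> (\<integral>\<^sup>+z. ennreal (reg_powr (p/2) (1 / real (Suc n)) (\<Sum>k\<in>I. c k * exp (cdot (a k) (b k)) * expf ((2 * sqrt (p - 1) / p) *\<^sub>R a k) 0 z)) \<partial>gauss 1)"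
      unfolding A_def using p by (intro nn_integral_mono ennreal_leI powr_le_reg_powr) auto
    also have "\<dots> \<le> (\<integral>\<^sup>+z. ennreal (reg_powr (p/2) (1 / real (Suc n)) (f z)) \<partial>gauss 1)"
      unfolding f_def by (rule reg_powr_contraction)
    finally show ?thesis .
  qed
  have "(\<lambda>n. \<integral>\<^sup>+z. ennreal (reg_powr (p/2) (1 / real (Suc n)) (f z)) \<partial>gauss 1) \<longlonglongrightarrow> (\<integral>\<^sup>+z. ennreal (cmod (f z) powr p) \<partial>gauss 1)"
  proof (rule nn_integral_dominated_convergence)
    show "(\<lambda>z. ennreal (reg_powr (p/2) (1 / real (Suc n)) (f z))) \<in> borel_measurable (gauss 1)" for n
      using reg_powr_measurable[of "1 / real (Suc n)" "p/2"] by measurable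
    show "(\<lambda>z. ennreal (reg_powr (p/2) 1 (f z))) \<in> borel_measurable (gauss 1)"
      using reg_powr_measurable[of 1 "p/2"] by measurable
    have "integrable (gauss 1) (\<lambda>z. reg_powr (p/2) 1 (f z))" unfolding f_def by (rule integrable_reg_powr_expf[OF fin]) simp
    then show "(\<integral>\<^sup>+z. ennreal (reg_powr (p/2) 1 (f z)) \<partial>gauss 1) < \<infinity>"
      using nn_integral_eq_integral[of "gauss 1" "\<lambda>z. reg_powr (p/2) 1 (f z)"] by (simp add: reg_powr_nonneg)
    show "AE z in gauss 1. ennreal (reg_powr (p/2) (1 / real (Suc n)) (f z)) \<le> ennreal (reg_powr (p/2) 1 (f z))" for n
      using p unfolding reg_powr_def shift_powr_def by (intro AE_I2 ennreal_leI powr_mono2) (auto simp: field_simps)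
    show "AE z in gauss 1. (\<lambda>n. ennreal (reg_powr (p/2) (1 / real (Suc n)) (f z))) \<longlonglongrightarrow> ennreal (cmod (f z) powr p)"
      using p by (intro AE_I2 tendsto_ennrealI reg_powr_tendsto) auto
  qed measurable
  from LIMSEQ_le_const[OF this] le show ?thesis unfolding A_def[symmetric] f_def by blast
qed

section \<open>Approximation by exponential sums\<close>

text \<open>An inductive predicate makes closure under sums and products a rule induction with no
  bookkeeping of indices; the indexed form needed for the contraction is recovered in
  \<open>exp_comb_repr\<close>.\<close>

inductive exp_comb :: "(complex^'n \<Rightarrow> complex) \<Rightarrow> bool" where
  zero: "exp_comb (\<lambda>_. 0)"
| add_term: "exp_comb f \<Longrightarrow> exp_comb (\<lambda>z. f z + c * expf x y z)"

lemma exp_comb_add: "exp_comb g \<Longrightarrow> exp_comb f \<Longrightarrow> exp_comb (\<lambda>z. f z + g z)"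
proof (induction g rule: exp_comb.induct)
  case (add_term g c x y)
  then have "exp_comb (\<lambda>z. (f z + g z) + c * expf x y z)" by (intro exp_comb.add_term)
  then show ?case by (simp add: add.assoc)
qed simp

lemma exp_comb_single: "exp_comb (\<lambda>z. c * expf x y z)"
  using exp_comb.add_term[OF exp_comb.zero, of c x y] by simp

lemma expf_00 [simp]: "expf 0 0 z = 1"
  by (simp add: expf_def)

lemma exp_comb_const: "exp_comb (\<lambda>_. c)"
  using exp_comb_single[of c 0 0] by simp

lemma expf_mult: "expf x y z * expf x' y' z = expf (x + x') (y + y') z"
  by (simp add: expf_def exp_add[symmetric] cdot_add_left algebra_simps)

lemma exp_comb_mult: "exp_comb f \<Longrightarrow> exp_comb g \<Longrightarrow> exp_comb (\<lambda>z. f z * g z)"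
proof (induction f rule: exp_comb.induct)
  case (add_term f c x y)
  have "exp_comb (\<lambda>z. c * expf x y z * g z)"
    using add_term.prems
  proof (induction g rule: exp_comb.induct)
    case (add_term g c' x' y')
    have "exp_comb (\<lambda>z. c * expf x y z * g z + (c * c') * expf (x + x') (y + y') z)"
      by (intro exp_comb.add_term add_term)
    then show ?case by (simp add: distrib_left expf_mult[symmetric] mult_ac)
  qed (simp add: exp_comb.zero)
  from exp_comb_add[OF this add_term.IH[OF add_term.prems]] show ?case
    by (simp add: distrib_right)
qed (simp add: exp_comb.zero)

lemma exp_comb_sum: "(\<And>i. i \<in> S \<Longrightarrow> exp_comb (f i)) \<Longrightarrow> exp_comb (\<lambda>z. \<Sum>i\<in>S. f i z)"
  by (induction S rule: infinite_finite_induct) (auto intro: exp_comb.zero exp_comb_add)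

lemma exp_comb_cmult: "exp_comb f \<Longrightarrow> exp_comb (\<lambda>z. c * f z)"
  by (rule exp_comb_mult[OF exp_comb_const])

lemma exp_comb_repr:
  "exp_comb f \<Longrightarrow> \<exists>(n::nat) c a b. f = (\<lambda>z. \<Sum>k<n. c k * expf (a k) (b k) z)"
proof (induction f rule: exp_comb.induct)
  case zero
  show ?case by (rule exI[of _ 0]) simp
next
  case (add_term f c x y)
  then obtain n :: nat and c' a b where f: "f = (\<lambda>z. \<Sum>k<n. c' k * expf (a k) (b k) z)" by blast
  show ?case
    by (rule exI[of _ "Suc n"], rule exI[of _ "c'(n := c)"], rule exI[of _ "a(n := x)"], rule exI[of _ "b(n := y)"]) (simp add: f)
qed

text \<open>The assumption says that \<open>\<i> * \<theta>\<close> is an admissible exponent, so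
  Euler's formulas write the cosine and sine as sums of two exponentials.\<close>

lemma exp_comb_exp_ii:
  assumes "\<And>z. of_real (\<theta> z) * \<i> = cdot x z + cdot y (vcnj z)"
  shows "exp_comb (\<lambda>z. of_real (cos (\<theta> z)))" "exp_comb (\<lambda>z. of_real (sin (\<theta> z)))"
proof -
  have e: "exp (\<i> * of_real (\<theta> z)) = expf x y z" "exp (- (\<i> * of_real (\<theta> z))) = expf (-x) (-y) z" for z
  proof -
    have m: "cdot (- u) w = - cdot u w" for u w :: "complex^'n" by (simp add: cdot_def sum_negf)
    show "exp (\<i> * of_real (\<theta> z)) = expf x y z" unfolding expf_def assms[symmetric] by (simp add: mult.commute)
    have "expf (-x) (-y) z = exp (- (of_real (\<theta> z) * \<i>))" unfolding expf_def m assms by simp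
    then show "exp (- (\<i> * of_real (\<theta> z))) = expf (-x) (-y) z" by (simp add: mult.commute)
  qed
  have "exp_comb (\<lambda>z. (1/2) * expf x y z + (1/2) * expf (-x) (-y) z)"
    by (intro exp_comb_add exp_comb_single)
  moreover have "of_real (cos (\<theta> z)) = (1/2) * expf x y z + (1/2) * expf (-x) (-y) z" for z
    unfolding cos_of_real[symmetric] cos_exp_eq e[symmetric] by simp
  ultimately show "exp_comb (\<lambda>z. of_real (cos (\<theta> z)))" by simp
  have "exp_comb (\<lambda>z. (- \<i>/2) * expf x y z + (\<i>/2) * expf (-x) (-y) z)"
    by (intro exp_comb_add exp_comb_single)
  moreover have "of_real (sin (\<theta> z)) = (- \<i>/2) * expf x y z + (\<i>/2) * expf (-x) (-y) z" for z
    unfolding sin_of_real[symmetric] sin_exp_eq e[symmetric] by (simp add: field_simps)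
  ultimately show "exp_comb (\<lambda>z. of_real (sin (\<theta> z)))" by simp
qed

lemma cdot_axis: "cdot (axis i w) z = w * z $ i"
proof -
  have "cdot (axis i w) z = (\<Sum>j\<in>UNIV. if j = i then w * z $ i else 0)"
    unfolding cdot_def by (intro sum.cong) (auto simp: axis_def)
  then show ?thesis by simp
qed

section \<open>Trigonometric approximation on large boxes\<close>

lemma exp_comb_trig:
  "exp_comb (\<lambda>z. of_real (cos (Re (z $ i) / L)))" "exp_comb (\<lambda>z. of_real (sin (Re (z $ i) / L)))"
  "exp_comb (\<lambda>z. of_real (cos (Im (z $ i) / L)))" "exp_comb (\<lambda>z. of_real (sin (Im (z $ i) / L)))"
proof -
  have "of_real (Re (z $ i) / L) * \<i> = cdot (axis i (\<i> / (2 * of_real L))) z + cdot (axis i (\<i> / (2 * of_real L))) (vcnj z)" for z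
    unfolding cdot_axis vcnj_nth distrib_left[symmetric] complex_add_cnj by simp
  from exp_comb_exp_ii[OF this] show "exp_comb (\<lambda>z. of_real (cos (Re (z $ i) / L)))" "exp_comb (\<lambda>z. of_real (sin (Re (z $ i) / L)))" .
  have "of_real (Im (z $ i) / L) * \<i> = cdot (axis i (1 / (2 * of_real L))) z + cdot (axis i (- 1 / (2 * of_real L))) (vcnj z)" for z
  proof -
    have "1 / (2 * of_real L) * z $ i + - 1 / (2 * of_real L) * cnj (z $ i) = 1 / (2 * of_real L) * (z $ i - cnj (z $ i))"
      by (simp add: diff_divide_distrib)
    then show ?thesis unfolding cdot_axis vcnj_nth complex_diff_cnj by simp
  qed
  from exp_comb_exp_ii[OF this] show "exp_comb (\<lambda>z. of_real (cos (Im (z $ i) / L)))" "exp_comb (\<lambda>z. of_real (sin (Im (z $ i) / L)))" .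
qed

text \<open>Polynomials in these coordinates are exponential sums, and since the map has bounded
  image they are bounded on the whole space. That global bound is what dominated convergence will
  use away from the box of approximation.\<close>

definition torus_map :: "real \<Rightarrow> complex^'n \<Rightarrow> (complex^'n) \<times> (complex^'n)" where
  "torus_map L z = (\<chi> i. Complex (cos (Re (z $ i) / L)) (cos (Im (z $ i) / L)), \<chi> i. Complex (sin (Re (z $ i) / L)) (sin (Im (z $ i) / L)))"

lemma exp_comb_torus_component:
  fixes b :: "(complex^'n) \<times> (complex^'n)"
  assumes "b \<in> Basis"
  shows "exp_comb (\<lambda>z. of_real (torus_map L z \<bullet> b))"
proof -
  consider u where "u \<in> Basis" "b = (u, 0)" | u where "u \<in> Basis" "b = (0, u)"
    using assms unfolding Basis_prod_def by blast
  moreover have "\<exists>i. u = axis i 1 \<or> u = axis i \<i>" if "u \<in> Basis" for u :: "complex^'n"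
    using that unfolding Basis_vec_def Basis_complex_def by blast
  ultimately consider i where "b = (axis i 1, 0)" | i where "b = (axis i \<i>, 0)" | i where "b = (0, axis i 1)" | i where "b = (0, axis i \<i>)"
    by cases blast+
  then show ?thesis
  proof cases
    case 1
    then have eq: "torus_map L z \<bullet> b = cos (Re (z $ i) / L)" for z by (simp add: torus_map_def inner_axis)
    show ?thesis unfolding eq by (rule exp_comb_trig)
  next
    case 2
    then have eq: "torus_map L z \<bullet> b = cos (Im (z $ i) / L)" for z by (simp add: torus_map_def inner_axis)
    show ?thesis unfolding eq by (rule exp_comb_trig)
  next
    case 3
    then have eq: "torus_map L z \<bullet> b = sin (Re (z $ i) / L)" for z by (simp add: torus_map_def inner_axis)
    show ?thesis unfolding eq by (rule exp_comb_trig)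
  next
    case 4
    then have eq: "torus_map L z \<bullet> b = sin (Im (z $ i) / L)" for z by (simp add: torus_map_def inner_axis)
    show ?thesis unfolding eq by (rule exp_comb_trig)
  qed
qed

lemma exp_comb_polynomial:
  assumes "real_polynomial_function P"
  shows "exp_comb (\<lambda>z. of_real (P (torus_map L z)))"
  using assms
proof (induction P rule: real_polynomial_function.induct)
  case (linear P)
  then interpret P: bounded_linear P .
  have "(of_real (P x) :: complex) = (\<Sum>b\<in>Basis. of_real (P b) * of_real (x \<bullet> b))" for x
  proof -
    have "P x = P (\<Sum>b\<in>Basis. (x \<bullet> b) *\<^sub>R b)" by (simp add: euclidean_representation)
    also have "\<dots> = (\<Sum>b\<in>Basis. P b * (x \<bullet> b))" by (simp only: P.sum P.scaleR real_scaleR_def mult.commute)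
    finally have "of_real (P x) = (of_real (\<Sum>b\<in>Basis. P b * (x \<bullet> b)) :: complex)" by (rule arg_cong)
    then show ?thesis by (simp only: of_real_sum of_real_mult)
  qed
  note eq = this[of "torus_map L _"]
  have "exp_comb (\<lambda>z. of_real (P b) * of_real (torus_map L z \<bullet> b))" if "b \<in> Basis" for b
    by (rule exp_comb_cmult[OF exp_comb_torus_component[OF that]])
  then show ?case unfolding eq by (rule exp_comb_sum)
next
  case (const c)
  show ?case by (rule exp_comb_const)
next
  case (add f g)
  then show ?case using exp_comb_add[of "\<lambda>z. of_real (g (torus_map L z))" "\<lambda>z. of_real (f (torus_map L z))"] by simp
next
  case (mult f g)
  then show ?case using exp_comb_mult[of "\<lambda>z. of_real (f (torus_map L z))" "\<lambda>z. of_real (g (torus_map L z))"] by simp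
qed

text \<open>Applied to a cosine of \<open>t\<close> in the interval from \<open>- pi\<close> to
  \<open>pi\<close>, it is 1 for \<open>|t| \<le> 1\<close> and 0 for \<open>|t| > pi / 2\<close>.
  It suppresses the branch on which \<open>arcsin (sin t)\<close> differs from
  \<open>t\<close>.\<close>

definition cutoff :: "real \<Rightarrow> real" where
  "cutoff t = max 0 (min 1 (t / cos 1))"

lemma cos_1_pos: "cos (1::real) > 0"
  using pi_gt3 by (intro cos_gt_zero_pi) auto

text \<open>On the period box, \<open>u\<close> factors through \<open>torus_map\<close> as a
  continuous function \<open>F\<close> on a cube: \<open>S\<close> recovers the point from the
  sines, correctly up to \<open>pi / 2\<close>, and \<open>\<kappa>\<close> makes \<open>F\<close>
  vanish on the wrong branch, where \<open>u\<close> is 0 as well. Stone-Weierstrass approximates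
  \<open>F\<close> by a polynomial on the cube. The image of every point lies in the cube, so the
  bound \<open>M + e\<close> is global.\<close>

lemma exp_comb_approx_real:
  fixes u :: "complex^'n \<Rightarrow> real"
  assumes L: "L > 0" and u: "continuous_on UNIV u" and M: "\<And>z. \<bar>u z\<bar> \<le> M" and e: "e > 0"
    and supp: "\<And>z i. L < \<bar>Re (z $ i)\<bar> \<or> L < \<bar>Im (z $ i)\<bar> \<Longrightarrow> u z = 0"
  shows "\<exists>g. exp_comb (\<lambda>z. of_real (g z)) \<and> (\<forall>z. \<bar>g z\<bar> \<le> M + e) \<and>
    (\<forall>z. (\<forall>i. \<bar>Re (z $ i)\<bar> \<le> pi * L \<and> \<bar>Im (z $ i)\<bar> \<le> pi * L) \<longrightarrow> \<bar>g z - u z\<bar> \<le> e)"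
proof -
  \<comment> \<open>The cube contains the image of \<open>torus_map\<close> and is compact, and on
    it all arguments of \<open>arcsin\<close> lie in the range of continuity.\<close>
  define D where "D = cbox (- One) (One :: (complex^'n) \<times> (complex^'n))"
  define \<kappa> where "\<kappa> = (\<lambda>c::complex^'n. \<Prod>i\<in>UNIV. cutoff (Re (c $ i)) * cutoff (Im (c $ i)))"
  define S where "S = (\<lambda>s::complex^'n. \<chi> i. Complex (L * arcsin (Re (s $ i))) (L * arcsin (Im (s $ i))))"
  define F where "F = (\<lambda>x. \<kappa> (fst x) * u (S (snd x)))"
  have D_iff: "x \<in> D \<longleftrightarrow> (\<forall>i. \<bar>Re (fst x $ i)\<bar> \<le> 1 \<and> \<bar>Im (fst x $ i)\<bar> \<le> 1 \<and> \<bar>Re (snd x $ i)\<bar> \<le> 1 \<and> \<bar>Im (snd x $ i)\<bar> \<le> 1)" for x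
  proof -
    have "x \<in> D \<longleftrightarrow> (\<forall>b\<in>Basis. \<bar>x \<bullet> b\<bar> \<le> 1)"
      unfolding D_def mem_box by (auto simp: inner_simps abs_le_iff)
    also have "\<dots> \<longleftrightarrow> (\<forall>i. \<bar>Re (fst x $ i)\<bar> \<le> 1 \<and> \<bar>Im (fst x $ i)\<bar> \<le> 1 \<and> \<bar>Re (snd x $ i)\<bar> \<le> 1 \<and> \<bar>Im (snd x $ i)\<bar> \<le> 1)"
    proof -
      have v: "(\<forall>u\<in>Basis. \<bar>y \<bullet> u\<bar> \<le> 1) \<longleftrightarrow> (\<forall>i. \<bar>Re (y $ i)\<bar> \<le> 1 \<and> \<bar>Im (y $ i)\<bar> \<le> 1)" for y :: "complex^'n"
        unfolding Basis_vec_def Basis_complex_def by (auto simp: inner_axis)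
      have "(\<forall>b\<in>Basis. \<bar>x \<bullet> b\<bar> \<le> 1) \<longleftrightarrow> (\<forall>u\<in>Basis. \<bar>fst x \<bullet> u\<bar> \<le> 1) \<and> (\<forall>u\<in>Basis. \<bar>snd x \<bullet> u\<bar> \<le> 1)"
        unfolding Basis_prod_def ball_Un by (simp add: inner_prod_def)
      then show ?thesis unfolding v by blast
    qed
    finally show ?thesis .
  qed
  have co: "continuous_on UNIV cutoff" unfolding cutoff_def using cos_1_pos by (intro continuous_intros) auto
  have c1: "0 \<le> cutoff t" "cutoff t \<le> 1" for t by (auto simp: cutoff_def)
  have kb: "\<bar>\<kappa> c\<bar> \<le> 1" for c
  proof -
    have "\<kappa> c \<le> 1" unfolding \<kappa>_def using c1 by (intro prod_le_1) (simp add: mult_le_one)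
    moreover have "\<kappa> c \<ge> 0" unfolding \<kappa>_def using c1 by (intro prod_nonneg) simp
    ultimately show ?thesis by simp
  qed
  have M0: "M \<ge> 0" using M[of 0] by linarith
  have Fb: "\<bar>F x\<bar> \<le> M" for x
    unfolding F_def abs_mult using kb[of "fst x"] M[of "S (snd x)"] M0 mult_mono[of "\<bar>\<kappa> (fst x)\<bar>" 1 "\<bar>u (S (snd x))\<bar>" M] by simp
  have "continuous_on D F"
    unfolding F_def
  proof (rule continuous_on_mult)
    show "continuous_on D (\<lambda>x. \<kappa> (fst x))"
      unfolding \<kappa>_def
      by (intro continuous_intros continuous_on_compose2[OF co] continuous_on_component) auto
    show "continuous_on D (\<lambda>x. u (S (snd x)))"
    proof (rule continuous_on_compose2[OF u])
      show "continuous_on D (\<lambda>x. S (snd x))"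
        unfolding S_def Complex_eq
        by (intro continuous_on_vec_lambda continuous_intros continuous_on_component) (auto simp: D_iff abs_le_iff minus_le_iff)
    qed auto
  qed
  moreover have "compact D" unfolding D_def by (rule compact_cbox)
  ultimately obtain P where P: "real_polynomial_function P" "\<And>x. x \<in> D \<Longrightarrow> \<bar>F x - P x\<bar> < e"
    using Stone_Weierstrass_real_polynomial_function[of D F e] e by blast
  have tD: "torus_map L z \<in> D" for z
    by (simp add: D_iff torus_map_def)
  have Fu: "F (torus_map L z) = u z" if z: "\<And>i. \<bar>Re (z $ i)\<bar> \<le> pi * L \<and> \<bar>Im (z $ i)\<bar> \<le> pi * L" for z
  proof -
    have inv: "S (snd (torus_map L z)) = z" if "\<And>i. \<bar>Re (z $ i) / L\<bar> \<le> pi / 2 \<and> \<bar>Im (z $ i) / L\<bar> \<le> pi / 2"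
    proof -
      have "L * arcsin (sin (Re (z $ i) / L)) = Re (z $ i)" "L * arcsin (sin (Im (z $ i) / L)) = Im (z $ i)" for i
      proof -
        have "arcsin (sin (Re (z $ i) / L)) = Re (z $ i) / L" "arcsin (sin (Im (z $ i) / L)) = Im (z $ i) / L"
        proof -
          have h: "arcsin (sin x) = x" if "\<bar>x\<bar> \<le> pi / 2" for x :: real
            using that by (intro arcsin_sin) (auto simp: abs_le_iff)
          show "arcsin (sin (Re (z $ i) / L)) = Re (z $ i) / L" "arcsin (sin (Im (z $ i) / L)) = Im (z $ i) / L"
            using that[of i] by (blast intro: h)+
        qed
        then show "L * arcsin (sin (Re (z $ i) / L)) = Re (z $ i)" "L * arcsin (sin (Im (z $ i) / L)) = Im (z $ i)"
          using L by auto
      qed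
      then show ?thesis by (simp add: S_def torus_map_def vec_eq_iff complex_eq_iff)
    qed
    show ?thesis
    proof (cases "\<forall>i. \<bar>Re (z $ i) / L\<bar> \<le> 1 \<and> \<bar>Im (z $ i) / L\<bar> \<le> 1")
      case True
      have "cutoff (cos t) = 1" if "\<bar>t\<bar> \<le> 1" for t
      proof -
        have "cos 1 \<le> cos \<bar>t\<bar>" using that pi_gt3 by (intro cos_monotone_0_pi_le) auto
        then have "cos 1 \<le> cos t" by simp
        then show ?thesis using cos_1_pos by (simp add: cutoff_def)
      qed
      then have "\<kappa> (fst (torus_map L z)) = 1"
        using True unfolding \<kappa>_def torus_map_def by (intro prod.neutral) simp
      moreover have "S (snd (torus_map L z)) = z"
      proof (rule inv)
        fix i
        show "\<bar>Re (z $ i) / L\<bar> \<le> pi / 2 \<and> \<bar>Im (z $ i) / L\<bar> \<le> pi / 2"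
          using spec[OF True, of i] pi_gt3 by linarith
      qed
      ultimately show ?thesis by (simp add: F_def)
    next
      case False
      then obtain i where "1 < \<bar>Re (z $ i) / L\<bar> \<or> 1 < \<bar>Im (z $ i) / L\<bar>" by (meson not_le)
      then have u0: "u z = 0" using L by (intro supp[of z i]) (simp add: abs_divide)
      show ?thesis
      proof (cases "\<forall>i. \<bar>Re (z $ i) / L\<bar> \<le> pi/2 \<and> \<bar>Im (z $ i) / L\<bar> \<le> pi/2")
        case True
        then have "S (snd (torus_map L z)) = z" by (intro inv) auto
        then show ?thesis using u0 by (simp add: F_def)
      next
        case False
        then obtain i where i: "pi/2 < \<bar>Re (z $ i) / L\<bar> \<or> pi/2 < \<bar>Im (z $ i) / L\<bar>" by (meson not_le)
        \<comment> \<open>The cosine stays nonpositive only up to \<open>pi\<close>; this is why the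
          approximation is claimed on the box of half-width \<open>pi * L\<close>.\<close>
        have neg: "cutoff (cos t) = 0" if "pi/2 < \<bar>t\<bar>" "\<bar>t\<bar> \<le> pi" for t
        proof -
          have "cos \<bar>t\<bar> \<le> cos (pi/2)" using that by (intro cos_monotone_0_pi_le) auto
          then have "cos t \<le> 0" by simp
          then have "cos t / cos 1 \<le> 0" using cos_1_pos by (simp add: divide_nonpos_pos)
          then show ?thesis by (simp add: cutoff_def)
        qed
        have "\<bar>Re (z $ i) / L\<bar> \<le> pi" "\<bar>Im (z $ i) / L\<bar> \<le> pi" using z[of i] L by (auto simp: abs_divide field_simps)
        then have "cutoff (cos (Re (z $ i) / L)) * cutoff (cos (Im (z $ i) / L)) = 0"
          using i neg by auto
        then have "\<kappa> (fst (torus_map L z)) = 0"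
          unfolding \<kappa>_def torus_map_def by (intro prod_zero) (auto intro!: exI[of _ i])
        then show ?thesis using u0 by (simp add: F_def)
      qed
    qed
  qed
  show ?thesis
  proof (intro exI[of _ "\<lambda>z. P (torus_map L z)"] conjI allI impI)
    show "exp_comb (\<lambda>z. of_real (P (torus_map L z)))" by (rule exp_comb_polynomial[OF P(1)])
    show "\<bar>P (torus_map L z)\<bar> \<le> M + e" for z using P(2)[OF tD[of z]] Fb[of "torus_map L z"] by linarith
    show "\<bar>P (torus_map L z) - u z\<bar> \<le> e" if "\<forall>i. \<bar>Re (z $ i)\<bar> \<le> pi * L \<and> \<bar>Im (z $ i)\<bar> \<le> pi * L" for z
      using P(2)[OF tD[of z]] Fu[of z] that by force
  qed
qed

text \<open>Real and imaginary parts are approximated separately on boxes that exhaust the space.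
  With errors at most 1 each part is bounded by \<open>M + 1\<close>, which gives the uniform bound
  \<open>2 * M + 2\<close>.\<close>

lemma exp_comb_approx:
  fixes f :: "complex^'n \<Rightarrow> complex"
  assumes f: "continuous_on UNIV f" and M: "\<And>z. cmod (f z) \<le> M" and R: "\<And>z. norm z > R \<Longrightarrow> f z = 0"
  obtains g where "\<And>n::nat. exp_comb (g n)" "\<And>n z. cmod (g n z) \<le> 2 * M + 2" "\<And>z. (\<lambda>n. g n z) \<longlonglongrightarrow> f z"
proof -
  \<comment> \<open>The term \<open>|R|\<close> keeps the support of \<open>f\<close> inside the box
    of half-width \<open>L n\<close>, and \<open>n\<close> makes the boxes exhaust the
    space.\<close>
  define L where "L n = \<bar>R\<bar> + real n + 1" for n :: nat
  define e where "e n = 1 / (real n + 1)" for n :: nat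
  have Lp: "L n > 0" for n by (simp add: L_def)
  have ep: "e n > 0" "e n \<le> 1" for n by (auto simp: e_def)
  have comp: "\<bar>Re (z $ i)\<bar> \<le> norm z" "\<bar>Im (z $ i)\<bar> \<le> norm z" for z :: "complex^'n" and i
    using abs_Re_le_cmod[of "z $ i"] abs_Im_le_cmod[of "z $ i"] Finite_Cartesian_Product.norm_nth_le[of z i] by linarith+
  have supp: "f z = 0" if "L n < \<bar>Re (z $ i)\<bar> \<or> L n < \<bar>Im (z $ i)\<bar>" for n z i
    using that comp[of z i] R[of z] by (auto simp: L_def)
  define near where "near n z \<longleftrightarrow> (\<forall>i. \<bar>Re (z $ i)\<bar> \<le> pi * L n \<and> \<bar>Im (z $ i)\<bar> \<le> pi * L n)" for n and z :: "complex^'n"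
  have ex: "\<exists>G. exp_comb G \<and> (\<forall>z. cmod (G z) \<le> 2 * M + 2) \<and> (\<forall>z. near n z \<longrightarrow> cmod (G z - f z) \<le> 2 * e n)" for n
  proof -
    have bg1: "\<bar>Re (f z)\<bar> \<le> M" for z using abs_Re_le_cmod[of "f z"] M[of z] by linarith
    have sg1: "Re (f z) = 0" if "L n < \<bar>Re (z $ i)\<bar> \<or> L n < \<bar>Im (z $ i)\<bar>" for z i using supp[OF that] by simp
    have "\<exists>g. exp_comb (\<lambda>z. of_real (g z)) \<and> (\<forall>z. \<bar>g z\<bar> \<le> M + e n) \<and> (\<forall>z. near n z \<longrightarrow> \<bar>g z - Re (f z)\<bar> \<le> e n)"
      unfolding near_def by (rule exp_comb_approx_real[OF Lp[of n] continuous_on_Re[OF f] bg1 ep(1)[of n]]) (rule sg1)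
    then obtain g1 where g1: "exp_comb (\<lambda>z. of_real (g1 z))" "\<And>z. \<bar>g1 z\<bar> \<le> M + e n" 
      "\<And>z. near n z \<Longrightarrow> \<bar>g1 z - Re (f z)\<bar> \<le> e n"
      by blast
    have bg2: "\<bar>Im (f z)\<bar> \<le> M" for z using abs_Im_le_cmod[of "f z"] M[of z] by linarith
    have sg2: "Im (f z) = 0" if "L n < \<bar>Re (z $ i)\<bar> \<or> L n < \<bar>Im (z $ i)\<bar>" for z i using supp[OF that] by simp
    have "\<exists>g. exp_comb (\<lambda>z. of_real (g z)) \<and> (\<forall>z. \<bar>g z\<bar> \<le> M + e n) \<and> (\<forall>z. near n z \<longrightarrow> \<bar>g z - Im (f z)\<bar> \<le> e n)"
      unfolding near_def by (rule exp_comb_approx_real[OF Lp[of n] continuous_on_Im[OF f] bg2 ep(1)[of n]]) (rule sg2)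
    then obtain g2 where g2: "exp_comb (\<lambda>z. of_real (g2 z))" "\<And>z. \<bar>g2 z\<bar> \<le> M + e n" 
      "\<And>z. near n z \<Longrightarrow> \<bar>g2 z - Im (f z)\<bar> \<le> e n"
      by blast
    define G where "G z = of_real (g1 z) + \<i> * of_real (g2 z)" for z
    have "exp_comb G"
      unfolding G_def[abs_def] by (rule exp_comb_add[OF exp_comb_cmult[OF g2(1)] g1(1)])
    moreover have "cmod (G z) \<le> 2 * M + 2" for z
    proof -
      have "cmod (G z) \<le> \<bar>g1 z\<bar> + \<bar>g2 z\<bar>"
        unfolding G_def by (rule order_trans[OF norm_triangle_ineq]) (simp add: norm_mult)
      then show ?thesis using g1(2)[of z] g2(2)[of z] ep[of n] by linarith
    qed
    moreover have "cmod (G z - f z) \<le> 2 * e n" if "near n z" for z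
    proof -
      have "cmod (G z - f z) \<le> \<bar>Re (G z - f z)\<bar> + \<bar>Im (G z - f z)\<bar>" by (rule cmod_le)
      also have "\<dots> = \<bar>g1 z - Re (f z)\<bar> + \<bar>g2 z - Im (f z)\<bar>" by (simp add: G_def)
      finally show ?thesis using g1(3)[OF that] g2(3)[OF that] by linarith
    qed
    ultimately show ?thesis by blast
  qed
  define G where "G n = (SOME G. exp_comb G \<and> (\<forall>z. cmod (G z) \<le> 2 * M + 2) \<and> (\<forall>z. near n z \<longrightarrow> cmod (G z - f z) \<le> 2 * e n))" for n
  have GG: "exp_comb (G n) \<and> (\<forall>z. cmod (G n z) \<le> 2 * M + 2) \<and> (\<forall>z. near n z \<longrightarrow> cmod (G n z - f z) \<le> 2 * e n)" for n
    unfolding G_def by (rule someI_ex[OF ex])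
  have G: "exp_comb (G n)" "cmod (G n z) \<le> 2 * M + 2" "near n z \<Longrightarrow> cmod (G n z - f z) \<le> 2 * e n" for n z
    using GG by blast+
  show ?thesis
  proof (rule that[of G, OF G(1) G(2)])
    fix z :: "complex^'n"
    have "eventually (\<lambda>n. cmod (G n z - f z) \<le> 2 * e n) sequentially"
      using eventually_ge_at_top[of "nat \<lceil>norm z\<rceil>"]
    proof eventually_elim
      case (elim n)
      have "norm z \<le> L n" using elim by (simp add: L_def)
      also have "L n \<le> pi * L n" using Lp[of n] pi_gt3 by simp
      finally have n: "norm z \<le> pi * L n" .
      have "near n z" unfolding near_def by (intro allI conjI order_trans[OF comp(1) n] order_trans[OF comp(2) n])
      then show ?case by (rule G(3))
    qed
    moreover have "(\<lambda>n. 2 * e n) \<longlonglongrightarrow> 0"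
    proof -
      have "(\<lambda>n. 1 / real (Suc n)) \<longlonglongrightarrow> 0" by (rule LIMSEQ_Suc[OF lim_1_over_n])
      moreover have "e n = 1 / real (Suc n)" for n by (simp add: e_def)
      ultimately have "e \<longlonglongrightarrow> 0" by presburger
      from tendsto_mult_right_zero[OF this, of 2] show ?thesis .
    qed
    ultimately have "(\<lambda>n. G n z - f z) \<longlonglongrightarrow> 0" by (rule Lim_null_comparison)
    then show "(\<lambda>n. G n z) \<longlonglongrightarrow> f z" by (rule LIM_zero_cancel)
  qed
qed

section \<open>Duality of Fock spaces\<close>

lemma conj_exponent:
  fixes p q :: real
  assumes "1 < p" "1 / p + 1 / q = 1"
  shows "1 < q" "q = p / (p - 1)" "(q - 1) * p = q"
proof -
  have "1 / q = (p - 1) / p" using assms by (simp add: field_simps)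
  then have "q = p / (p - 1)" by (metis divide_divide_eq_right div_by_1 inverse_divide inverse_eq_divide inverse_inverse_eq)
  then show qq: "q = p / (p - 1)" .
  show "1 < q" unfolding qq using assms(1) by simp
  show "(q - 1) * p = q" unfolding qq using assms(1) by (simp add: field_simps)
qed

lemma cnj_measurable [measurable]: "cnj \<in> borel_measurable borel"
  by (intro borel_measurable_continuous_onI continuous_intros)

lemma fock_space_iff:
  "g \<in> fock_space p a \<longleftrightarrow> holo_Cn g \<and> integrable (gauss (a * p / 2)) (\<lambda>z. norm (g z) powr p)"
proof -
  have "(\<integral>\<^sup>+ z. ennreal ((norm (g z)) powr p) \<partial>(gauss (a * p / 2))) < \<infinity> \<longleftrightarrow> integrable (gauss (a * p / 2)) (\<lambda>z. norm (g z) powr p)"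
    if "holo_Cn g"
  proof -
    note [measurable] = holo_Cn_measurable[OF that]
    show ?thesis by (subst integrable_iff_bounded) (simp add: less_top)
  qed
  then show ?thesis unfolding fock_space_def by blast
qed

lemma fock_norm_nonneg: "fock_norm p a g \<ge> 0"
  by (simp add: fock_norm_def)

lemma fock_norm_powr:
  assumes "p > 0"
  shows "fock_norm p a g powr p = (\<integral>z. norm (g z) powr p \<partial>gauss (a * p / 2))"
  using assms by (simp add: fock_norm_def powr_powr)

lemma fock_pointwise_bound:
  fixes g :: "complex^'n \<Rightarrow> complex"
  assumes a: "a > 0" and p: "p > 1" and g: "g \<in> fock_space p a"
  shows "norm (g z) \<le> exp (a / 2 * (norm z)\<^sup>2) * fock_norm p a g"
proof -
  define b where "b = a * p / 2"
  have b: "b > 0" using a p by (simp add: b_def)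
  interpret P: prob_space "gauss b :: (complex^'n) measure" by (rule prob_space_gauss[OF b])
  have hg: "holo_Cn g" and ig: "integrable (gauss b) (\<lambda>z. norm (g z) powr p)"
    using g unfolding fock_space_iff b_def by auto
  note [measurable] = holo_Cn_measurable[OF hg]
  \<comment> \<open>The holomorphic factor is chosen so that \<open>|k|^p\<close> is
    \<open>exp (b * |z|^2)\<close> times the Cameron-Martin density of \<open>gauss b\<close>
    multiplied by the translate of \<open>|g|^p\<close>. Since \<open>b = a * p / 2\<close>, the
    p-th root of that constant is \<open>exp (a / 2 * |z|^2)\<close>.\<close>
  define k where "k = (\<lambda>v. g (v + z) * exp (cdot (- (a *\<^sub>R vcnj z)) v))"
  have hk: "holo_Cn k" unfolding k_def by (intro holo_Cn_mult holo_Cn_translate hg holo_Cn_exp_cdot)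
  note [measurable] = holo_Cn_measurable[OF hk]
  have kp: "norm (k v) powr p = exp (b * (norm z)\<^sup>2) * (exp (- (b * (2 * Re (cdot v (vcnj z)) + (norm z)\<^sup>2))) *\<^sub>R norm (g (v + z)) powr p)" for v
  proof -
    have "cdot (- (a *\<^sub>R vcnj z)) v = - of_real a * cdot v (vcnj z)"
      using cdot_scaleR_left[of "-a" "vcnj z" v] by (simp add: cdot_commute)
    then have "norm (k v) powr p = norm (g (v + z)) powr p * exp (- (a * Re (cdot v (vcnj z)))) powr p"
      by (simp add: k_def norm_mult powr_mult)
    also have "exp (- (a * Re (cdot v (vcnj z)))) powr p = exp (b * (norm z)\<^sup>2) * exp (- (b * (2 * Re (cdot v (vcnj z)) + (norm z)\<^sup>2)))"
      by (simp add: exp_powr_real exp_add[symmetric] b_def algebra_simps)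
    finally show ?thesis by simp
  qed
  have ik: "integrable (gauss b) (\<lambda>v. norm (k v) powr p)"
    unfolding kp using integrable_gauss_translate[OF b, of "\<lambda>v. norm (g v) powr p" z] ig by simp
  have Ik: "(\<integral>v. norm (k v) powr p \<partial>gauss b) = exp (b * (norm z)\<^sup>2) * (\<integral>v. norm (g v) powr p \<partial>gauss b)"
    unfolding kp using integral_gauss_translate[OF b, of "\<lambda>v. norm (g v) powr p" z] by simp
  have meas: "k \<in> borel_measurable (gauss b)" by simp
  note L = P.integral_norm_le_powr[OF p meas ik]
  have "norm (g z) = norm (k 0)" by (simp add: k_def)
  also have "k 0 = (\<integral>v. k v \<partial>gauss b)" by (rule gauss_mean_value[OF b hk L(1), symmetric])
  also have "norm \<dots> \<le> (\<integral>v. norm (k v) \<partial>gauss b)" by (rule integral_norm_bound)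
  also have "\<dots> \<le> (\<integral>v. norm (k v) powr p \<partial>gauss b) powr (1/p)" by (rule L(2))
  also have "\<dots> = exp (b * (norm z)\<^sup>2) powr (1/p) * (\<integral>v. norm (g v) powr p \<partial>gauss b) powr (1/p)"
    unfolding Ik by (simp add: powr_mult)
  also have "exp (b * (norm z)\<^sup>2) powr (1/p) = exp (a / 2 * (norm z)\<^sup>2)"
    using p by (simp add: exp_powr_real b_def)
  finally show ?thesis by (simp add: fock_norm_def b_def)
qed

text \<open>The pointwise bound at a point where \<open>g\<close> does not vanish excludes norm
  0.\<close>

lemma fock_norm_pos:
  fixes g :: "complex^'n \<Rightarrow> complex"
  assumes a: "a > 0" and p: "p > 1" and g: "g \<in> fock_space p a - {\<lambda>_. 0}"
  shows "fock_norm p a g > 0"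
proof -
  obtain z where "g z \<noteq> 0" using g by auto
  then have "0 < norm (g z)" by simp
  also have "\<dots> \<le> exp (a / 2 * (norm z)\<^sup>2) * fock_norm p a g"
    using fock_pointwise_bound[OF a p] g by blast
  finally show ?thesis by (simp add: zero_less_mult_iff)
qed

section \<open>Boundedness of the pairing\<close>

lemma gauss_integral_lborel:
  fixes F :: "complex^'n \<Rightarrow> real"
  assumes "a > 0" and [measurable]: "F \<in> borel_measurable borel"
  shows "integrable (gauss a) F \<longleftrightarrow> integrable lborel (\<lambda>z. (a / pi) ^ CARD('n) * exp (- a * (norm z)\<^sup>2) * F z)"
    "(\<integral>z. F z \<partial>gauss a) = (\<integral>z. (a / pi) ^ CARD('n) * exp (- a * (norm z)\<^sup>2) * F z \<partial>lborel)"
proof -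
  show "integrable (gauss a) F \<longleftrightarrow> integrable lborel (\<lambda>z. (a / pi) ^ CARD('n) * exp (- a * (norm z)\<^sup>2) * F z)"
    unfolding gauss_def by (subst integrable_density) (use assms in auto)
  show "(\<integral>z. F z \<partial>gauss a) = (\<integral>z. (a / pi) ^ CARD('n) * exp (- a * (norm z)\<^sup>2) * F z \<partial>lborel)"
    unfolding gauss_def by (subst integral_density) (use assms in auto)
qed

text \<open>The three measures are compared on Lebesgue measure: \<open>exp (- a * |z|^2)\<close> is
  shared equally between \<open>g\<close> and \<open>h\<close>, and Young's inequality then produces
  exactly the weights of the two norms. The powers of \<open>2/p\<close> and \<open>2/q\<close> are
  quotients of normalising constants. The bound is crude, but it serves to make the supremum in
  \<open>dual_norm\<close> finite.\<close>

lemma fock_pair_young: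
  fixes g h :: "complex^'n \<Rightarrow> complex"
  assumes a: "a > 0" and p: "1 < p" and pq: "1 / p + 1 / q = 1"
    and g: "g \<in> fock_space p a" and h: "h \<in> fock_space q a"
  shows "integrable (gauss a) (\<lambda>z. g z * cnj (h z))"
    "norm (fock_pair a g h) \<le> (2/p) ^ CARD('n) / p * fock_norm p a g powr p + (2/q) ^ CARD('n) / q * fock_norm q a h powr q"
proof -
  let ?n = "CARD('n)"
  note q = conj_exponent[OF p pq]
  have hg: "holo_Cn g" and ig: "integrable (gauss (a * p / 2)) (\<lambda>z. norm (g z) powr p)"
    and hh: "holo_Cn h" and ih: "integrable (gauss (a * q / 2)) (\<lambda>z. norm (h z) powr q)"
    using g h unfolding fock_space_iff by auto
  note [measurable] = holo_Cn_measurable[OF hg] holo_Cn_measurable[OF hh]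
  have ap: "a * p / 2 > 0" and aq: "a * q / 2 > 0" using a p q by auto
  define A where "A = (\<lambda>z. (a * p / 2 / pi) ^ ?n * exp (- (a * p / 2) * (norm z)\<^sup>2) * norm (g z) powr p)"
  define B where "B = (\<lambda>z. (a * q / 2 / pi) ^ ?n * exp (- (a * q / 2) * (norm z)\<^sup>2) * norm (h z) powr q)"
  have iA: "integrable lborel A" using ig unfolding A_def by (subst (asm) gauss_integral_lborel[OF ap]) auto
  have iB: "integrable lborel B" using ih unfolding B_def by (subst (asm) gauss_integral_lborel[OF aq]) auto
  have IA: "(\<integral>z. A z \<partial>lborel) = fock_norm p a g powr p"
    using p unfolding A_def by (subst gauss_integral_lborel(2)[OF ap, symmetric]) (auto simp: fock_norm_powr)
  have IB: "(\<integral>z. B z \<partial>lborel) = fock_norm q a h powr q"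
    using q unfolding B_def by (subst gauss_integral_lborel(2)[OF aq, symmetric]) (auto simp: fock_norm_powr)
  define C where "C = (\<lambda>z. (2/p) ^ ?n / p * A z + (2/q) ^ ?n / q * B z)"
  have iC: "integrable lborel C" unfolding C_def using iA iB by simp
  have IC: "(\<integral>z. C z \<partial>lborel) = (2/p) ^ ?n / p * fock_norm p a g powr p + (2/q) ^ ?n / q * fock_norm q a h powr q"
    unfolding C_def using iA iB IA IB by simp
  define G where "G = (\<lambda>z. (a / pi) ^ ?n * exp (- a * (norm z)\<^sup>2) * norm (g z * cnj (h z)))"
  have G0: "G z \<ge> 0" for z using a by (simp add: G_def)
  have GC: "G z \<le> C z" for z
  proof -
    define u where "u = norm (g z) * exp (- (a / 2 * (norm z)\<^sup>2))"
    define v where "v = norm (h z) * exp (- (a / 2 * (norm z)\<^sup>2))"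
    have "u * v \<le> u powr p / p + v powr q / q"
      using Youngs_inequality[of p q u v] p q pq by (simp add: u_def v_def)
    then have "(a / pi) ^ ?n * (u * v) \<le> (a / pi) ^ ?n * (u powr p / p + v powr q / q)"
      using a by (intro mult_left_mono) auto
    moreover have "(a / pi) ^ ?n * (u * v) = G z"
    proof -
      have "exp (- (a / 2 * (norm z)\<^sup>2)) * exp (- (a / 2 * (norm z)\<^sup>2)) = exp (- a * (norm z)\<^sup>2)" by (simp add: exp_add[symmetric])
      then show ?thesis unfolding G_def u_def v_def by (simp add: norm_mult mult_ac)
    qed
    moreover have "(a / pi) ^ ?n * (u powr p / p) = (2/p) ^ ?n / p * A z"
    proof -
      have "u powr p = norm (g z) powr p * exp (- (a * p / 2) * (norm z)\<^sup>2)"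
        by (simp add: u_def powr_mult exp_powr_real algebra_simps)
      moreover have "(a / pi) ^ ?n = (2/p) ^ ?n * (a * p / 2 / pi) ^ ?n"
        using p by (simp add: power_mult_distrib[symmetric])
      ultimately show ?thesis by (simp add: A_def)
    qed
    moreover have "(a / pi) ^ ?n * (v powr q / q) = (2/q) ^ ?n / q * B z"
    proof -
      have "v powr q = norm (h z) powr q * exp (- (a * q / 2) * (norm z)\<^sup>2)"
        by (simp add: v_def powr_mult exp_powr_real algebra_simps)
      moreover have "(a / pi) ^ ?n = (2/q) ^ ?n * (a * q / 2 / pi) ^ ?n"
        using q(1) by (simp add: power_mult_distrib[symmetric])
      ultimately show ?thesis by (simp add: B_def)
    qed
    ultimately show ?thesis unfolding C_def distrib_left by linarith
  qed
  have [measurable]: "G \<in> borel_measurable borel" unfolding G_def by measurable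
  have iG: "integrable lborel G"
    by (rule Bochner_Integration.integrable_bound[OF iC]) (use G0 GC in \<open>auto intro: order_trans[OF _ abs_ge_self]\<close>)
  have iN: "integrable (gauss a) (\<lambda>z. norm (g z * cnj (h z)))"
    unfolding gauss_integral_lborel(1)[OF a, of "\<lambda>z. norm (g z * cnj (h z))", simplified] using iG unfolding G_def by simp
  show iP: "integrable (gauss a) (\<lambda>z. g z * cnj (h z))"
    using iN by (subst (asm) integrable_norm_iff) auto
  have "norm (fock_pair a g h) \<le> (\<integral>z. norm (g z * cnj (h z)) \<partial>gauss a)"
    unfolding fock_pair_def by (rule integral_norm_bound)
  also have "\<dots> = (\<integral>z. G z \<partial>lborel)"
    unfolding G_def by (subst gauss_integral_lborel(2)[OF a]) auto
  also have "\<dots> \<le> (\<integral>z. C z \<partial>lborel)" by (rule integral_mono[OF iG iC GC])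
  finally show "norm (fock_pair a g h) \<le> (2/p) ^ ?n / p * fock_norm p a g powr p + (2/q) ^ ?n / q * fock_norm q a h powr q"
    unfolding IC .
qed

lemma holo_Cn_cmult: "holo_Cn g \<Longrightarrow> holo_Cn (\<lambda>z. c * g z)"
  by (rule holo_Cn_mult[OF holo_Cn_const])

lemma fock_space_cmult:
  assumes "g \<in> fock_space p a"
  shows "(\<lambda>z. c * g z) \<in> fock_space p a"
  using assms unfolding fock_space_iff by (auto simp: norm_mult powr_mult intro: holo_Cn_cmult)

lemma fock_norm_cmult:
  assumes "p > 0"
  shows "fock_norm p a (\<lambda>z. c * g z) = norm c * fock_norm p a g"
  using assms by (simp add: fock_norm_def norm_mult powr_mult powr_powr)

text \<open>The quotient is invariant under scaling of \<open>g\<close>, so \<open>g\<close> may be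
  normalised to norm 1; the bound then no longer involves \<open>g\<close>.\<close>

lemma fock_pair_ratio_bound:
  fixes g h :: "complex^'n \<Rightarrow> complex"
  assumes a: "a > 0" and p: "1 < p" and pq: "1 / p + 1 / q = 1"
    and g: "g \<in> fock_space p a - {\<lambda>_. 0}" and h: "h \<in> fock_space q a"
  shows "norm (fock_pair a g h) / fock_norm p a g \<le> (2/p) ^ CARD('n) / p + (2/q) ^ CARD('n) / q * fock_norm q a h powr q"
proof -
  define N where "N = fock_norm p a g"
  have N: "N > 0" unfolding N_def by (rule fock_norm_pos[OF a p g])
  have "fock_pair a (\<lambda>z. of_real (1/N) * g z) h = of_real (1/N) * fock_pair a g h"
    unfolding fock_pair_def by (simp add: mult.assoc)
  then have "norm (fock_pair a g h) / N = norm (fock_pair a (\<lambda>z. of_real (1/N) * g z) h)"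
    using N by (simp add: norm_mult norm_divide)
  also have "\<dots> \<le> (2/p) ^ CARD('n) / p * fock_norm p a (\<lambda>z. of_real (1/N) * g z) powr p + (2/q) ^ CARD('n) / q * fock_norm q a h powr q"
    using g by (intro fock_pair_young(2)[OF a p pq] fock_space_cmult h) auto
  also have "fock_norm p a (\<lambda>z. of_real (1/N) * g z) = 1"
    using N p by (subst fock_norm_cmult) (auto simp: norm_divide N_def[symmetric])
  finally show ?thesis by (simp add: N_def)
qed

text \<open>\<open>dual_norm\<close> is a supremum of reals, so it dominates the individual
  quotients only once boundedness is known.\<close>

lemma bdd_above_dual:
  fixes h :: "complex^'n \<Rightarrow> complex"
  assumes "a > 0" "1 < p" "1 / p + 1 / q = 1" "h \<in> fock_space q a"
  shows "bdd_above ((\<lambda>g. norm (fock_pair a g h) / fock_norm p a g) ` (fock_space p a - {\<lambda>_. 0}))"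
  using fock_pair_ratio_bound[OF assms(1-3) _ assms(4)] by (intro bdd_aboveI2) blast

lemma fock_space_one:
  assumes "a > 0" "p > 0"
  shows "(\<lambda>_. 1) \<in> (fock_space p a :: (complex^'n \<Rightarrow> complex) set)" "fock_norm p a (\<lambda>_::complex^'n. 1) = 1"
proof -
  have ap: "a * p / 2 > 0" using assms by simp
  interpret prob_space "gauss (a * p / 2) :: (complex^'n) measure" by (rule prob_space_gauss[OF ap])
  show "(\<lambda>_. 1) \<in> (fock_space p a :: (complex^'n \<Rightarrow> complex) set)"
    unfolding fock_space_iff by (auto intro: holo_Cn_const)
  show "fock_norm p a (\<lambda>_::complex^'n. 1) = 1"
    using assms ap by (simp add: fock_norm_def)
qed

lemma fock_pair_le_dual:
  fixes g h :: "complex^'n \<Rightarrow> complex"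
  assumes "a > 0" "1 < p" "1 / p + 1 / q = 1" and h: "h \<in> fock_space q a" and g: "g \<in> fock_space p a"
  shows "norm (fock_pair a g h) \<le> dual_norm p a h * fock_norm p a g" "dual_norm p a h \<ge> 0"
proof -
  have *: "norm (fock_pair a g h) / fock_norm p a g \<le> dual_norm p a h" if "g \<in> fock_space p a - {\<lambda>_. 0}" for g
    unfolding dual_norm_def by (rule cSUP_upper[OF that bdd_above_dual[OF assms(1-3) h]])
  have "(\<lambda>_. 1) \<in> fock_space p a - {\<lambda>_::complex^'n. 0 :: complex}"
    using fock_space_one(1)[of a p] assms by (auto dest: fun_cong)
  from *[OF this] show d0: "dual_norm p a h \<ge> 0"
    using fock_norm_nonneg[of p a "\<lambda>_::complex^'n. 1"] by (meson divide_nonneg_nonneg norm_ge_zero order_trans)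
  show "norm (fock_pair a g h) \<le> dual_norm p a h * fock_norm p a g"
  proof (cases "g = (\<lambda>_. 0)")
    case True
    then show ?thesis using d0 fock_norm_nonneg[of p a g] by (simp add: fock_pair_def)
  next
    case False
    then have gs: "g \<in> fock_space p a - {\<lambda>_. 0}" using g by auto
    from *[OF gs] fock_norm_pos[OF assms(1,2) gs] show ?thesis by (simp add: field_simps)
  qed
qed

section \<open>Lower bound for the dual norm by test functions on
  \<open>gauss (a * q / 2)\<close>\<close>

lemma holo_Cn_expf_sum:
  fixes x :: "nat \<Rightarrow> complex^'n"
  shows "holo_Cn (\<lambda>z. \<Sum>k<n. c k * expf (x k) 0 z)"
proof (intro holo_Cn_sum holo_Cn_cmult)
  have "expf u 0 = (\<lambda>z. exp (cdot u z))" for u :: "complex^'n" by (simp add: fun_eq_iff expf_def)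
  then show "holo_Cn (expf (x k) 0)" for k using holo_Cn_exp_cdot by metis
qed

lemma integrable_powr_expf_sum:
  fixes x y :: "nat \<Rightarrow> complex^'n"
  assumes a: "a > 0" and p: "p > 0"
  shows "integrable (gauss a) (\<lambda>z. norm (\<Sum>k<n. c k * expf (x k) (y k) z) powr p)"
proof -
  define B where "B = (\<Sum>k<n. norm (x k) + norm (y k))"
  have B: "norm (x k) + norm (y k) \<le> B" if "k < n" for k
    unfolding B_def using that by (intro member_le_sum[of k "{..<n}" "\<lambda>k. norm (x k) + norm (y k)"]) auto
  define V where "V = (\<Sum>k<n. cmod (c k))"
  have b: "norm (\<Sum>k<n. c k * expf (x k) (y k) z) \<le> V * exp (B * norm z)" for z
  proof -
    have "norm (\<Sum>k<n. c k * expf (x k) (y k) z) \<le> (\<Sum>k<n. cmod (c k) * exp (B * norm z))"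
    proof (rule sum_norm_le)
      fix k assume "k \<in> {..<n}"
      then have "cmod (expf (x k) (y k) z) \<le> exp (B * norm z)"
        using B[of k] by (intro order_trans[OF norm_expf_le]) (simp add: mult_right_mono)
      then show "norm (c k * expf (x k) (y k) z) \<le> cmod (c k) * exp (B * norm z)"
        by (simp add: norm_mult mult_left_mono)
    qed
    then show ?thesis by (simp add: V_def sum_distrib_right)
  qed
  have V0: "V \<ge> 0" unfolding V_def by (intro sum_nonneg) auto
  show ?thesis
  proof (rule Bochner_Integration.integrable_bound)
    show "integrable (gauss a) (\<lambda>z::complex^'n. V powr p * exp ((B * p) * norm z))"
      by (intro integrable_mult_right integrable_exp_norm_gauss a)
    show "AE z in gauss a. norm (norm (\<Sum>k<n. c k * expf (x k) (y k) z) powr p) \<le> norm (V powr p * exp ((B * p) * norm z))"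
    proof (intro AE_I2)
      fix z :: "complex^'n"
      have "norm (\<Sum>k<n. c k * expf (x k) (y k) z) powr p \<le> (V * exp (B * norm z)) powr p"
        using b p by (intro powr_mono2) auto
      also have "\<dots> = V powr p * exp ((B * p) * norm z)"
        using V0 by (simp add: powr_mult exp_powr_real mult_ac)
      finally show "norm (norm (\<Sum>k<n. c k * expf (x k) (y k) z) powr p) \<le> norm (V powr p * exp ((B * p) * norm z))"
        by simp
    qed
  qed simp
qed

lemma nn_integral_gauss_scale:
  fixes F :: "complex^'n \<Rightarrow> ennreal"
  assumes "a > 0" and [measurable]: "F \<in> borel_measurable borel"
  shows "(\<integral>\<^sup>+z. F z \<partial>gauss a) = (\<integral>\<^sup>+z. F ((1 / sqrt a) *\<^sub>R z) \<partial>gauss 1)"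
proof -
  have "gauss a = distr (gauss 1) borel (\<lambda>z::complex^'n. (1 / sqrt a) *\<^sub>R z)"
    using distr_gauss_scale[of 1 "1 / sqrt a", where 'n = 'n] assms by (simp add: power_divide)
  then show ?thesis by (simp add: nn_integral_distr)
qed

lemma expf_scaleR: "expf x y (r *\<^sub>R z) = expf (r *\<^sub>R x) (r *\<^sub>R y) z"
  by (simp add: expf_def cdot_scaleR_left cdot_scaleR_right vcnj_scaleR)

text \<open>\<open>g\<close> is the Bargmann projection for \<open>gauss \<beta>\<close> of the
  exponential sum, dilated by \<open>2 / q\<close>. Both measures are rescaled to
  \<open>gauss 1\<close>; the identity \<open>scale\<close> says that the dilation then becomes the
  factor \<open>r\<close> of \<open>bargmann_contraction\<close>.\<close>

lemma fock_contraction: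
  fixes x y :: "nat \<Rightarrow> complex^'n" and c :: "nat \<Rightarrow> complex" and n :: nat
  assumes a: "a > 0" and p: "1 < p" and pq: "1 / p + 1 / q = 1"
  defines "\<beta> \<equiv> a * q / 2"
  defines "g \<equiv> (\<lambda>z. \<Sum>k<n. (c k * exp (cdot (x k) (y k) / of_real \<beta>)) * expf ((2 / q) *\<^sub>R x k) 0 z)"
  shows "g \<in> fock_space p a"
    "fock_norm p a g powr p \<le> (\<integral>z. norm (\<Sum>k<n. c k * expf (x k) (y k) z) powr p \<partial>gauss \<beta>)"
proof -
  note q = conj_exponent[OF p pq]
  have ap: "a * p / 2 > 0" and b: "\<beta> > 0" using a p q(1) by (auto simp: \<beta>_def)
  define r where "r = 2 * sqrt (p - 1) / p"
  define s where "s = 1 / sqrt \<beta>"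
  define X where "X k = s *\<^sub>R x k" for k
  define Y where "Y k = s *\<^sub>R y k" for k
  have ig: "integrable (gauss (a * p / 2)) (\<lambda>z. norm (g z) powr p)"
    unfolding g_def using integrable_powr_expf_sum[OF ap, where p = p and n = n and y = "\<lambda>_. 0"] p by simp
  then show gs: "g \<in> fock_space p a"
    using holo_Cn_expf_sum[of "\<lambda>k. c k * exp (cdot (x k) (y k) / of_real \<beta>)" "\<lambda>k. (2 / q) *\<^sub>R x k" n]
    unfolding fock_space_iff g_def by simp
  have [measurable]: "g \<in> borel_measurable borel" unfolding g_def by measurable
  have ss: "s * s = 1 / \<beta>" using b by (simp add: s_def real_sqrt_mult_self)
  have cXY: "exp (cdot (X k) (Y k)) = exp (cdot (x k) (y k) / of_real \<beta>)" for k
  proof -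
    have "cdot (X k) (Y k) = of_real (s * s) * cdot (x k) (y k)"
      by (simp add: X_def Y_def cdot_scaleR_left cdot_scaleR_right)
    then show ?thesis by (simp add: ss)
  qed
  have scale: "(1 / sqrt (a * p / 2)) * (2 / q) = r * s"
  proof (rule power2_eq_imp_eq)
    have "((1 / sqrt (a * p / 2)) * (2 / q))\<^sup>2 = 8 / (a * p * q\<^sup>2)"
      using ap by (simp add: power_mult_distrib power_divide)
    also have "\<dots> = 8 * (p - 1)\<^sup>2 / (a * p ^ 3)"
      using p a unfolding q(2) by (simp add: power_divide power2_eq_square power3_eq_cube)
    also have "\<dots> = (r * s)\<^sup>2"
    proof -
      have "(r * s)\<^sup>2 = (4 * (p - 1) / p\<^sup>2) * (1 / \<beta>)"
        using p b by (simp add: r_def s_def power_mult_distrib power_divide)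
      also have "\<beta> = a * p / (2 * (p - 1))" unfolding \<beta>_def q(2) using p by simp
      also have "(4 * (p - 1) / p\<^sup>2) * (1 / (a * p / (2 * (p - 1)))) = 8 * (p - 1)\<^sup>2 / (a * p ^ 3)"
        using p a by (simp add: field_simps power2_eq_square power3_eq_cube)
      finally show ?thesis ..
    qed
    finally show "((1 / sqrt (a * p / 2)) * (2 / q))\<^sup>2 = (r * s)\<^sup>2" .
    show "0 \<le> (1 / sqrt (a * p / 2)) * (2 / q)" using q(1) ap by simp
    show "0 \<le> r * s" using p b by (simp add: r_def s_def)
  qed
  have "(\<integral>\<^sup>+z. ennreal (norm (g z) powr p) \<partial>gauss (a * p / 2)) = (\<integral>\<^sup>+z. ennreal (norm (g ((1 / sqrt (a * p / 2)) *\<^sub>R z)) powr p) \<partial>gauss 1)"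
    by (rule nn_integral_gauss_scale[OF ap]) measurable
  also have "\<dots> = (\<integral>\<^sup>+z. ennreal (norm (\<Sum>k<n. c k * exp (cdot (X k) (Y k)) * expf (r *\<^sub>R X k) 0 z) powr p) \<partial>gauss 1)"
    unfolding g_def expf_scaleR scaleR_scaleR scale cXY by (simp add: X_def)
  also have "\<dots> \<le> (\<integral>\<^sup>+z. ennreal (norm (\<Sum>k<n. c k * expf (X k) (Y k) z) powr p) \<partial>gauss 1)"
    unfolding r_def by (rule bargmann_contraction[OF _ p]) simp
  also have "\<dots> = (\<integral>\<^sup>+z. ennreal (norm (\<Sum>k<n. c k * expf (x k) (y k) z) powr p) \<partial>gauss \<beta>)"
  proof (subst nn_integral_gauss_scale[OF b])
    show "(\<integral>\<^sup>+z. ennreal (norm (\<Sum>k<n. c k * expf (X k) (Y k) z) powr p) \<partial>gauss 1)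
       = (\<integral>\<^sup>+z. ennreal (norm (\<Sum>k<n. c k * expf (x k) (y k) ((1 / sqrt \<beta>) *\<^sub>R z)) powr p) \<partial>gauss 1)"
      by (simp add: X_def Y_def s_def expf_scaleR)
  qed measurable
  finally have le: "(\<integral>\<^sup>+z. ennreal (norm (g z) powr p) \<partial>gauss (a * p / 2)) \<le> (\<integral>\<^sup>+z. ennreal (norm (\<Sum>k<n. c k * expf (x k) (y k) z) powr p) \<partial>gauss \<beta>)" .
  have if': "integrable (gauss \<beta>) (\<lambda>z. norm (\<Sum>k<n. c k * expf (x k) (y k) z) powr p)"
    by (rule integrable_powr_expf_sum[OF b]) (use p in simp)
  have "fock_norm p a g powr p = (\<integral>z. norm (g z) powr p \<partial>gauss (a * p / 2))"
    using p by (simp add: fock_norm_powr)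
  also have "\<dots> \<le> (\<integral>z. norm (\<Sum>k<n. c k * expf (x k) (y k) z) powr p \<partial>gauss \<beta>)"
    using le unfolding nn_integral_eq_integral[OF ig AE_I2[OF powr_ge_zero]] nn_integral_eq_integral[OF if' AE_I2[OF powr_ge_zero]]
    by (subst (asm) ennreal_le_iff) auto
  finally show "fock_norm p a g powr p \<le> (\<integral>z. norm (\<Sum>k<n. c k * expf (x k) (y k) z) powr p \<partial>gauss \<beta>)" .
qed

lemma expf_holo_split: "expf x y z * cnj w = cnj (w * exp (cdot (vcnj y) z) * exp (cdot (vcnj x) (vcnj z)))"
  by (simp add: expf_def exp_cnj cnj_cdot exp_add mult_ac)

text \<open>After conjugating the integrand, \<open>h\<close> together with
  \<open>exp (cdot (vcnj y) z)\<close> is holomorphic and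
  \<open>exp (cdot (vcnj x) (vcnj z))\<close> is the reproducing kernel, which evaluates at
  \<open>(1/b) *\<^sub>R vcnj x\<close>.\<close>

lemma integral_expf_cnj:
  fixes h :: "complex^'n \<Rightarrow> complex"
  assumes b: "b > 0" and hh: "holo_Cn h" and int: "integrable (gauss b) (\<lambda>z. expf x y z * cnj (h z))"
  shows "(\<integral>z. expf x y z * cnj (h z) \<partial>gauss b) = exp (cdot x y / of_real b) * cnj (h ((1/b) *\<^sub>R vcnj x))"
proof -
  define k where "k = (\<lambda>z. h z * exp (cdot (vcnj y) z))"
  have hk: "holo_Cn k" unfolding k_def by (intro holo_Cn_mult hh holo_Cn_exp_cdot)
  have e: "expf x y z * cnj (h z) = cnj (k z * exp (cdot (vcnj x) (vcnj z)))" for z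
    unfolding k_def by (rule expf_holo_split)
  have ik: "integrable (gauss b) (\<lambda>z. k z * exp (cdot (vcnj x) (vcnj z)))"
    using int unfolding e complex_integrable_cnj .
  have "(\<integral>z. expf x y z * cnj (h z) \<partial>gauss b) = cnj (k ((1/b) *\<^sub>R vcnj x))"
    unfolding e Bochner_Integration.integral_cnj gauss_reproducing[OF b hk ik] ..
  then show ?thesis
    by (simp add: k_def exp_cnj cnj_cdot cdot_scaleR_right vcnj_scaleR cdot_commute divide_inverse mult_ac)
qed

lemma integrable_mult_conj_exponent:
  fixes f h :: "complex^'n \<Rightarrow> complex"
  assumes p: "1 < p" and pq: "1 / p + 1 / q = 1"
    and [measurable]: "f \<in> borel_measurable borel" "h \<in> borel_measurable borel"
    and "integrable (gauss b) (\<lambda>z. norm (f z) powr p)" "integrable (gauss b) (\<lambda>z. norm (h z) powr q)"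
  shows "integrable (gauss b) (\<lambda>z. f z * cnj (h z))"
proof (rule Bochner_Integration.integrable_bound)
  note q = conj_exponent[OF p pq]
  show "integrable (gauss b) (\<lambda>z. norm (f z) powr p / p + norm (h z) powr q / q)" using assms by simp
  have "norm (f z) * norm (h z) \<le> norm (f z) powr p / p + norm (h z) powr q / q" for z
    using Youngs_inequality[of p q] p q(1) pq by simp
  moreover have "norm (f z) powr p / p + norm (h z) powr q / q \<ge> 0" for z using p q(1) by simp
  ultimately show "AE z in gauss b. norm (f z * cnj (h z)) \<le> norm (norm (f z) powr p / p + norm (h z) powr q / q)"
    by (intro AE_I2) (simp add: norm_mult)
qed measurable

text \<open>Replacing \<open>f\<close> by its projected and dilated version \<open>g\<close> leaves
  the pairing with \<open>h\<close> unchanged, although the measure changes from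
  \<open>gauss \<beta>\<close> to \<open>gauss a\<close>. The norm of \<open>g\<close> is controlled
  by \<open>fock_contraction\<close>, and the definition of the dual norm applies to
  \<open>g\<close>.\<close>

lemma dual_bound_exp_comb:
  fixes h :: "complex^'n \<Rightarrow> complex"
  assumes a: "a > 0" and p: "1 < p" and pq: "1 / p + 1 / q = 1"
    and h: "h \<in> fock_space q a" and f: "exp_comb f"
  shows "norm (\<integral>z. f z * cnj (h z) \<partial>gauss (a * q / 2)) \<le> dual_norm p a h * (\<integral>z. norm (f z) powr p \<partial>gauss (a * q / 2)) powr (1/p)"
proof -
  note q = conj_exponent[OF p pq]
  define \<beta> where "\<beta> = a * q / 2"
  have b: "\<beta> > 0" using a q(1) by (simp add: \<beta>_def)
  obtain n :: nat and c x y where f: "f = (\<lambda>z. \<Sum>k<n. c k * expf (x k) (y k) z)"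
    using exp_comb_repr[OF f] by blast
  define C where "C k = c k * exp (cdot (x k) (y k) / of_real \<beta>)" for k
  define g where "g = (\<lambda>z. \<Sum>k<n. C k * expf ((2 / q) *\<^sub>R x k) 0 z)"
  have hh: "holo_Cn h" and ih: "integrable (gauss \<beta>) (\<lambda>z. norm (h z) powr q)"
    using h unfolding fock_space_iff \<beta>_def by auto
  note [measurable] = holo_Cn_measurable[OF hh]
  have gs: "g \<in> fock_space p a" and gn: "fock_norm p a g powr p \<le> (\<integral>z. norm (f z) powr p \<partial>gauss \<beta>)"
    using fock_contraction[OF a p pq, where n = n and c = c and x = x and y = y] unfolding g_def f C_def \<beta>_def by auto
  have expp: "integrable (gauss d) (\<lambda>z. norm (expf u v z) powr p)" if "d > 0" for d and u v :: "complex^'n"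
    using integrable_powr_expf_sum[OF that, where p = p and n = 1 and c = "\<lambda>_. 1" and x = "\<lambda>_. u" and y = "\<lambda>_. v"] p by simp
  have i1: "integrable (gauss \<beta>) (\<lambda>z. expf (x k) (y k) z * cnj (h z))" for k
    by (rule integrable_mult_conj_exponent[OF p pq]) (use expp[OF b] ih in auto)
  have i2: "integrable (gauss a) (\<lambda>z. expf ((2 / q) *\<^sub>R x k) 0 z * cnj (h z))" for k
  proof (rule fock_pair_young(1)[OF a p pq _ h])
    have "holo_Cn (expf ((2 / q) *\<^sub>R x k) 0)"
      using holo_Cn_expf_sum[of "\<lambda>_. 1" "\<lambda>_. (2 / q) *\<^sub>R x k" 1] by simp
    then show "expf ((2 / q) *\<^sub>R x k) 0 \<in> fock_space p a"
      unfolding fock_space_iff using expp[of "a * p / 2"] a p by auto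
  qed
  have "fock_pair a g h = (\<Sum>k<n. C k * (\<integral>z. expf ((2 / q) *\<^sub>R x k) 0 z * cnj (h z) \<partial>gauss a))"
    unfolding fock_pair_def g_def sum_distrib_right mult.assoc
    by (subst Bochner_Integration.integral_sum) (auto intro: i2)
  also have "\<dots> = (\<Sum>k<n. c k * (\<integral>z. expf (x k) (y k) z * cnj (h z) \<partial>gauss \<beta>))"
  proof (rule sum.cong)
    fix k
    \<comment> \<open>Both reproducing formulas sample \<open>h\<close> at the same point, because
      \<open>(1 / a) * (2 / q) = 1 / \<beta>\<close>; the factor in \<open>C\<close> matches the
      exponential that the formula for \<open>\<beta>\<close> produces.\<close>
    have "(1 / a) *\<^sub>R vcnj ((2 / q) *\<^sub>R x k) = (1 / \<beta>) *\<^sub>R vcnj (x k)"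
      using a q(1) by (simp add: vcnj_scaleR \<beta>_def mult.commute)
    then show "C k * (\<integral>z. expf ((2 / q) *\<^sub>R x k) 0 z * cnj (h z) \<partial>gauss a) = c k * (\<integral>z. expf (x k) (y k) z * cnj (h z) \<partial>gauss \<beta>)"
      unfolding integral_expf_cnj[OF a hh i2] integral_expf_cnj[OF b hh i1] C_def by simp
  qed simp
  also have "\<dots> = (\<integral>z. f z * cnj (h z) \<partial>gauss \<beta>)"
    unfolding f sum_distrib_right mult.assoc
    by (subst Bochner_Integration.integral_sum) (auto intro: i1)
  finally have eq: "fock_pair a g h = (\<integral>z. f z * cnj (h z) \<partial>gauss \<beta>)" .
  have "fock_norm p a g = (fock_norm p a g powr p) powr (1/p)"
    using p fock_norm_nonneg[of p a g] by (simp add: powr_powr)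
  also have "\<dots> \<le> (\<integral>z. norm (f z) powr p \<partial>gauss \<beta>) powr (1/p)"
    using gn p by (intro powr_mono2) auto
  finally have n: "fock_norm p a g \<le> (\<integral>z. norm (f z) powr p \<partial>gauss \<beta>) powr (1/p)" .
  have "norm (fock_pair a g h) \<le> dual_norm p a h * fock_norm p a g"
    by (rule fock_pair_le_dual(1)[OF a p pq h gs])
  also have "\<dots> \<le> dual_norm p a h * (\<integral>z. norm (f z) powr p \<partial>gauss \<beta>) powr (1/p)"
    using n fock_pair_le_dual(2)[OF a p pq h gs] by (intro mult_left_mono) auto
  finally show ?thesis unfolding eq \<beta>_def .
qed

text \<open>The approximating exponential sums are uniformly bounded, so a multiple of
  \<open>|h|\<close> is a majorant for the pairings and a constant is one for the p-th
  powers.\<close>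

lemma dual_bound_compact_support:
  fixes h :: "complex^'n \<Rightarrow> complex"
  assumes a: "a > 0" and p: "1 < p" and pq: "1 / p + 1 / q = 1"
    and h: "h \<in> fock_space q a" and f: "continuous_on UNIV f" and M: "\<And>z. cmod (f z) \<le> M" and R: "\<And>z. norm z > R \<Longrightarrow> f z = 0"
  shows "norm (\<integral>z. f z * cnj (h z) \<partial>gauss (a * q / 2)) \<le> dual_norm p a h * (\<integral>z. norm (f z) powr p \<partial>gauss (a * q / 2)) powr (1/p)"
proof -
  note q = conj_exponent[OF p pq]
  define \<beta> where "\<beta> = a * q / 2"
  have b: "\<beta> > 0" using a q(1) by (simp add: \<beta>_def)
  interpret P: prob_space "gauss \<beta> :: (complex^'n) measure" by (rule prob_space_gauss[OF b])
  have hh: "holo_Cn h" and ih: "integrable (gauss \<beta>) (\<lambda>z. norm (h z) powr q)"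
    using h unfolding fock_space_iff \<beta>_def by auto
  note [measurable] = holo_Cn_measurable[OF hh]
  have [measurable]: "f \<in> borel_measurable borel" by (rule borel_measurable_continuous_onI[OF f])
  have hint: "integrable (gauss \<beta>) h"
    by (rule P.integral_norm_le_powr(1)[OF q(1) _ ih]) simp
  obtain g where g: "\<And>n::nat. exp_comb (g n)" "\<And>n z. cmod (g n z) \<le> 2 * M + 2" "\<And>z. (\<lambda>n. g n z) \<longlonglongrightarrow> f z"
    using exp_comb_approx[OF f M R] by blast
  have gm[measurable]: "g n \<in> borel_measurable borel" for n
  proof -
    obtain N :: nat and c x y where "g n = (\<lambda>z. \<Sum>k<N. c k * expf (x k) (y k) z)"
      using exp_comb_repr[OF g(1)[of n]] by blast
    then show ?thesis by simp
  qed
  have "(\<lambda>n. \<integral>z. g n z * cnj (h z) \<partial>gauss \<beta>) \<longlonglongrightarrow> (\<integral>z. f z * cnj (h z) \<partial>gauss \<beta>)"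
  proof (rule integral_dominated_convergence[where w = "\<lambda>z. (2 * M + 2) * norm (h z)"])
    show "integrable (gauss \<beta>) (\<lambda>z. (2 * M + 2) * norm (h z))" using hint by simp
    show "AE z in gauss \<beta>. (\<lambda>n. g n z * cnj (h z)) \<longlonglongrightarrow> f z * cnj (h z)"
      by (intro AE_I2 tendsto_mult g(3) tendsto_const)
    show "AE z in gauss \<beta>. norm (g n z * cnj (h z)) \<le> (2 * M + 2) * norm (h z)" for n
      by (intro AE_I2) (simp add: norm_mult mult_right_mono g(2))
  qed measurable
  then have l1: "(\<lambda>n. norm (\<integral>z. g n z * cnj (h z) \<partial>gauss \<beta>)) \<longlonglongrightarrow> norm (\<integral>z. f z * cnj (h z) \<partial>gauss \<beta>)"
    by (rule tendsto_norm)
  have "(\<lambda>n. \<integral>z. norm (g n z) powr p \<partial>gauss \<beta>) \<longlonglongrightarrow> (\<integral>z. norm (f z) powr p \<partial>gauss \<beta>)"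
  proof (rule integral_dominated_convergence[where w = "\<lambda>z. (2 * M + 2) powr p"])
    show "AE z in gauss \<beta>. (\<lambda>n. norm (g n z) powr p) \<longlonglongrightarrow> norm (f z) powr p"
      using p by (intro AE_I2 tendsto_powr2 tendsto_norm g(3) tendsto_const) (auto intro: always_eventually)
    show "AE z in gauss \<beta>. norm (norm (g n z) powr p) \<le> (2 * M + 2) powr p" for n
      using p g(2) by (intro AE_I2) (auto intro!: powr_mono2)
  qed simp_all
  then have "(\<lambda>n. (\<integral>z. norm (g n z) powr p \<partial>gauss \<beta>) powr (1/p)) \<longlonglongrightarrow> (\<integral>z. norm (f z) powr p \<partial>gauss \<beta>) powr (1/p)"
    using p by (intro tendsto_powr2 tendsto_const) (auto intro!: always_eventually)
  then have l2: "(\<lambda>n. dual_norm p a h * (\<integral>z. norm (g n z) powr p \<partial>gauss \<beta>) powr (1/p)) \<longlonglongrightarrow> dual_norm p a h * (\<integral>z. norm (f z) powr p \<partial>gauss \<beta>) powr (1/p)"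
    by (intro tendsto_mult tendsto_const)
  have "norm (\<integral>z. f z * cnj (h z) \<partial>gauss \<beta>) \<le> dual_norm p a h * (\<integral>z. norm (f z) powr p \<partial>gauss \<beta>) powr (1/p)"
    by (rule LIMSEQ_le[OF l1 l2]) (use dual_bound_exp_comb[OF a p pq h g(1)] in \<open>auto simp: \<beta>_def\<close>)
  then show ?thesis unfolding \<beta>_def .
qed

text \<open>For \<open>q < 2\<close> the scalar factor is unbounded near 0, but the product has
  modulus \<open>|y| powr (q - 1)\<close>, which tends to 0 since \<open>q > 1\<close>.\<close>

lemma continuous_on_duality_map:
  assumes q: "q > 1"
  shows "continuous_on UNIV (\<lambda>y::complex. y * of_real (cmod y powr (q - 2)))"
proof (intro continuous_at_imp_continuous_on ballI)
  fix y :: complex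
  show "isCont (\<lambda>y::complex. y * of_real (cmod y powr (q - 2))) y"
  proof (cases "y = 0")
    case False
    then show ?thesis by (intro continuous_intros) auto
  next
    case True
    have n: "norm (y * of_real (cmod y powr (q - 2))) = cmod y powr (q - 1)" for y :: complex
    proof (cases "y = 0")
      case False
      then have "cmod y * cmod y powr (q - 2) = cmod y powr 1 * cmod y powr (q - 2)" by simp
      also have "\<dots> = cmod y powr (q - 1)" by (simp only: powr_add[symmetric]) simp
      finally show ?thesis by (simp add: norm_mult)
    qed simp
    have "((\<lambda>y. cmod y powr (q - 1)) \<longlongrightarrow> cmod 0 powr (q - 1)) (at 0)"
      using q by (intro tendsto_powr2 tendsto_norm tendsto_ident_at tendsto_const) (auto intro!: always_eventually)
    then have "((\<lambda>y. norm (y * of_real (cmod y powr (q - 2)))) \<longlongrightarrow> 0) (at 0)"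
      unfolding n using q by simp
    then have "((\<lambda>y. y * of_real (cmod y powr (q - 2))) \<longlongrightarrow> 0) (at 0)" by (rule tendsto_norm_zero_cancel)
    then show ?thesis unfolding isCont_def True by simp
  qed
qed

text \<open>The test function is \<open>|h| powr (q-2) * h\<close> times a compactly supported
  cutoff. Its pairing with \<open>h\<close> is \<open>J n\<close>, and its p-norm is at most
  \<open>J n powr (1/p)\<close>. Since \<open>J n\<close> is finite, dividing leaves
  \<open>J n powr (1/q) \<le> D\<close>, and removing the cutoff gives the norm of
  \<open>h\<close>.\<close>

lemma fock_norm_le_dual:
  fixes h :: "complex^'n \<Rightarrow> complex"
  assumes a: "a > 0" and p: "1 < p" and pq: "1 / p + 1 / q = 1"
    and h: "h \<in> fock_space q a"
  shows "fock_norm q a h \<le> dual_norm p a h"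
proof -
  note q = conj_exponent[OF p pq]
  define \<beta> where "\<beta> = a * q / 2"
  have hh: "holo_Cn h" and ih: "integrable (gauss \<beta>) (\<lambda>z. norm (h z) powr q)"
    using h unfolding fock_space_iff \<beta>_def by auto
  note [measurable] = holo_Cn_measurable[OF hh]
  have ch: "continuous_on UNIV h" by (rule holo_Cn_continuous_on[OF hh])
  define D where "D = dual_norm p a h"
  have D0: "D \<ge> 0" unfolding D_def using fock_pair_le_dual(2)[OF a p pq h fock_space_one(1)] a p by simp
  define cut where "cut n z = max 0 (min 1 (real n + 1 - norm z))" for n :: nat and z :: "complex^'n"
  have chi: "0 \<le> cut n z" "cut n z \<le> 1" for n z by (auto simp: cut_def)
  have cchi: "continuous_on UNIV (cut n)" for n unfolding cut_def by (intro continuous_intros)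
  have [measurable]: "cut n \<in> borel_measurable borel" for n by (rule borel_measurable_continuous_onI[OF cchi])
  define J where "J n = (\<integral>z. cut n z * norm (h z) powr q \<partial>gauss \<beta>)" for n
  have iJ: "integrable (gauss \<beta>) (\<lambda>z. cut n z * norm (h z) powr q)" for n
    by (rule Bochner_Integration.integrable_bound[OF ih]) (use chi in \<open>auto simp: mult_left_le_one_le\<close>)
  have J0: "J n \<ge> 0" for n unfolding J_def by (intro integral_nonneg_AE AE_I2 mult_nonneg_nonneg chi) simp
  have main: "J n \<le> D * J n powr (1/p)" for n
  proof -
    define f where "f z = of_real (cut n z) * (h z * of_real (cmod (h z) powr (q - 2)))" for z
    have cf: "continuous_on UNIV f" unfolding f_def
      by (intro continuous_on_mult continuous_on_of_real cchi continuous_on_compose2[OF continuous_on_duality_map[OF q(1)] ch]) auto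
    have supp: "f z = 0" if "norm z > real n + 1" for z using that by (simp add: f_def cut_def)
    obtain M where M: "\<And>z. cmod (f z) \<le> M"
    proof -
      have "compact (f ` cball 0 (real n + 1))"
        by (intro compact_continuous_image continuous_on_subset[OF cf] compact_cball) auto
      then obtain B where B: "\<And>w. w \<in> f ` cball 0 (real n + 1) \<Longrightarrow> norm w \<le> B" "B > 0"
        using compact_imp_bounded bounded_pos by metis
      have "cmod (f z) \<le> B" for z
      proof (cases "norm z > real n + 1")
        case True then show ?thesis using supp B(2) by simp
      next
        case False then show ?thesis by (intro B(1)) auto
      qed
      then show ?thesis by (rule that)
    qed
    have hq: "cmod w powr (q - 2) * (cmod w * cmod w) = cmod w powr q" for w :: complex
    proof (cases "w = 0")
      case False
      then have "cmod w powr (q - 2) * (cmod w powr 1 * cmod w powr 1) = cmod w powr q" by (simp only: powr_add[symmetric]) simp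
      then show ?thesis using False by simp
    qed (use q in simp)
    have fh: "f z * cnj (h z) = of_real (cut n z * norm (h z) powr q)" for z
    proof -
      have "f z * cnj (h z) = of_real (cut n z) * (of_real (cmod (h z) powr (q - 2)) * (h z * cnj (h z)))"
        by (simp add: f_def mult_ac)
      also have "h z * cnj (h z) = of_real (cmod (h z) * cmod (h z))"
        by (simp add: complex_norm_square[symmetric] power2_eq_square[symmetric])
      finally show ?thesis by (simp only: of_real_mult[symmetric] hq)
    qed
    have "(\<integral>z. f z * cnj (h z) \<partial>gauss \<beta>) = of_real (J n)"
      unfolding fh J_def by (rule integral_complex_of_real)
    then have l: "norm (\<integral>z. f z * cnj (h z) \<partial>gauss \<beta>) = J n" using J0 by simp
    have fp: "norm (f z) powr p \<le> cut n z * norm (h z) powr q" for z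
    proof (cases "h z = 0")
      case False
      have "norm (f z) = cut n z * (cmod (h z) powr 1 * cmod (h z) powr (q - 2))"
        using chi False by (simp add: f_def norm_mult)
      also have "cmod (h z) powr 1 * cmod (h z) powr (q - 2) = cmod (h z) powr (q - 1)"
        by (simp only: powr_add[symmetric]) simp
      \<comment> \<open>The exponent is \<open>(q - 1) * p = q\<close>. The power of the cutoff is
        then dropped to the first power, as its values lie in the unit interval and
        \<open>p > 1\<close>.\<close>
      finally have "norm (f z) powr p = cut n z powr p * norm (h z) powr q"
        using chi by (simp add: powr_mult powr_powr q(3))
      also have "\<dots> \<le> cut n z * norm (h z) powr q"
      proof (rule mult_right_mono)
        show "cut n z powr p \<le> cut n z"
          using powr_mono'[of 1 p "cut n z"] chi[of n z] p by simp
      qed simp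
      finally show ?thesis .
    qed (simp add: f_def)
    have "(\<integral>z. norm (f z) powr p \<partial>gauss \<beta>) \<le> J n"
      unfolding J_def
    proof (rule integral_mono'[OF iJ fp])
      show "0 \<le> cut n z * norm (h z) powr q" for z by (intro mult_nonneg_nonneg chi) simp
    qed
    then have r: "(\<integral>z. norm (f z) powr p \<partial>gauss \<beta>) powr (1/p) \<le> J n powr (1/p)"
      using p by (intro powr_mono2) auto
    have "J n \<le> D * (\<integral>z. norm (f z) powr p \<partial>gauss \<beta>) powr (1/p)"
      using dual_bound_compact_support[OF a p pq h cf M supp] unfolding \<beta>_def[symmetric] l D_def .
    also have "\<dots> \<le> D * J n powr (1/p)" by (rule mult_left_mono[OF r D0])
    finally show ?thesis .
  qed
  have Jq: "J n powr (1/q) \<le> D" for n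
  proof (cases "J n = 0")
    case True then show ?thesis using D0 by simp
  next
    case False
    then have Jp: "J n > 0" using J0[of n] by simp
    have "J n powr (1/q) * J n powr (1/p) = J n"
      using Jp pq by (simp add: powr_add[symmetric] add.commute)
    then have "J n powr (1/q) * J n powr (1/p) \<le> D * J n powr (1/p)" using main[of n] by simp
    then show ?thesis using Jp by simp
  qed
  have "J \<longlonglongrightarrow> (\<integral>z. norm (h z) powr q \<partial>gauss \<beta>)"
    unfolding J_def
  proof (rule integral_dominated_convergence[OF _ _ ih])
    show "AE z in gauss \<beta>. (\<lambda>n. cut n z * norm (h z) powr q) \<longlonglongrightarrow> norm (h z) powr q"
    proof (rule AE_I2)
      fix z :: "complex^'n"
      have "eventually (\<lambda>n. cut n z * norm (h z) powr q = norm (h z) powr q) sequentially"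
        using eventually_ge_at_top[of "nat \<lceil>norm z\<rceil>"]
      proof eventually_elim
        case (elim n)
        then have "norm z \<le> real n" by linarith
        then have "cut n z = 1" by (simp add: cut_def)
        then show ?case by simp
      qed
      then show "(\<lambda>n. cut n z * norm (h z) powr q) \<longlonglongrightarrow> norm (h z) powr q"
        by (rule tendsto_eventually)
    qed
    show "AE z in gauss \<beta>. norm (cut n z * norm (h z) powr q) \<le> norm (h z) powr q" for n
      using chi by (intro AE_I2) (simp add: mult_left_le_one_le)
  qed measurable
  then have "(\<lambda>n. J n powr (1/q)) \<longlonglongrightarrow> (\<integral>z. norm (h z) powr q \<partial>gauss \<beta>) powr (1/q)"
    using q(1) J0 by (intro tendsto_powr2 tendsto_const) (auto intro!: always_eventually)
  then have "(\<integral>z. norm (h z) powr q \<partial>gauss \<beta>) powr (1/q) \<le> D"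
    by (rule LIMSEQ_le_const2) (use Jq in blast)
  then show ?thesis by (simp add: fock_norm_def D_def \<beta>_def)
qed

section \<open>The constant function as extremal function, and the conclusion\<close>

lemma dual_norm_one:
  assumes a: "a > 0" and p: "1 < p" and pq: "1 / p + 1 / q = 1"
  shows "dual_norm p a (\<lambda>_::complex^'n. 1) = 1"
proof (rule antisym)
  note q = conj_exponent[OF p pq]
  have one: "(\<lambda>_. 1) \<in> (fock_space q a :: (complex^'n \<Rightarrow> complex) set)"
    using fock_space_one(1)[of a q] a q(1) by simp
  have "fock_norm q a (\<lambda>_::complex^'n. 1) \<le> dual_norm p a (\<lambda>_::complex^'n. 1)"
    by (rule fock_norm_le_dual[OF a p pq one])
  then show "1 \<le> dual_norm p a (\<lambda>_::complex^'n. 1)"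
    using fock_space_one(2)[of a q, where 'n = 'n] a q(1) by simp
  have ne: "(\<lambda>_. 1) \<in> fock_space p a - {\<lambda>_::complex^'n. 0 :: complex}"
    using fock_space_one(1)[of a p] a p by (auto dest: fun_cong)
  show "dual_norm p a (\<lambda>_::complex^'n. 1) \<le> 1"
    unfolding dual_norm_def
  proof (rule cSUP_least)
    fix g assume g: "g \<in> fock_space p a - {\<lambda>_::complex^'n. 0 :: complex}"
    then have hg: "holo_Cn g" and gs: "g \<in> fock_space p a" by (auto simp: fock_space_iff)
    have "integrable (gauss a) (\<lambda>z. g z * cnj 1)" by (rule fock_pair_young(1)[OF a p pq gs one])
    then have "fock_pair a g (\<lambda>_. 1) = g 0"
      unfolding fock_pair_def using gauss_mean_value[OF a hg] by simp
    moreover have "norm (g 0) \<le> fock_norm p a g" using fock_pointwise_bound[OF a p gs, of 0] by simp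
    ultimately show "norm (fock_pair a g (\<lambda>_. 1)) / fock_norm p a g \<le> 1"
      using fock_norm_pos[OF a p g] by simp
  qed (use ne in blast)
qed

theorem theorem1p2:
  fixes a p q :: real
  assumes "a > 0" and "1 < p" and "1 / p + 1 / q = 1"
  shows "(INF h \<in> (fock_space q a :: (complex^'n \<Rightarrow> complex) set) - {\<lambda>_. 0}.
            dual_norm p a h / fock_norm q a h) = 1
       \<and> (\<forall>(z :: complex^'n). \<forall>g \<in> fock_space p a.
            norm (g z) \<le> exp (a / 2 * (norm z)\<^sup>2) * fock_norm p a g)"
proof
  note q = conj_exponent[OF assms(2,3)]
  have one: "(\<lambda>_. 1) \<in> (fock_space q a :: (complex^'n \<Rightarrow> complex) set) - {\<lambda>_. 0}"
    using fock_space_one(1)[of a q] assms(1) q(1) by (auto dest: fun_cong)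
  have val: "dual_norm p a (\<lambda>_::complex^'n. 1) / fock_norm q a (\<lambda>_::complex^'n. 1) = 1"
    using dual_norm_one[OF assms] fock_space_one(2)[of a q, where 'n = 'n] assms(1) q(1) by simp
  show "(INF h \<in> (fock_space q a :: (complex^'n \<Rightarrow> complex) set) - {\<lambda>_. 0}. dual_norm p a h / fock_norm q a h) = 1"
  \<comment> \<open>The infimum is a minimum, attained at the constant 1, so no minimising sequence
    is involved.\<close>
  proof (rule cInf_eq_minimum)
    show "1 \<in> (\<lambda>h. dual_norm p a h / fock_norm q a h) ` ((fock_space q a :: (complex^'n \<Rightarrow> complex) set) - {\<lambda>_. 0})"
      using one val by (metis (no_types, lifting) image_eqI)
    fix y assume "y \<in> (\<lambda>h. dual_norm p a h / fock_norm q a h) ` ((fock_space q a :: (complex^'n \<Rightarrow> complex) set) - {\<lambda>_. 0})"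
    then obtain h where h: "h \<in> (fock_space q a :: (complex^'n \<Rightarrow> complex) set) - {\<lambda>_. 0}" and y: "y = dual_norm p a h / fock_norm q a h"
      by blast
    have "fock_norm q a h > 0" by (rule fock_norm_pos[OF assms(1) q(1) h])
    then show "1 \<le> y" unfolding y using fock_norm_le_dual[OF assms, of h] h by simp
  qed
  show "\<forall>(z :: complex^'n). \<forall>g \<in> fock_space p a. norm (g z) \<le> exp (a / 2 * (norm z)\<^sup>2) * fock_norm p a g"
    using fock_pointwise_bound[OF assms(1,2)] by blast
qed

end
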